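(* Let $\{(\mathbf{x}_i,y_i)\}_{i=1}^n$ be independent observations from the $k$-sample linear regression model described in the context. Suppose that: for every $1\le j\le k$ the sample size $n_j$ is divisible by the window size $n_0$; the predictor $\mathbf{x}$, the intercept $\nu$ and the error $\varepsilon$ are mutually independent; $\{\mathbf{x}_i\}_{i=1}^n$ are i.i.d. with $\mathbb{E}[\|\mathbf{x}\|^3]<\infty$ and the covariance matrix $\bm{\Sigma}_{\mathbf{xx}}=\mathrm{Var}(\mathbf{x})=\mathbb{E}[(\mathbf{x}-\mathbb{E}[\mathbf{x}])(\mathbf{x}-\mathbb{E}[\mathbf{x}])^{\top}]$ is positive definite; and, as $n\to\infty$, $n_0$ is fixed and $T=n/n_0\to\infty$. Then the EM estimator $\hat{\bm{\beta}}_{\mathrm{EM}}$ satisfies $$\sqrt{n}\bigl(\hat{\bm{\beta}}_{\mathrm{EM}}-\bm{\beta}\bigr)\xrightarrow{d}\mathcal{N}\Bigl(\mathbf{0},\ \frac{n_0}{n_0-1}\,\tilde{\sigma}_T^2\,\bm{\Sigma}_{\mathbf{xx}}^{-1}\Bigr)\quad\text{as } n\to\infty,$$ where $\tilde{\sigma}_T^2=\frac1T\sum_{j=1}^T\tau_j^2\in[\underline{\sigma}^2,\overline{\sigma}^2]$ and $\tau_j^2$ is the error variance within the $j$th window.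
   Context: Model. The observations satisfy $y_i=\mathbf{x}_i^{\top}\bm{\beta}+\nu_i+\varepsilon_i$, $i=1,\dots,n$, with $\bm{\beta}\in\mathbb{R}^p$ the vector of regression coefficients, $\mathbf{x}_i\in\mathbb{R}^p$ predictors having a certain distribution $F_{\mathbf{x}}$ ($\mathbf{x}$ denotes a generic predictor vector), $\nu_i$ a random intercept and $\varepsilon_i$ an error; the pairs $(\mathbf{x}_i,y_i)$ are independent across $i$. The data consist of $k$ consecutive samples (groups), the $j$th of size $n_j$, with $\sum_{j=1}^k n_j=n$. For every index $i$ in the $j$th sample, $\nu_i$ follows the one-point distribution at $c_j$, where $c_j\in[\underline{\mu},\overline{\mu}]$ with $\underline{\mu}=\min_{1\le j\le k} c_j$ and $\overline{\mu}=\max_{1\le j\le k} c_j$, and $\varepsilon_i\sim\mathcal{N}(0,\sigma_j^2)$ with $\sigma_j\in[\underline{\sigma},\overline{\sigma}]$, $0<\underline{\sigma}\le\overline{\sigma}<\infty$. The number of samples and the locations of the change points between them are not known. Windows. $n_0$ is a positive integer (small window size) with $n_0<\min_{1\le j\le k} n_j$, and $T=n/n_0$. The $j$th window is the index set $\{1+(j-1)n_0,\dots,jn_0\}$, $1\le j\le T$. Since $n_0$ divides every $n_j$, window $j$ lies in a single sample, with index $g(j)\in\{1,\dots,k\}$, and $\tau_j^2=\sigma_{g(j)}^2$. EM estimator. Starting from an initial $\bm{\beta}^{(0)}$, the algorithm alternates: (E-step) given $\bm{\beta}^{(s)}$, set $a_j=\frac1{n_0}\sum_{i=1+(j-1)n_0}^{jn_0}(y_i-\mathbf{x}_i^{\top}\bm{\beta}^{(s)})$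 and $\nu_i^{(s+1)}=a_j$ for all $i$ in window $j$, $1\le j\le T$; (M-step) let $\bm{\beta}^{(s+1)}$ minimize $\sum_{i=1}^n\{y_i-(\mathbf{x}_i^{\top}\bm{\beta}+\nu_i^{(s+1)})\}^2$ over $\bm{\beta}$, i.e. solve $\sum_{i=1}^n\{y_i-(\mathbf{x}_i^{\top}\bm{\beta}^{(s+1)}+\nu_i^{(s+1)})\}\mathbf{x}_i=\mathbf{0}$. The EM estimator $\hat{\bm{\beta}}_{\mathrm{EM}}$ is the value upon convergence, which together with numbers $\hat a_1,\dots,\hat a_T$ satisfies both $$\sum_{i=1+(j-1)n_0}^{jn_0}(y_i-\hat a_j-\mathbf{x}_i^{\top}\hat{\bm{\beta}}_{\mathrm{EM}})=0\ (1\le j\le T),\qquad \sum_{j=1}^T\sum_{i=1+(j-1)n_0}^{jn_0}(y_i-\hat a_j-\mathbf{x}_i^{\top}\hat{\bm{\beta}}_{\mathrm{EM}})\mathbf{x}_i=\mathbf{0}.$$ *)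

theory Defs
  imports "HOL-Probability.Probability"
begin

text \<open>All index sets are 0-based: observations \<open>i < n\<close>, samples \<open>g < k\<close>, windows \<open>j < T\<close>.\<close>

section \<open>Random vectors\<close>

definition pos_def :: "real^'p^'p \<Rightarrow> bool" where
  "pos_def A \<longleftrightarrow> transpose A = A \<and> (\<forall>v. v \<noteq> 0 \<longrightarrow> v \<bullet> (A *v v) > 0)"

definition mean_vec :: "(real^'p) measure \<Rightarrow> real^'p" where
  "mean_vec F = (LINT u|F. u)"

definition cov_mat :: "(real^'p) measure \<Rightarrow> real^'p^'p" where
  "cov_mat F = (\<chi> i j. LINT u|F. (u $ i - mean_vec F $ i) * (u $ j - mean_vec F $ j))"

text \<open>The normal law \<open>N(m, V)\<close>; meaningful for positive definite \<open>V\<close> only.\<close>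

definition mv_normal :: "real^'p \<Rightarrow> real^'p^'p \<Rightarrow> (real^'p) measure" where
  "mv_normal m V = density lborel (\<lambda>u. ennreal
     (exp (- ((u - m) \<bullet> (matrix_inv V *v (u - m))) / 2) / sqrt ((2 * pi) ^ CARD('p) * det V)))"

text \<open>Convergence in distribution towards a sequence of laws \<open>Q m\<close>, for statements whose
  right-hand side depends on the sample size. For a constant sequence \<open>Q\<close> this is weak
  convergence in the usual sense (convergence of integrals of bounded continuous functions).\<close>

definition conv_in_distr :: "(nat \<Rightarrow> 'b::topological_space measure) \<Rightarrow> (nat \<Rightarrow> 'b measure) \<Rightarrow> bool" where
  "conv_in_distr P Q \<longleftrightarrow>
     (\<forall>f :: 'b \<Rightarrow> real. continuous_on UNIV f \<longrightarrow> bounded (range f) \<longrightarrow>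
        (\<lambda>m. (LINT u|P m. f u) - (LINT u|Q m. f u)) \<longlonglongrightarrow> 0)"

section \<open>The k-sample regression model\<close>

definition sample_block :: "(nat \<Rightarrow> nat) \<Rightarrow> nat \<Rightarrow> nat set" where
  "sample_block ns g = {(\<Sum>l<g. ns l)..<(\<Sum>l<Suc g. ns l)}"

definition total_size :: "nat \<Rightarrow> (nat \<Rightarrow> nat) \<Rightarrow> nat" where
  "total_size k ns = (\<Sum>g<k. ns g)"

text \<open>\<open>F\<close> is the law of the predictors; \<open>c g\<close> and \<open>\<sigma> g\<close> are the random-intercept location and
  the error standard deviation in sample \<open>g\<close>. The bounds on \<open>c g\<close> by the minimum and
  maximum of the \<open>c g\<close> are tautological. Mutual independence of predictor, intercept and
  error is written out because \<open>indep_vars\<close> requires a common codomain type.\<close>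

locale k_sample_model = prob_space M
  for M :: "'a measure" and k :: nat and ns :: "nat \<Rightarrow> nat" and c \<sigma> :: "nat \<Rightarrow> real"
    and \<beta> :: "real^'p" and F :: "(real^'p) measure"
    and x :: "nat \<Rightarrow> 'a \<Rightarrow> real^'p" and \<nu> \<epsilon> y :: "nat \<Rightarrow> 'a \<Rightarrow> real" +
  assumes k_pos: "k \<ge> 1"
    and response: "\<And>i \<omega>. i < total_size k ns \<Longrightarrow> \<omega> \<in> space M \<Longrightarrow>
          y i \<omega> = x i \<omega> \<bullet> \<beta> + \<nu> i \<omega> + \<epsilon> i \<omega>"
    and indep_observations: "indep_vars (\<lambda>_. borel \<Otimes>\<^sub>M borel) (\<lambda>i \<omega>. (x i \<omega>, y i \<omega>)) {..<total_size k ns}"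
    and indep_predictors: "indep_vars (\<lambda>_. borel) x {..<total_size k ns}"
    and predictor_law: "\<And>i. i < total_size k ns \<Longrightarrow> distr M borel (x i) = F"
    and measurable_components: "\<And>i. i < total_size k ns \<Longrightarrow>
          x i \<in> borel_measurable M \<and> \<nu> i \<in> borel_measurable M \<and> \<epsilon> i \<in> borel_measurable M"
    and mutually_indep: "\<And>i A B C. i < total_size k ns \<Longrightarrow>
          A \<in> sets borel \<Longrightarrow> B \<in> sets borel \<Longrightarrow> C \<in> sets borel \<Longrightarrow>
          prob {\<omega> \<in> space M. x i \<omega> \<in> A \<and> \<nu> i \<omega> \<in> B \<and> \<epsilon> i \<omega> \<in> C}
            = prob {\<omega> \<in> space M. x i \<omega> \<in> A} * prob {\<omega> \<in> space M. \<nu> i \<omega> \<in> B}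
                * prob {\<omega> \<in> space M. \<epsilon> i \<omega> \<in> C}"
    and intercept_law: "\<And>g i. g < k \<Longrightarrow> i \<in> sample_block ns g \<Longrightarrow> distr M borel (\<nu> i) = return borel (c g)"
    and error_law: "\<And>g i. g < k \<Longrightarrow> i \<in> sample_block ns g \<Longrightarrow>
          distributed M lborel (\<epsilon> i) (normal_density 0 (\<sigma> g))"

section \<open>Windows and the EM estimator\<close>

definition window :: "nat \<Rightarrow> nat \<Rightarrow> nat set" where
  "window n0 j = {j * n0..<Suc j * n0}"

definition window_sample :: "nat \<Rightarrow> (nat \<Rightarrow> nat) \<Rightarrow> nat \<Rightarrow> nat \<Rightarrow> nat" where
  "window_sample k ns n0 j = (THE g. g < k \<and> window n0 j \<subseteq> sample_block ns g)"

text \<open>The average over the windows of the within-window error variances.\<close>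

definition avg_window_var :: "nat \<Rightarrow> (nat \<Rightarrow> nat) \<Rightarrow> (nat \<Rightarrow> real) \<Rightarrow> nat \<Rightarrow> real" where
  "avg_window_var k ns \<sigma> n0 =
     (let T = total_size k ns div n0 in (\<Sum>j<T. (\<sigma> (window_sample k ns n0 j))\<^sup>2) / real T)"

definition E_step :: "nat \<Rightarrow> (nat \<Rightarrow> real^'p) \<Rightarrow> (nat \<Rightarrow> real) \<Rightarrow> real^'p \<Rightarrow> nat \<Rightarrow> real" where
  "E_step n0 x y b j = (\<Sum>i\<in>window n0 j. y i - x i \<bullet> b) / real n0"

text \<open>Observation \<open>i\<close> lies in window \<open>i div n0\<close>. The minimiser in the M-step need not be unique,
  so it is a relation.\<close>

definition M_step :: "nat \<Rightarrow> nat \<Rightarrow> (nat \<Rightarrow> real^'p) \<Rightarrow> (nat \<Rightarrow> real) \<Rightarrow> (nat \<Rightarrow> real) \<Rightarrow> real^'p \<Rightarrow> bool" where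
  "M_step n0 n x y a b' \<longleftrightarrow>
     is_arg_min (\<lambda>b. \<Sum>i<n. (y i - (x i \<bullet> b + a (i div n0)))\<^sup>2) (\<lambda>_. True) b'"

text \<open>A value upon convergence of the EM iteration, for some initial value \<open>b 0\<close>.\<close>

definition EM_estimate :: "nat \<Rightarrow> nat \<Rightarrow> (nat \<Rightarrow> real^'p) \<Rightarrow> (nat \<Rightarrow> real) \<Rightarrow> real^'p \<Rightarrow> bool" where
  "EM_estimate n0 n x y bhat \<longleftrightarrow>
     (\<exists>b. (\<forall>s. M_step n0 n x y (E_step n0 x y (b s)) (b (Suc s))) \<and> b \<longlonglongrightarrow> bhat)"

lemma M_step_iff:
  "M_step n0 n x y a b' \<longleftrightarrow> (\<Sum>i<n. (y i - (x i \<bullet> b' + a (i div n0))) *\<^sub>R x i) = 0"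
proof -
  define r where "r i = y i - (x i \<bullet> b' + a (i div n0))" for i
  define v where "v = (\<Sum>i<n. r i *\<^sub>R x i)"
  have expand: "(\<Sum>i<n. (y i - (x i \<bullet> (b' + d) + a (i div n0)))\<^sup>2)
      = (\<Sum>i<n. (r i)\<^sup>2) - 2 * (v \<bullet> d) + (\<Sum>i<n. (x i \<bullet> d)\<^sup>2)" for d
  proof -
    have "(\<Sum>i<n. (y i - (x i \<bullet> (b' + d) + a (i div n0)))\<^sup>2)
        = (\<Sum>i<n. (r i)\<^sup>2 - 2 * (r i * (x i \<bullet> d)) + (x i \<bullet> d)\<^sup>2)"
      by (intro sum.cong refl) (simp add: r_def inner_add_right power2_eq_square algebra_simps)
    also have "\<dots> = (\<Sum>i<n. (r i)\<^sup>2) - 2 * (v \<bullet> d) + (\<Sum>i<n. (x i \<bullet> d)\<^sup>2)"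
      by (simp add: v_def sum.distrib sum_subtractf inner_sum_left sum_distrib_left)
    finally show ?thesis .
  qed
  have base: "(\<Sum>i<n. (y i - (x i \<bullet> b' + a (i div n0)))\<^sup>2) = (\<Sum>i<n. (r i)\<^sup>2)"
    by (simp add: r_def)
  have shift: "(\<forall>b. P b) \<longleftrightarrow> (\<forall>d. P (b' + d))" for P
    by (metis add_diff_cancel_left' diff_add_cancel add.commute)
  have "M_step n0 n x y a b' \<longleftrightarrow> (\<forall>d. 2 * (v \<bullet> d) \<le> (\<Sum>i<n. (x i \<bullet> d)\<^sup>2))"
  proof -
    have "M_step n0 n x y a b' \<longleftrightarrow>
      (\<forall>b. (\<Sum>i<n. (r i)\<^sup>2) \<le> (\<Sum>i<n. (y i - (x i \<bullet> b + a (i div n0)))\<^sup>2))"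
      unfolding M_step_def is_arg_min_def base by (simp add: not_less)
    also have "\<dots> \<longleftrightarrow> (\<forall>d. 2 * (v \<bullet> d) \<le> (\<Sum>i<n. (x i \<bullet> d)\<^sup>2))"
      unfolding shift[of "\<lambda>b. (\<Sum>i<n. (r i)\<^sup>2) \<le> (\<Sum>i<n. (y i - (x i \<bullet> b + a (i div n0)))\<^sup>2)"] expand
      by (simp add: algebra_simps)
    finally show ?thesis .
  qed
  also have "\<dots> \<longleftrightarrow> v = 0"
  proof
    assume *: "\<forall>d. 2 * (v \<bullet> d) \<le> (\<Sum>i<n. (x i \<bullet> d)\<^sup>2)"
    define q where "q = (\<Sum>i<n. (x i \<bullet> v)\<^sup>2)"
    have q: "q \<ge> 0" by (simp add: q_def sum_nonneg)
    have le: "2 * (t * (v \<bullet> v)) \<le> t\<^sup>2 * q" for t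
      using *[rule_format, of "t *\<^sub>R v"]
      by (simp add: q_def power_mult_distrib sum_distrib_left)
    have 1: "2 * (v \<bullet> v) \<le> t * q" if "t > 0" for t
      using le[of t] that by (simp add: power2_eq_square algebra_simps)
    have "2 * (v \<bullet> v) \<le> 0"
    proof (rule field_le_epsilon)
      fix e :: real assume e: "e > 0"
      have "2 * (v \<bullet> v) \<le> (e / (q + 1)) * q" using 1[of "e / (q+1)"] e q by simp
      also have "\<dots> \<le> e" using e q by (simp add: field_simps)
      finally show "2 * (v \<bullet> v) \<le> 0 + e" by simp
    qed
    hence "v \<bullet> v = 0" using inner_ge_zero[of v] by linarith
    thus "v = 0" by simp
  qed (simp add: sum_nonneg)
  finally show ?thesis by (simp add: v_def r_def)
qed

lemma E_step_iff:
  assumes "n0 > 0"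
  shows "a = E_step n0 x y b j \<longleftrightarrow> (\<Sum>i\<in>window n0 j. y i - a - x i \<bullet> b) = 0"
proof -
  have "(\<Sum>i\<in>window n0 j. y i - a - x i \<bullet> b) = (\<Sum>i\<in>window n0 j. y i - x i \<bullet> b) - real n0 * a"
    by (simp add: sum_subtractf sum.distrib window_def algebra_simps)
  thus ?thesis using assms by (auto simp: E_step_def field_simps)
qed

lemma EM_estimate_iff:
  "EM_estimate n0 n x y bhat \<longleftrightarrow> M_step n0 n x y (E_step n0 x y bhat) bhat"
proof
  assume "M_step n0 n x y (E_step n0 x y bhat) bhat"
  thus "EM_estimate n0 n x y bhat"
    unfolding EM_estimate_def by (intro exI[of _ "\<lambda>_. bhat"]) simp
next
  assume "EM_estimate n0 n x y bhat"
  then obtain b where step: "\<And>s. M_step n0 n x y (E_step n0 x y (b s)) (b (Suc s))"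
    and lim: "b \<longlonglongrightarrow> bhat" unfolding EM_estimate_def by auto
  have lim': "(\<lambda>s. b (Suc s)) \<longlonglongrightarrow> bhat" using lim by (rule LIMSEQ_Suc)
  have "(\<lambda>s. \<Sum>i<n. (y i - (x i \<bullet> b (Suc s) + E_step n0 x y (b s) (i div n0))) *\<^sub>R x i)
      \<longlonglongrightarrow> (\<Sum>i<n. (y i - (x i \<bullet> bhat + E_step n0 x y bhat (i div n0))) *\<^sub>R x i)"
    unfolding E_step_def divide_inverse by (intro tendsto_intros lim lim')
  moreover have "(\<Sum>i<n. (y i - (x i \<bullet> b (Suc s) + E_step n0 x y (b s) (i div n0))) *\<^sub>R x i) = 0" for s
    using step[of s] unfolding M_step_iff .
  ultimately show "M_step n0 n x y (E_step n0 x y bhat) bhat"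
    unfolding M_step_iff by (simp add: LIMSEQ_const_iff)
qed

text \<open>The values upon convergence are exactly the solutions of the estimating equations.\<close>

lemma EM_estimate_iff_estimating_equations:
  assumes n0: "n0 > 0"
  shows "EM_estimate n0 (T * n0) x y bhat \<longleftrightarrow>
    (\<exists>a. (\<forall>j<T. (\<Sum>i\<in>window n0 j. y i - a j - x i \<bullet> bhat) = 0) \<and>
         (\<Sum>j<T. \<Sum>i\<in>window n0 j. (y i - a j - x i \<bullet> bhat) *\<^sub>R x i) = 0)"
proof -
  have split: "(\<Sum>i<T * n0. h i) = (\<Sum>j<T. \<Sum>i\<in>window n0 j. h i)" for h :: "nat \<Rightarrow> real^'p"
  proof (induction T)
    case (Suc T)
    have "{..<Suc T * n0} = {..<T * n0} \<union> window n0 T"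
      by (auto simp: window_def)
    moreover have "(\<Sum>i\<in>{..<T * n0} \<union> window n0 T. h i) = (\<Sum>i<T * n0. h i) + (\<Sum>i\<in>window n0 T. h i)"
      by (intro sum.union_disjoint) (auto simp: window_def)
    ultimately show ?case using Suc by simp
  qed simp
  have idx: "i div n0 = j" if "i \<in> window n0 j" for i j
    using that n0 by (auto simp: window_def intro!: div_nat_eqI simp: algebra_simps)
  have eq: "(\<Sum>i<T * n0. (y i - (x i \<bullet> bhat + a (i div n0))) *\<^sub>R x i)
      = (\<Sum>j<T. \<Sum>i\<in>window n0 j. (y i - a j - x i \<bullet> bhat) *\<^sub>R x i)" for a
    unfolding split by (intro sum.cong refl) (simp add: idx algebra_simps)
  show ?thesis
    unfolding EM_estimate_iff M_step_iff eq
  proof safe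
    assume "(\<Sum>j<T. \<Sum>i\<in>window n0 j. (y i - E_step n0 x y bhat j - x i \<bullet> bhat) *\<^sub>R x i) = 0"
    thus "\<exists>a. (\<forall>j<T. (\<Sum>i\<in>window n0 j. y i - a j - x i \<bullet> bhat) = 0) \<and>
         (\<Sum>j<T. \<Sum>i\<in>window n0 j. (y i - a j - x i \<bullet> bhat) *\<^sub>R x i) = 0"
      by (intro exI[of _ "E_step n0 x y bhat"]) (simp add: E_step_iff[OF n0, symmetric])
  next
    fix a assume a: "\<forall>j<T. (\<Sum>i\<in>window n0 j. y i - a j - x i \<bullet> bhat) = 0"
      and e: "(\<Sum>j<T. \<Sum>i\<in>window n0 j. (y i - a j - x i \<bullet> bhat) *\<^sub>R x i) = 0"
    have "a j = E_step n0 x y bhat j" if "j < T" for j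
      using a that by (simp add: E_step_iff[OF n0])
    thus "(\<Sum>j<T. \<Sum>i\<in>window n0 j. (y i - E_step n0 x y bhat j - x i \<bullet> bhat) *\<^sub>R x i) = 0"
      using e by simp
  qed
qed

end

theory Submission
  imports Defs
begin

text \<open>
  The estimating equations, centred within windows, say that \<open>b - \<beta>\<close> solves a linear system
  \<open>A (b - \<beta>) = \<Sum>\<^sub>i e\<^sub>i d\<^sub>i\<close>, where \<open>d\<^sub>i\<close> is the deviation of the predictor
  from its window mean and \<open>A = \<Sum>\<^sub>i d\<^sub>i d\<^sub>i\<^sup>T\<close>: centring removes the intercepts, which are
  constant on windows (\<open>EM_estimate_normal_equations\<close>).

  The errors are exactly normal and independent of the predictors. Given the predictors,
  \<open>sqrt n (b - \<beta>)\<close> is a linear combination of independent centred normal variables,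
  so as soon as \<open>A\<close> is invertible it is exactly normal, and its covariance is
  \<open>V = n A\<^sup>-\<^sup>1 B A\<^sup>-\<^sup>1\<close> with \<open>B = \<Sum>\<^sub>i \<sigma>\<^sub>i\<^sup>2 d\<^sub>i d\<^sub>i\<^sup>T\<close>
  (\<open>conditional_covariance\<close>, \<open>integral_sum_normals\<close>). Randomness enters the limit only
  through \<open>A\<close> and \<open>B\<close>. Both are sums over windows of independent, identically distributed
  scatter matrices with mean \<open>(n0 - 1) \<Sigma>\<close>, in the case of \<open>B\<close> with bounded weights,
  so by a weak law of large numbers \<open>A / (T (n0 - 1))\<close> is close to \<open>\<Sigma>\<close> and
  \<open>B / (T (n0 - 1))\<close> is close to \<open>t \<Sigma>\<close>, where \<open>t\<close> is the average window
  variance (\<open>expected_scatter_deviation_tendsto_0\<close>). Hence \<open>V\<close> is close to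
  \<open>n0 / (n0 - 1) t \<Sigma>\<^sup>-\<^sup>1\<close>. The integral of a bounded continuous function against a
  centred normal law is a continuous function of the covariance (\<open>gauss_mean_tendsto\<close>), and
  \<open>t\<close> stays in a compact interval, so this closeness is inherited, uniformly in \<open>t\<close>, by
  the expectations that define convergence in distribution (\<open>EM_error_bound\<close>).

  The normality of linear combinations is obtained with densities alone. Adding a single
  multiple \<open>s a\<close> of a standard normal variable changes the covariance by the rank-one matrix
  \<open>s\<^sup>2 a a\<^sup>T\<close>; completing the square turns this into the Sherman--Morrison formula and the
  matrix determinant lemma (\<open>mv_normal_density_rank_one\<close>). Induction then starts from a normal
  vector with covariance \<open>d\<^sup>2 I\<close>, which is finally made to vanish by letting \<open>d\<close>
  tend to \<open>0\<close>.
\<close>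

section \<open>Inverses, determinants and positive definite matrices\<close>

lemma matrix_inv_eqI:
  fixes A B :: "real^'p^'p"
  assumes "A ** B = mat 1"
  shows "matrix_inv A = B"
proof -
  have "B ** A = mat 1" using assms matrix_left_right_inverse by blast
  with assms have "A ** matrix_inv A = mat 1"
    unfolding matrix_inv_def by (metis (mono_tags, lifting) someI_ex)
  then have "B ** (A ** matrix_inv A) = B" by simp
  then show ?thesis by (simp add: matrix_mul_assoc \<open>B ** A = mat 1\<close>)
qed

lemma matrix_inv_mult:
  fixes A :: "real^'p^'p"
  assumes "det A \<noteq> 0"
  shows "A ** matrix_inv A = mat 1" and "matrix_inv A ** A = mat 1"
proof -
  obtain B where B: "A ** B = mat 1" "B ** A = mat 1"
    using assms unfolding invertible_det_nz[symmetric] invertible_def by blast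
  then show "A ** matrix_inv A = mat 1" "matrix_inv A ** A = mat 1"
    using matrix_inv_eqI[OF B(1)] by simp_all
qed

lemma matrix_inv_vector_mult:
  fixes A :: "real^'p^'p"
  assumes "det A \<noteq> 0"
  shows "A *v (matrix_inv A *v v) = v" and "matrix_inv A *v (A *v v) = v"
  using matrix_inv_mult[OF assms] by (simp_all add: matrix_vector_mul_assoc)

lemma matrix_inv_scaleR:
  fixes A :: "real^'p^'p"
  assumes "det A \<noteq> 0" "c \<noteq> 0"
  shows "matrix_inv (c *\<^sub>R A) = (1 / c) *\<^sub>R matrix_inv A"
proof (rule matrix_inv_eqI, rule matrix_eq[THEN iffD2], rule allI)
  fix v show "(c *\<^sub>R A ** (1 / c) *\<^sub>R matrix_inv A) *v v = mat 1 *v v"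
    using assms matrix_inv_vector_mult(1)[OF assms(1)]
    by (simp add: matrix_vector_mul_assoc[symmetric] scaleR_matrix_vector_assoc[symmetric] matrix_vector_mult_scaleR)
qed

lemma symmetric_inner_matrix_vector:
  fixes A :: "real^'p^'p"
  assumes "transpose A = A"
  shows "v \<bullet> (A *v w) = w \<bullet> (A *v v)"
  by (metis assms dot_lmul_matrix inner_commute vector_transpose_matrix)

lemma transpose_matrix_inv:
  fixes A :: "real^'p^'p"
  assumes "transpose A = A" "det A \<noteq> 0"
  shows "transpose (matrix_inv A) = matrix_inv A"
  using matrix_inv_mult(2)[OF assms(2)]
  by (metis assms(1) matrix_inv_eqI matrix_transpose_mul transpose_mat)

definition outer :: "real^'p \<Rightarrow> real^'p \<Rightarrow> real^'p^'p" where
  "outer a b = (\<chi> i j. a $ i * b $ j)"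

lemma outer_mult_vector: "outer a b *v v = (b \<bullet> v) *\<^sub>R a"
  by (simp add: vec_eq_iff outer_def matrix_vector_mult_def inner_vec_def sum_distrib_left algebra_simps)

text \<open>Every row other than \<open>k\<close> is a unit vector plus a multiple of row \<open>k\<close>. Subtracting these
multiples leaves the identity matrix with \<open>b\<close> in row \<open>k\<close>.\<close>

lemma det_axis_rows_update:
  fixes a b :: "real^'p"
  assumes "finite S" "k \<notin> S"
  shows "det (\<chi> i. if i = k then b else if i \<in> S then axis i 1 + a $ i *s b else axis i 1) = b $ k"
  using assms
proof (induction S)
  case empty
  have rows: "row i (mat 1 :: real^'p^'p) = axis i 1" for i
    by (simp add: vec_eq_iff row_def mat_def axis_def)
  have "(\<Sum>i\<in>UNIV. b $ i *s row i (mat 1 :: real^'p^'p)) = b"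
    unfolding rows by (rule basis_expansion)
  with cramer_lemma_transpose[of k b "mat 1 :: real^'p^'p"]
  have "det (\<chi> i. if i = k then b else axis i 1) = b $ k"
    unfolding rows by (simp only: det_I mult_1_right)
  then show ?case by (simp only: empty_iff if_False)
next
  case (insert l S)
  define A :: "real^'p^'p" where
    "A = (\<chi> i. if i = k then b else if i \<in> S then axis i 1 + a $ i *s b else axis i 1)"
  have row: "row i A = A $ i" for i by (simp add: row_def)
  have "l \<noteq> k" using insert by auto
  then have "det A = det (\<chi> i. if i = l then row l A + a $ l *s row k A else row i A)"
    using det_row_operation[of l k A "a $ l"] by simp
  also have "(\<chi> i. if i = l then row l A + a $ l *s row k A else row i A)
      = (\<chi> i. if i = k then b else if i \<in> insert l S then axis i 1 + a $ i *s b else axis i 1)"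
    using insert \<open>l \<noteq> k\<close> unfolding row by (subst vec_eq_iff) (auto simp: A_def)
  finally show ?case using insert by (simp add: A_def)
qed

text \<open>The rows \<open>e\<^sub>i + a\<^sub>i b\<close> are split one at a time by linearity of the determinant: row
\<open>k\<close> contributes \<open>a\<^sub>k\<close> times the determinant with \<open>b\<close> in that row, which is
\<open>b\<^sub>k\<close>.\<close>

lemma det_mat1_add_outer:
  fixes a b :: "real^'p"
  shows "det (mat 1 + outer a b) = 1 + a \<bullet> b"
proof -
  have "det (\<chi> i. if i \<in> S then axis i 1 + a $ i *s b else axis i 1) = 1 + (\<Sum>i\<in>S. a $ i * b $ i)"
    if "finite S" for S :: "'p set"
    using that
  proof (induction S)
    case empty
    have "(\<chi> i. axis i 1) = (mat 1 :: real^'p^'p)"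
      by (simp add: vec_eq_iff mat_def axis_def)
    then show ?case by simp
  next
    case (insert k S)
    let ?r = "\<lambda>i. if i \<in> S then axis i 1 + a $ i *s b else axis i (1::real)"
    have eq: "(\<chi> i. if i \<in> insert k S then axis i 1 + a $ i *s b else axis i 1)
        = (\<chi> i. if i = k then axis i 1 + a $ i *s b else ?r i)"
      by (subst vec_eq_iff) auto
    have same: "(\<chi> i. if i = k then axis i 1 else ?r i) = (\<chi> i. ?r i)"
      using insert by (subst vec_eq_iff) auto
    have scaled: "(\<chi> i. if i = k then a $ i *s b else ?r i) = (\<chi> i. if i = k then a $ k *s b else ?r i)"
      by (subst vec_eq_iff) auto
    have "det (\<chi> i. if i = k then axis i 1 + a $ i *s b else ?r i)
        = det (\<chi> i. ?r i) + a $ k * b $ k"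
      unfolding det_row_add[of k "\<lambda>i. axis i 1" "\<lambda>i. a $ i *s b" ?r] same scaled
        det_row_mul[of k "a $ k" "\<lambda>_. b" ?r] det_axis_rows_update[OF insert(1,2), of b a] ..
    then show ?case using insert unfolding eq by simp
  qed
  from this[of UNIV] have "det (\<chi> i. axis i 1 + a $ i *s b) = 1 + a \<bullet> b"
    by (simp add: inner_vec_def)
  moreover have "(\<chi> i. axis i 1 + a $ i *s b) = mat 1 + outer a b"
    by (simp add: vec_eq_iff mat_def axis_def outer_def)
  ultimately show ?thesis by simp
qed

text \<open>The matrix determinant lemma, by factoring \<open>W\<close> out on the left.\<close>

lemma det_add_outer:
  fixes W :: "real^'p^'p"
  assumes "det W \<noteq> 0"
  shows "det (W + outer a b) = det W * (1 + b \<bullet> (matrix_inv W *v a))"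
proof -
  have "W ** outer (matrix_inv W *v a) b = outer a b"
  proof (rule matrix_eq[THEN iffD2], rule allI)
    fix v
    show "(W ** outer (matrix_inv W *v a) b) *v v = outer a b *v v"
      using matrix_inv_vector_mult(1)[OF assms]
      by (simp add: matrix_vector_mul_assoc[symmetric] outer_mult_vector matrix_vector_mult_scaleR)
  qed
  then have "W + outer a b = W ** (mat 1 + outer (matrix_inv W *v a) b)"
    by (simp add: matrix_add_ldistrib)
  then show ?thesis by (simp add: det_mul det_mat1_add_outer inner_commute)
qed

text \<open>The Sherman--Morrison formula.\<close>

lemma matrix_inv_add_outer:
  fixes W :: "real^'p^'p"
  assumes "det W \<noteq> 0" and sym: "transpose W = W" and nz: "1 + a \<bullet> (matrix_inv W *v a) * t \<noteq> 0"
  defines "b \<equiv> matrix_inv W *v a"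
  shows "matrix_inv (W + t *\<^sub>R outer a a) = matrix_inv W - (t / (1 + t * (a \<bullet> b))) *\<^sub>R outer b b"
proof (rule matrix_inv_eqI, rule matrix_eq[THEN iffD2], rule allI)
  fix v
  define q where "q = a \<bullet> b"
  have q: "1 + t * q \<noteq> 0" using nz by (simp add: q_def b_def mult.commute)
  have bv: "a \<bullet> (matrix_inv W *v v) = b \<bullet> v"
    using symmetric_inner_matrix_vector[OF transpose_matrix_inv[OF sym assms(1)], of a v]
    by (simp add: b_def inner_commute)
  have Wb: "W *v b = a" using matrix_inv_vector_mult(1)[OF assms(1)] by (simp add: b_def)
  have "(W + t *\<^sub>R outer a a) *v ((matrix_inv W - (t / (1 + t * q)) *\<^sub>R outer b b) *v v)
     = v + (t * (b \<bullet> v) - t / (1 + t * q) * (b \<bullet> v) - t * (t / (1 + t * q)) * (b \<bullet> v) * q) *\<^sub>R a"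
    using matrix_inv_vector_mult(1)[OF assms(1), of v]
    by (simp add: matrix_vector_mult_add_rdistrib matrix_vector_mult_diff_rdistrib
        matrix_vector_mult_diff_distrib scaleR_matrix_vector_assoc[symmetric] outer_mult_vector
        matrix_vector_mult_scaleR Wb inner_diff_right bv q_def[symmetric] algebra_simps)
  also have "t * (b \<bullet> v) - t / (1 + t * q) * (b \<bullet> v) - t * (t / (1 + t * q)) * (b \<bullet> v) * q = 0"
    using q by (simp add: field_simps)
  finally show "((W + t *\<^sub>R outer a a) ** (matrix_inv W - (t / (1 + t * (a \<bullet> b))) *\<^sub>R outer b b)) *v v
      = mat 1 *v v"
    by (simp add: matrix_vector_mul_assoc[symmetric] q_def)
qed

lemma det_nonzero_if_kernel_trivial:
  fixes A :: "real^'p^'p"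
  assumes "\<And>v. A *v v = 0 \<Longrightarrow> v = 0"
  shows "det A \<noteq> 0"
  using assms
  by (metis invertible_det_nz invertible_left_inverse matrix_left_invertible_ker)

lemma pos_def_mat1_scaleR: "t > 0 \<Longrightarrow> pos_def (t *\<^sub>R (mat 1 :: real^'p^'p))"
  unfolding pos_def_def by (simp add: transpose_scalar scaleR_matrix_vector_assoc[symmetric])

text \<open>The segment from the identity matrix to \<open>A\<close> consists of positive definite, hence invertible,
matrices, so the determinant has no zero on it and keeps the sign of its value \<open>1\<close> at the
identity.\<close>

lemma det_pos_if_pos_def:
  fixes A :: "real^'p^'p"
  assumes A: "pos_def A"
  shows "det A > 0"
proof (rule ccontr)
  assume "\<not> det A > 0"
  define f where "f s = det ((1 - s) *\<^sub>R mat 1 + s *\<^sub>R A)" for s :: real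
  have "continuous_on {0..1} f" unfolding f_def det_def
    by (intro continuous_intros)
  moreover have "f 0 = 1" "f 1 \<le> 0" using \<open>\<not> det A > 0\<close> by (simp_all add: f_def)
  ultimately obtain s where s: "0 \<le> s" "s \<le> 1" "f s = 0"
    using IVT2'[of f 1 0 0] by auto
  have "det ((1 - s) *\<^sub>R mat 1 + s *\<^sub>R A) \<noteq> 0"
  proof (rule det_nonzero_if_kernel_trivial, rule ccontr)
    fix v assume v: "((1 - s) *\<^sub>R mat 1 + s *\<^sub>R A) *v v = 0" "v \<noteq> 0"
    have "0 = v \<bullet> (((1 - s) *\<^sub>R mat 1 + s *\<^sub>R A) *v v)" using v by simp
    also have "\<dots> = (1 - s) * (v \<bullet> v) + s * (v \<bullet> (A *v v))"
      by (simp add: matrix_vector_mult_add_rdistrib scaleR_matrix_vector_assoc[symmetric] inner_add_right)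
    finally have 0: "(1 - s) * (v \<bullet> v) + s * (v \<bullet> (A *v v)) = 0" by simp
    have p: "v \<bullet> v > 0" "v \<bullet> (A *v v) > 0" using v A by (auto simp: pos_def_def)
    show False
    proof (cases "s = 0")
      case False
      then have "s * (v \<bullet> (A *v v)) > 0" "(1 - s) * (v \<bullet> v) \<ge> 0" using s p by auto
      then show False using 0 by linarith
    qed (use 0 p in auto)
  qed
  then show False using s by (simp add: f_def)
qed

lemma pos_def_add_outer:
  assumes "pos_def W" "t \<ge> 0" shows "pos_def (W + t *\<^sub>R outer a a)"
proof -
  have "transpose (outer a a) = outer a a"
    by (simp add: vec_eq_iff transpose_def outer_def mult.commute)
  moreover have "transpose (W + t *\<^sub>R outer a a) = transpose W + t *\<^sub>R transpose (outer a a)"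
    by (simp add: vec_eq_iff transpose_def)
  moreover have "v \<bullet> ((W + t *\<^sub>R outer a a) *v v) = v \<bullet> (W *v v) + t * (a \<bullet> v)\<^sup>2" for v
    by (simp add: matrix_vector_mult_add_rdistrib scaleR_matrix_vector_assoc[symmetric] outer_mult_vector
        inner_add_right power2_eq_square inner_commute)
  ultimately show ?thesis using assms unfolding pos_def_def
    by (auto intro!: add_pos_nonneg)
qed

lemma pos_def_scaleR: "pos_def V \<Longrightarrow> t > 0 \<Longrightarrow> pos_def (t *\<^sub>R V)"
  unfolding pos_def_def by (simp add: transpose_scalar scaleR_matrix_vector_assoc[symmetric])

lemma sum_matrix_vector_mult: "(\<Sum>i\<in>I. A i) *v v = (\<Sum>i\<in>I. A i *v v)"
  for A :: "'i \<Rightarrow> real^'p^'q"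
  by (induction I rule: infinite_finite_induct) (auto simp: matrix_vector_mult_add_rdistrib)

lemma outer_matrix_vector_mult: "outer (M *v u) (M *v u) = M ** outer u u ** transpose M" for M :: "real^'p^'p"
proof -
  have "outer (M *v u) (M *v u) *v v = (M ** outer u u ** transpose M) *v v" for v
    by (simp add: outer_mult_vector matrix_vector_mul_assoc[symmetric] matrix_vector_mult_scaleR)
       (metis dot_lmul_matrix inner_commute transpose_transpose vector_transpose_matrix)
  then show ?thesis by (simp add: matrix_eq)
qed

lemma matrix_mult_sum_left: "M ** (\<Sum>i\<in>I. A i) = (\<Sum>i\<in>I. M ** A i)" for M :: "real^'p^'q"
  by (induction I rule: infinite_finite_induct) (auto simp: matrix_add_ldistrib)

lemma matrix_mult_sum_right: "(\<Sum>i\<in>I. A i) ** M = (\<Sum>i\<in>I. A i ** M)" for M :: "real^'p^'q"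
  by (induction I rule: infinite_finite_induct) (auto simp: matrix_matrix_mult_def vec_eq_iff sum.distrib distrib_right)

lemma transpose_outer_sum:
  "transpose (\<Sum>i\<in>I. t i *\<^sub>R outer (a i) (a i)) = (\<Sum>i\<in>I. t i *\<^sub>R outer (a i) (a i))" for a :: "'i \<Rightarrow> real^'p"
  by (simp add: vec_eq_iff transpose_def outer_def mult.commute)

lemma tendsto_matrix_vector_mult:
  fixes V :: "real^'p^'q"
  assumes "(f \<longlongrightarrow> V) F" shows "((\<lambda>x. f x *v u) \<longlongrightarrow> V *v u) F"
  unfolding matrix_vector_mult_def using assms by (intro tendsto_intros)

lemma tendsto_det:
  fixes V :: "real^'p^'p"
  assumes "(f \<longlongrightarrow> V) F" shows "((\<lambda>x. det (f x)) \<longlongrightarrow> det V) F"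
  unfolding det_def using assms by (intro tendsto_intros)

text \<open>Cramer's formula gives an inverse whose entries are visibly continuous and measurable
  functions of the matrix; \<open>matrix_inv\<close> itself is a choice operator.\<close>

definition cramer_inv :: "real^'p^'p \<Rightarrow> real^'p^'p" where
  "cramer_inv A = (\<chi> i j. det (\<chi> k l. if l = i then axis j 1 $ k else A $ k $ l) / det A)"

lemma matrix_inv_eq_cramer_inv:
  fixes A :: "real^'p^'p"
  assumes "det A \<noteq> 0"
  shows "matrix_inv A = cramer_inv A"
proof -
  have "matrix_inv A $ i $ j = det (\<chi> k l. if l = i then axis j 1 $ k else A $ k $ l) / det A" for i j
  proof -
    have "matrix_inv A *v axis j 1 = (\<chi> i. det (\<chi> k l. if l = i then axis j 1 $ k else A $ k $ l) / det A)"
      using cramer[OF assms, of "matrix_inv A *v axis j 1" "axis j 1"] matrix_inv_vector_mult(1)[OF assms] by blast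
    then have "column j (matrix_inv A) $ i = det (\<chi> k l. if l = i then axis j 1 $ k else A $ k $ l) / det A"
      by (simp add: matrix_vector_mul_component matrix_vector_mult_basis)
    then show ?thesis by (simp add: column_def)
  qed
  then show ?thesis by (simp add: vec_eq_iff cramer_inv_def)
qed

lemma tendsto_matrix_inv:
  fixes V :: "real^'p^'p"
  assumes f: "(f \<longlongrightarrow> V) F" and V: "det V \<noteq> 0"
  shows "((\<lambda>x. matrix_inv (f x)) \<longlongrightarrow> matrix_inv V) F"
proof -
  have "((\<lambda>x. \<chi> i j. det (\<chi> k l. if l = i then axis j 1 $ k else f x $ k $ l) / det (f x))
      \<longlongrightarrow> (\<chi> i j. det (\<chi> k l. if l = i then axis j 1 $ k else V $ k $ l) / det V)) F"
  proof (intro tendsto_vec_lambda tendsto_divide tendsto_det f V)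
    fix i j k l
    show "((\<lambda>x. if l = i then axis j 1 $ k else f x $ k $ l) \<longlongrightarrow> (if l = i then axis j 1 $ k else V $ k $ l)) F"
      using f by (cases "l = i") (auto intro!: tendsto_intros)
  qed
  moreover have "\<forall>\<^sub>F x in F. det (f x) \<noteq> 0"
    using tendsto_imp_eventually_ne[OF tendsto_det[OF f] V] .
  then have "\<forall>\<^sub>F x in F. matrix_inv (f x) = (\<chi> i j. det (\<chi> k l. if l = i then axis j 1 $ k else f x $ k $ l) / det (f x))"
    by eventually_elim (rule matrix_inv_eq_cramer_inv[unfolded cramer_inv_def])
  ultimately show ?thesis
    unfolding matrix_inv_eq_cramer_inv[OF V] cramer_inv_def using tendsto_cong by fast
qed

text \<open>Used for differences of matrices: entrywise convergence makes quadratic forms converge uniformly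
relative to \<open>u \<bullet> u\<close>.\<close>

lemma abs_quadratic_form_le:
  fixes A :: "real^'p^'p"
  shows "\<bar>u \<bullet> (A *v u)\<bar> \<le> (\<Sum>i\<in>UNIV. \<Sum>j\<in>UNIV. \<bar>A $ i $ j\<bar>) * (u \<bullet> u)"
proof -
  have uu: "\<bar>u $ i\<bar> * \<bar>u $ j\<bar> \<le> u \<bullet> u" for i j
  proof -
    have "\<bar>u $ i\<bar> * \<bar>u $ j\<bar> \<le> norm u * norm u"
      by (intro mult_mono component_le_norm_cart) auto
    then show ?thesis by (simp add: power2_norm_eq_inner[symmetric] power2_eq_square)
  qed
  have "\<bar>u \<bullet> (A *v u)\<bar> = \<bar>\<Sum>i\<in>UNIV. \<Sum>j\<in>UNIV. u $ i * (A $ i $ j * u $ j)\<bar>"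
    by (simp add: inner_vec_def matrix_vector_mult_def sum_distrib_left)
  also have "\<dots> \<le> (\<Sum>i\<in>UNIV. \<Sum>j\<in>UNIV. \<bar>u $ i * (A $ i $ j * u $ j)\<bar>)"
    by (rule order_trans[OF sum_abs]) (intro sum_mono sum_abs)
  also have "\<dots> \<le> (\<Sum>i\<in>UNIV. \<Sum>j\<in>UNIV. \<bar>A $ i $ j\<bar> * (u \<bullet> u))"
  proof (intro sum_mono)
    fix i j
    show "\<bar>u $ i * (A $ i $ j * u $ j)\<bar> \<le> \<bar>A $ i $ j\<bar> * (u \<bullet> u)"
      using mult_left_mono[OF uu[of i j], of "\<bar>A $ i $ j\<bar>"] by (simp add: abs_mult ac_simps)
  qed
  finally show ?thesis by (simp add: sum_distrib_right)
qed

text \<open>The constant is the minimum of the quadratic form on the unit sphere.\<close>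

lemma pos_def_coercive:
  fixes A :: "real^'p^'p"
  assumes A: "pos_def A"
  obtains c where "c > 0" "\<And>u. u \<bullet> (A *v u) \<ge> c * (u \<bullet> u)"
proof -
  have ne: "sphere (0::real^'p) 1 \<noteq> {}"
    by (auto intro!: exI[of _ "axis undefined 1"])
  have "continuous_on (sphere 0 1) (\<lambda>u. u \<bullet> (A *v u))"
    by (intro continuous_intros matrix_vector_mult_linear_continuous_on)
  then obtain w where w: "w \<in> sphere 0 1" "\<And>u. u \<in> sphere 0 1 \<Longrightarrow> w \<bullet> (A *v w) \<le> u \<bullet> (A *v u)"
    using continuous_attains_inf[OF compact_sphere ne] by blast
  have "w \<noteq> 0" using w(1) by auto
  then have "w \<bullet> (A *v w) > 0" using A by (simp add: pos_def_def)
  moreover have "u \<bullet> (A *v u) \<ge> (w \<bullet> (A *v w)) * (u \<bullet> u)" for u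
  proof (cases "u = 0")
    case False
    have "w \<bullet> (A *v w) \<le> (u /\<^sub>R norm u) \<bullet> (A *v (u /\<^sub>R norm u))"
      using False by (intro w) simp
    also have "\<dots> = (u \<bullet> (A *v u)) / (norm u)\<^sup>2"
      by (simp add: matrix_vector_mult_scaleR power2_eq_square field_simps)
    finally show ?thesis using False by (simp add: field_simps power2_norm_eq_inner[symmetric])
  qed simp
  ultimately show ?thesis by (rule that)
qed

lemma pos_def_matrix_inv:
  assumes A: "pos_def A" shows "pos_def (matrix_inv A)"
proof -
  have d: "det A \<noteq> 0" using det_pos_if_pos_def[OF A] by simp
  have s: "transpose A = A" using A by (simp add: pos_def_def)
  have "v \<bullet> (matrix_inv A *v v) > 0" if "v \<noteq> 0" for v
  proof -
    define w where "w = matrix_inv A *v v"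
    have v: "v = A *v w" by (simp add: w_def matrix_inv_vector_mult[OF d])
    then have "w \<noteq> 0" using that by auto
    then have "w \<bullet> (A *v w) > 0" using A by (simp add: pos_def_def)
    then show ?thesis by (simp add: w_def[symmetric] v[symmetric] inner_commute)
  qed
  then show ?thesis using transpose_matrix_inv[OF s d] by (simp add: pos_def_def)
qed

lemma tendsto_matrix_mult:
  fixes A :: "real^'p^'q" and B :: "real^'r^'p"
  assumes "(f \<longlongrightarrow> A) F" "(g \<longlongrightarrow> B) F" shows "((\<lambda>x. f x ** g x) \<longlongrightarrow> A ** B) F"
  unfolding matrix_matrix_mult_def using assms by (intro tendsto_intros)

section \<open>Normal laws and sums of independent normal variables\<close>

definition mv_normal_density :: "real^'p^'p \<Rightarrow> real^'p \<Rightarrow> real" where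
  "mv_normal_density V u = exp (- (u \<bullet> (matrix_inv V *v u)) / 2) / sqrt ((2 * pi) ^ CARD('p) * det V)"

lemma mv_normal_eq: "mv_normal 0 V = density lborel (\<lambda>u. ennreal (mv_normal_density V u))"
  by (simp add: mv_normal_def mv_normal_density_def)

lemma borel_measurable_matrix_vector_mult [measurable]:
  fixes A :: "real^'p^'q"
  shows "f \<in> borel_measurable M \<Longrightarrow> (\<lambda>x. A *v f x) \<in> borel_measurable M"
  by (rule borel_measurable_continuous_onI[THEN measurable_compose_rev]) (auto intro: matrix_vector_mult_linear_continuous_on)

lemma borel_measurable_mv_normal_density [measurable]:
  "mv_normal_density V \<in> borel_measurable borel"
  unfolding mv_normal_density_def by measurable

lemma sets_mv_normal [simp, measurable_cong]: "sets (mv_normal m V) = sets borel"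
  by (simp add: mv_normal_def)

lemma space_mv_normal [simp]: "space (mv_normal m V) = UNIV"
  by (simp add: mv_normal_def)

lemma sigma_finite_mv_normal: "sigma_finite_measure (mv_normal 0 V)"
  unfolding mv_normal_eq
  by (subst sigma_finite_measure.sigma_finite_iff_density_finite[OF sigma_finite_lborel]) auto

lemma mv_normal_density_nonneg: "pos_def V \<Longrightarrow> 0 \<le> mv_normal_density V u"
  using det_pos_if_pos_def[of V] by (simp add: mv_normal_density_def)

text \<open>With \<open>b = W\<^sup>-\<^sup>1 a\<close>, the joint exponent is a quadratic polynomial in \<open>t\<close> with leading
coefficient \<open>D / s\<^sup>2\<close>. Completing the square leaves the quadratic form of
\<open>W\<^sup>-\<^sup>1 - (s\<^sup>2 / D) b b\<^sup>T\<close>, which is the inverse of the updated covariance by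
\<open>matrix_inv_add_outer\<close>, and the factor \<open>D\<close> in the normalising constants is the one
from \<open>det_add_outer\<close>.\<close>

lemma mv_normal_density_rank_one:
  fixes W :: "real^'p^'p" and a :: "real^'p"
  assumes W: "pos_def W" and s: "s > 0"
  defines "b \<equiv> matrix_inv W *v a"
  defines "D \<equiv> 1 + s\<^sup>2 * (a \<bullet> b)"
  shows "mv_normal_density W (u - t *\<^sub>R a) * normal_density 0 s t
    = mv_normal_density (W + s\<^sup>2 *\<^sub>R outer a a) u * normal_density (s\<^sup>2 * (b \<bullet> u) / D) (s / sqrt D) t"
    and "D > 0"
proof -
  have det: "det W > 0" by (rule det_pos_if_pos_def[OF W])
  have sym: "transpose W = W" using W by (simp add: pos_def_def)
  have Wb: "W *v b = a" using matrix_inv_vector_mult(1)[of W a] det by (simp add: b_def)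
  have "a \<bullet> b = b \<bullet> (W *v b)" by (simp add: Wb inner_commute)
  also have "\<dots> \<ge> 0" using W unfolding pos_def_def by (cases "b = 0") (auto intro: less_imp_le)
  finally have q: "a \<bullet> b \<ge> 0" .
  then show D: "D > 0" unfolding D_def by (intro add_pos_nonneg) auto
  have so: "s\<^sup>2 *\<^sub>R outer a a = outer (s\<^sup>2 *\<^sub>R a) a"
    by (simp add: vec_eq_iff outer_def)
  have det': "det (W + s\<^sup>2 *\<^sub>R outer a a) = det W * D"
    using det_add_outer[of W "s\<^sup>2 *\<^sub>R a" a] det unfolding so by (simp add: D_def b_def matrix_vector_mult_scaleR)
  have inv': "matrix_inv (W + s\<^sup>2 *\<^sub>R outer a a) = matrix_inv W - (s\<^sup>2 / D) *\<^sub>R outer b b"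
    unfolding D_def b_def
    by (rule matrix_inv_add_outer) (use det sym D in \<open>auto simp: D_def b_def mult.commute\<close>)
  have au: "a \<bullet> (matrix_inv W *v u) = b \<bullet> u"
    using symmetric_inner_matrix_vector[OF transpose_matrix_inv[OF sym], of a u] det
    by (simp add: b_def inner_commute)
  have ub: "u \<bullet> (matrix_inv W *v a) = b \<bullet> u" by (simp add: b_def inner_commute)
  define Q where "Q = u \<bullet> (matrix_inv W *v u)"
  have quad: "(u - t *\<^sub>R a) \<bullet> (matrix_inv W *v (u - t *\<^sub>R a)) = Q - 2 * t * (b \<bullet> u) + t\<^sup>2 * (a \<bullet> b)"
    by (simp add: matrix_vector_mult_diff_distrib matrix_vector_mult_scaleR inner_diff_left inner_diff_right
        au ub Q_def b_def[symmetric] power2_eq_square algebra_simps)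
       (simp add: inner_commute)
  have quad': "u \<bullet> (matrix_inv (W + s\<^sup>2 *\<^sub>R outer a a) *v u) = Q - (s\<^sup>2 / D) * (b \<bullet> u)\<^sup>2"
    unfolding inv'
    by (simp add: matrix_vector_mult_diff_rdistrib scaleR_matrix_vector_assoc[symmetric] outer_mult_vector
        inner_diff_right Q_def power2_eq_square inner_commute)
  have square: "Q - 2 * t * (b \<bullet> u) + t\<^sup>2 * (a \<bullet> b) + t\<^sup>2 / s\<^sup>2
      = Q - (s\<^sup>2 / D) * (b \<bullet> u)\<^sup>2 + (t - s\<^sup>2 * (b \<bullet> u) / D)\<^sup>2 / (s\<^sup>2 / D)"
  proof -
    have ab: "a \<bullet> b = (D - 1) / s\<^sup>2" using s by (simp add: D_def)
    show ?thesis unfolding ab using s D by (simp add: field_simps power2_eq_square)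
  qed
  have sD: "(s / sqrt D)\<^sup>2 = s\<^sup>2 / D" using D by (simp add: power_divide)
  have e: "- (Q - 2 * t * (b \<bullet> u) + t\<^sup>2 * (a \<bullet> b)) / 2 + - t\<^sup>2 / (2 * s\<^sup>2)
     = - (Q - (s\<^sup>2 / D) * (b \<bullet> u)\<^sup>2) / 2 + - (t - s\<^sup>2 * (b \<bullet> u) / D)\<^sup>2 / (2 * (s\<^sup>2 / D))"
  proof -
    have "- (Q - 2 * t * (b \<bullet> u) + t\<^sup>2 * (a \<bullet> b)) / 2 + - t\<^sup>2 / (2 * s\<^sup>2)
       = - (Q - 2 * t * (b \<bullet> u) + t\<^sup>2 * (a \<bullet> b) + t\<^sup>2 / s\<^sup>2) / 2"
      by (simp add: field_simps)
    also have "\<dots> = - (Q - (s\<^sup>2 / D) * (b \<bullet> u)\<^sup>2) / 2 + - (t - s\<^sup>2 * (b \<bullet> u) / D)\<^sup>2 / (2 * (s\<^sup>2 / D))"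
      unfolding square by (simp add: field_simps)
    finally show ?thesis .
  qed
  have c: "sqrt ((2 * pi) ^ CARD('p) * det W) * sqrt (2 * pi * s\<^sup>2)
      = sqrt ((2 * pi) ^ CARD('p) * (det W * D)) * sqrt (2 * pi * (s\<^sup>2 / D))"
    unfolding real_sqrt_mult[symmetric] using D by (simp add: field_simps)
  have "mv_normal_density W (u - t *\<^sub>R a) * normal_density 0 s t
      = exp (- (Q - 2 * t * (b \<bullet> u) + t\<^sup>2 * (a \<bullet> b)) / 2 + - t\<^sup>2 / (2 * s\<^sup>2))
        / (sqrt ((2 * pi) ^ CARD('p) * det W) * sqrt (2 * pi * s\<^sup>2))"
    unfolding mv_normal_density_def normal_density_def quad exp_add by simp
  also have "\<dots> = mv_normal_density (W + s\<^sup>2 *\<^sub>R outer a a) u * normal_density (s\<^sup>2 * (b \<bullet> u) / D) (s / sqrt D) t"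
    unfolding mv_normal_density_def normal_density_def quad' det' sD e c exp_add by simp
  finally show "mv_normal_density W (u - t *\<^sub>R a) * normal_density 0 s t
    = mv_normal_density (W + s\<^sup>2 *\<^sub>R outer a a) u * normal_density (s\<^sup>2 * (b \<bullet> u) / D) (s / sqrt D) t" .
qed

text \<open>The law of \<open>u + t a\<close> for independent normal \<open>u\<close> and \<open>t\<close>. After translating
\<open>u\<close> and exchanging the integrals, \<open>t\<close> occurs only in the one-dimensional density split
off by \<open>mv_normal_density_rank_one\<close>, which integrates to \<open>1\<close>.\<close>

lemma nn_integral_mv_normal_add_normal:
  fixes W :: "real^'p^'p"
  assumes W: "pos_def W" and s: "s > 0" and [measurable]: "f \<in> borel_measurable borel"
  shows "(\<integral>\<^sup>+t. \<integral>\<^sup>+u. f (u + t *\<^sub>R a) \<partial>mv_normal 0 W \<partial>density lborel (normal_density 0 s))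
    = (\<integral>\<^sup>+u. f u \<partial>mv_normal 0 (W + s\<^sup>2 *\<^sub>R outer a a))"
proof -
  define b D where "b = matrix_inv W *v a" and "D = 1 + s\<^sup>2 * (a \<bullet> b)"
  let ?W' = "W + s\<^sup>2 *\<^sub>R outer a a"
  note rank_one = mv_normal_density_rank_one[OF W s, where a = a, folded b_def, folded D_def]
  have W': "pos_def ?W'" using W by (rule pos_def_add_outer) simp
  \<comment> \<open>translation invariance moves the shift from the integrand to the density\<close>
  have shift: "(\<integral>\<^sup>+u. f (u + t *\<^sub>R a) * mv_normal_density W u \<partial>lborel)
      = (\<integral>\<^sup>+u. f u * mv_normal_density W (u - t *\<^sub>R a) \<partial>lborel)" for t
  proof -
    have "(\<integral>\<^sup>+u. f u * mv_normal_density W (u - t *\<^sub>R a) \<partial>lborel)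
        = (\<integral>\<^sup>+u. f u * mv_normal_density W (u - t *\<^sub>R a) \<partial>distr lborel borel ((+) (t *\<^sub>R a)))"
      by (simp add: lborel_distr_plus)
    also have "\<dots> = (\<integral>\<^sup>+u. f (u + t *\<^sub>R a) * mv_normal_density W u \<partial>lborel)"
      by (subst nn_integral_distr) (auto simp: add.commute)
    finally show ?thesis by simp
  qed
  have inner: "(\<integral>\<^sup>+t. normal_density 0 s t * (f u * mv_normal_density W (u - t *\<^sub>R a)) \<partial>lborel)
      = f u * mv_normal_density ?W' u" for u
  proof -
    let ?n = "normal_density (s\<^sup>2 * (b \<bullet> u) / D) (s / sqrt D)"
    have "(\<integral>\<^sup>+t. normal_density 0 s t * (f u * mv_normal_density W (u - t *\<^sub>R a)) \<partial>lborel)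
        = (\<integral>\<^sup>+t. (f u * mv_normal_density ?W' u) * ?n t \<partial>lborel)"
    proof (rule nn_integral_cong)
      fix t
      have "ennreal (normal_density 0 s t) * (f u * ennreal (mv_normal_density W (u - t *\<^sub>R a)))
        = f u * ennreal (mv_normal_density W (u - t *\<^sub>R a) * normal_density 0 s t)"
        by (simp add: ennreal_mult mv_normal_density_nonneg[OF W] ac_simps)
      also have "\<dots> = (f u * ennreal (mv_normal_density ?W' u)) * ennreal (?n t)"
        unfolding rank_one(1) by (simp add: ennreal_mult mv_normal_density_nonneg[OF W'] ac_simps)
      finally show "ennreal (normal_density 0 s t) * (f u * ennreal (mv_normal_density W (u - t *\<^sub>R a)))
        = (f u * ennreal (mv_normal_density ?W' u)) * ennreal (?n t)" .
    qed
    also have "\<dots> = (f u * mv_normal_density ?W' u) * (\<integral>\<^sup>+t. ?n t \<partial>lborel)"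
      by (rule nn_integral_cmult) simp
    also have "(\<integral>\<^sup>+t. ?n t \<partial>lborel) = 1"
    proof -
      have "s / sqrt D > 0" using s rank_one(2) by simp
      then interpret N: prob_space "density lborel ?n" by (rule prob_space_normal_density)
      show ?thesis using N.emeasure_space_1 by (simp add: emeasure_density)
    qed
    finally show ?thesis by simp
  qed
  have "(\<integral>\<^sup>+t. \<integral>\<^sup>+u. f (u + t *\<^sub>R a) \<partial>mv_normal 0 W \<partial>density lborel (normal_density 0 s))
      = (\<integral>\<^sup>+t. normal_density 0 s t * (\<integral>\<^sup>+u. f (u + t *\<^sub>R a) * mv_normal_density W u \<partial>lborel) \<partial>lborel)"
    unfolding mv_normal_eq by (simp add: nn_integral_density ac_simps)
  also have "\<dots> = (\<integral>\<^sup>+t. \<integral>\<^sup>+u. normal_density 0 s t * (f u * mv_normal_density W (u - t *\<^sub>R a)) \<partial>lborel \<partial>lborel)"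
    unfolding shift by (simp add: nn_integral_cmult)
  also have "\<dots> = (\<integral>\<^sup>+u. \<integral>\<^sup>+t. normal_density 0 s t * (f u * mv_normal_density W (u - t *\<^sub>R a)) \<partial>lborel \<partial>lborel)"
    by (rule lborel_pair.Fubini') measurable
  also have "\<dots> = (\<integral>\<^sup>+u. f u \<partial>mv_normal 0 ?W')"
    unfolding inner mv_normal_eq by (simp add: nn_integral_density ac_simps)
  finally show ?thesis .
qed

lemma pos_def_add_outer_sum:
  assumes "finite I" "pos_def W"
  shows "pos_def (W + (\<Sum>i\<in>I. (s i)\<^sup>2 *\<^sub>R outer (a i) (a i)))"
  using assms
proof (induction I)
  case (insert i I)
  then show ?case
    using pos_def_add_outer[of "W + (\<Sum>i\<in>I. (s i)\<^sup>2 *\<^sub>R outer (a i) (a i))" "(s i)\<^sup>2" "a i"]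
    by (simp add: ac_simps)
qed simp

text \<open>Partial sums of the \<open>e\<^sub>i a\<^sub>i\<close> have no density as long as the \<open>a\<^sub>i\<close> do not span the
space. The additional nondegenerate summand with law \<open>N(0, W)\<close> gives every intermediate sum a
density, so that the rank-one update can be iterated.\<close>

lemma nn_integral_mv_normal_add_sum:
  fixes W :: "real^'p^'p"
  assumes "finite I" "pos_def W" "\<And>i. s i > 0" "f \<in> borel_measurable borel"
  shows "(\<integral>\<^sup>+e. \<integral>\<^sup>+u. f (u + (\<Sum>i\<in>I. e i *\<^sub>R a i)) \<partial>mv_normal 0 W
      \<partial>PiM I (\<lambda>i. density lborel (normal_density 0 (s i))))
    = (\<integral>\<^sup>+u. f u \<partial>mv_normal 0 (W + (\<Sum>i\<in>I. (s i)\<^sup>2 *\<^sub>R outer (a i) (a i))))"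
  using assms(1,2)
proof (induction I arbitrary: W)
  case empty
  then show ?case by (simp add: PiM_empty nn_integral_count_space_finite)
next
  case (insert i I)
  note [measurable] = assms(4)
  define N where "N = (\<lambda>i. density lborel (\<lambda>t. ennreal (normal_density 0 (s i) t)))"
  have sN [measurable_cong, simp]: "sets (N i) = sets borel" for i by (simp add: N_def)
  have N: "prob_space (N i)" for i
    unfolding N_def using prob_space_normal_density[of "s i" 0] assms(3) by simp
  interpret product_sigma_finite N
    by (intro product_sigma_finite.intro prob_space_imp_sigma_finite N)
  define W' where "W' = W + (s i)\<^sup>2 *\<^sub>R outer (a i) (a i)"
  have W': "pos_def W'" unfolding W'_def by (rule pos_def_add_outer[OF insert(4)]) simp
  interpret mv: sigma_finite_measure "mv_normal 0 W" by (rule sigma_finite_mv_normal)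
  have "(\<integral>\<^sup>+e. \<integral>\<^sup>+u. f (u + (\<Sum>j\<in>insert i I. e j *\<^sub>R a j)) \<partial>mv_normal 0 W \<partial>PiM (insert i I) N)
    = (\<integral>\<^sup>+e. \<integral>\<^sup>+y. \<integral>\<^sup>+u. f (u + (\<Sum>j\<in>insert i I. (e(i := y)) j *\<^sub>R a j)) \<partial>mv_normal 0 W \<partial>N i \<partial>PiM I N)"
    by (rule product_nn_integral_insert[OF insert(1,2)]) measurable
  also have "\<dots> = (\<integral>\<^sup>+e. \<integral>\<^sup>+u. f (u + (\<Sum>j\<in>I. e j *\<^sub>R a j)) \<partial>mv_normal 0 W' \<partial>PiM I N)"
  proof (intro nn_integral_cong)
    fix e
    have eq: "u + (\<Sum>j\<in>insert i I. (e(i := y)) j *\<^sub>R a j) = (u + y *\<^sub>R a i) + (\<Sum>j\<in>I. e j *\<^sub>R a j)" for u y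
    proof -
      have "(\<Sum>j\<in>I. (e(i := y)) j *\<^sub>R a j) = (\<Sum>j\<in>I. e j *\<^sub>R a j)"
        using insert by (intro sum.cong) auto
      then show ?thesis using insert by (simp add: ac_simps)
    qed
    show "(\<integral>\<^sup>+y. \<integral>\<^sup>+u. f (u + (\<Sum>j\<in>insert i I. (e(i := y)) j *\<^sub>R a j)) \<partial>mv_normal 0 W \<partial>N i)
        = (\<integral>\<^sup>+u. f (u + (\<Sum>j\<in>I. e j *\<^sub>R a j)) \<partial>mv_normal 0 W')"
      unfolding eq N_def W'_def
      by (rule nn_integral_mv_normal_add_normal[OF insert(4) assms(3)]) measurable
  qed
  also have "\<dots> = (\<integral>\<^sup>+u. f u \<partial>mv_normal 0 (W' + (\<Sum>j\<in>I. (s j)\<^sup>2 *\<^sub>R outer (a j) (a j))))"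
    using insert.IH[OF W'] by (simp add: N_def)
  also have "W' + (\<Sum>j\<in>I. (s j)\<^sup>2 *\<^sub>R outer (a j) (a j)) = W + (\<Sum>j\<in>insert i I. (s j)\<^sup>2 *\<^sub>R outer (a j) (a j))"
    using insert by (simp add: W'_def ac_simps)
  finally show ?case by (simp add: N_def)
qed

lemma prob_space_mv_normal_mat1: "prob_space (mv_normal 0 (mat 1 :: real^'p^'p))"
proof
  have "mv_normal_density (mat 1 :: real^'p^'p) u = (\<Prod>b\<in>Basis. normal_density 0 1 (u \<bullet> b))" for u
  proof -
    have "(\<Prod>b\<in>Basis. normal_density 0 1 (u \<bullet> b)) = (1 / sqrt (2 * pi)) ^ CARD('p) * exp (\<Sum>b\<in>Basis. - ((u \<bullet> b)\<^sup>2 / 2))"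
      by (simp add: normal_density_def prod_dividef exp_sum power_divide)
    also have "(\<Sum>b\<in>Basis. - ((u \<bullet> b)\<^sup>2 / 2)) = - (u \<bullet> u) / 2"
      by (subst euclidean_inner) (simp add: sum_negf sum_divide_distrib power2_eq_square)
    also have "(1 / sqrt (2 * pi)) ^ CARD('p) = 1 / sqrt ((2 * pi) ^ CARD('p))"
      by (simp add: power_divide real_sqrt_power power_mult_distrib real_sqrt_mult)
    finally show ?thesis
      by (simp add: mv_normal_density_def matrix_inv_eqI[of "mat 1" "mat 1"])
  qed
  then have "(\<integral>\<^sup>+u. mv_normal_density (mat 1 :: real^'p^'p) u \<partial>lborel)
      = (\<integral>\<^sup>+u. (\<Prod>b\<in>Basis. ennreal (normal_density 0 1 (u \<bullet> b))) \<partial>(lborel :: (real^'p) measure))"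
    by (simp add: prod_ennreal)
  also have "\<dots> = (\<Prod>b\<in>(Basis :: (real^'p) set). (\<integral>\<^sup>+t. normal_density 0 1 t \<partial>lborel))"
    by (rule nn_integral_lborel_prod) auto
  also have "(\<integral>\<^sup>+t. normal_density 0 1 t \<partial>lborel) = 1"
    using prob_space.emeasure_space_1[OF prob_space_normal_density[of 1 0]] by (simp add: emeasure_density)
  finally show "emeasure (mv_normal 0 (mat 1 :: real^'p^'p)) (space (mv_normal 0 (mat 1 :: real^'p^'p))) = 1"
    by (simp add: mv_normal_eq emeasure_density)
qed

text \<open>The law \<open>N(0, d\<^sup>2 I)\<close> as the law of \<open>d z\<close> with \<open>z\<close> standard normal: one
fixed probability space serves all \<open>d\<close>, which makes the limit \<open>d \<rightarrow> 0\<close> a pointwise one.\<close>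

lemma nn_integral_mv_normal_scaled_mat1:
  fixes f :: "real^'p \<Rightarrow> ennreal"
  assumes d: "d > 0" and [measurable]: "f \<in> borel_measurable borel"
  shows "(\<integral>\<^sup>+u. f u \<partial>mv_normal 0 (d\<^sup>2 *\<^sub>R mat 1)) = (\<integral>\<^sup>+z. f (d *\<^sub>R z) \<partial>mv_normal 0 (mat 1))"
proof -
  have inv: "matrix_inv (d\<^sup>2 *\<^sub>R mat 1 :: real^'p^'p) = (1 / d\<^sup>2) *\<^sub>R mat 1"
    using matrix_inv_scaleR[of "mat 1 :: real^'p^'p" "d\<^sup>2"] d matrix_inv_eqI[of "mat 1 :: real^'p^'p" "mat 1"] by simp
  have mat: "(d\<^sup>2 *\<^sub>R mat 1 :: real^'p^'p) = (\<chi> i j. if i = j then d\<^sup>2 else 0)"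
    by (simp add: vec_eq_iff mat_def)
  have "det (d\<^sup>2 *\<^sub>R mat 1 :: real^'p^'p) = (d\<^sup>2) ^ CARD('p)"
    unfolding mat by (subst det_diagonal) auto
  then have dens: "mv_normal_density (d\<^sup>2 *\<^sub>R mat 1) (d *\<^sub>R z) = mv_normal_density (mat 1) z / d ^ CARD('p)" for z :: "real^'p"
    using d by (simp add: mv_normal_density_def inv matrix_inv_eqI[of "mat 1" "mat 1"] scaleR_matrix_vector_assoc[symmetric]
        matrix_vector_mult_scaleR real_sqrt_mult real_sqrt_power) (simp add: power2_eq_square)
  have "(\<integral>\<^sup>+u. f u \<partial>mv_normal 0 (d\<^sup>2 *\<^sub>R mat 1)) = (\<integral>\<^sup>+u. mv_normal_density (d\<^sup>2 *\<^sub>R mat 1) u * f u \<partial>lborel)"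
    by (simp add: mv_normal_eq nn_integral_density)
  also have "\<dots> = (\<integral>\<^sup>+z. ennreal (d ^ CARD('p)) * (mv_normal_density (d\<^sup>2 *\<^sub>R mat 1) (d *\<^sub>R z) * f (d *\<^sub>R z)) \<partial>lborel)"
    by (subst lborel_affine[of d 0]) (use d in \<open>auto simp: nn_integral_density nn_integral_distr\<close>)
  also have "\<dots> = (\<integral>\<^sup>+z. mv_normal_density (mat 1) z * f (d *\<^sub>R z) \<partial>lborel)"
  proof (rule nn_integral_cong)
    fix z :: "real^'p"
    have "ennreal (d ^ CARD('p)) * ennreal (mv_normal_density (mat 1) z / d ^ CARD('p)) = ennreal (mv_normal_density (mat 1) z)"
      using d by (subst ennreal_mult'[symmetric]) auto
    then show "ennreal (d ^ CARD('p)) * (mv_normal_density (d\<^sup>2 *\<^sub>R mat 1) (d *\<^sub>R z) * f (d *\<^sub>R z))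
        = mv_normal_density (mat 1) z * f (d *\<^sub>R z)"
      unfolding dens by (simp add: mult.assoc[symmetric])
  qed
  also have "\<dots> = (\<integral>\<^sup>+z. f (d *\<^sub>R z) \<partial>mv_normal 0 (mat 1))"
    by (simp add: mv_normal_eq nn_integral_density)
  finally show ?thesis .
qed

text \<open>For positive definite \<open>V\<close> this is the mean of \<open>f\<close> under \<open>N(0, V)\<close>. It is defined for
all matrices, so that continuity at a positive definite matrix can be stated without restrictions on
the approximating matrices.\<close>

definition gauss_mean :: "(real^'p \<Rightarrow> real) \<Rightarrow> real^'p^'p \<Rightarrow> real" where
  "gauss_mean f V = (LINT u|lborel. f u * mv_normal_density V u)"

lemma integral_mv_normal:
  assumes "pos_def V" and "f \<in> borel_measurable borel"
  shows "(LINT u|mv_normal 0 V. f u) = gauss_mean f V"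
  unfolding mv_normal_eq gauss_mean_def
  using assms by (subst integral_density) (auto simp: mv_normal_density_nonneg mult.commute)

text \<open>The function is a multiple of the density of \<open>N(0, d\<^sup>2 I)\<close> for \<open>d\<^sup>2 = 1 / (2 c)\<close>,
which has total mass \<open>1\<close> by rescaling.\<close>

lemma integrable_exp_neg_quadratic:
  assumes c: "c > 0"
  shows "integrable lborel (\<lambda>u::real^'p. exp (- c * (u \<bullet> u)))"
proof -
  define d where "d = 1 / sqrt (2 * c)"
  have d: "d > 0" "d\<^sup>2 = 1 / (2 * c)" using c by (auto simp: d_def power_divide)
  define V :: "real^'p^'p" where "V = d\<^sup>2 *\<^sub>R mat 1"
  have V: "pos_def V" unfolding V_def using d c by (intro pos_def_mat1_scaleR) simp
  have "matrix_inv V = (2 * c) *\<^sub>R mat 1"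
    unfolding V_def d(2) using c by (intro allI matrix_inv_eqI matrix_eq[THEN iffD2])
      (simp add: matrix_vector_mul_assoc[symmetric] scaleR_matrix_vector_assoc[symmetric] matrix_vector_mult_scaleR)
  then have dens: "mv_normal_density V u * sqrt ((2 * pi) ^ CARD('p) * det V) = exp (- c * (u \<bullet> u))" for u
    using det_pos_if_pos_def[OF V]
    by (simp add: mv_normal_density_def scaleR_matrix_vector_assoc[symmetric])
  have "(\<integral>\<^sup>+u. 1 \<partial>mv_normal 0 V) = (\<integral>\<^sup>+u. 1 \<partial>mv_normal 0 (mat 1 :: real^'p^'p))"
    unfolding V_def using nn_integral_mv_normal_scaled_mat1[of d "\<lambda>_. 1"] d by simp
  also have "\<dots> = 1" using prob_space.emeasure_space_1[OF prob_space_mv_normal_mat1] by simp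
  finally have "(\<integral>\<^sup>+u. mv_normal_density V u \<partial>lborel) < \<infinity>"
    by (simp add: mv_normal_eq nn_integral_density emeasure_density)
  then have "integrable lborel (mv_normal_density V)"
    by (subst integrable_iff_bounded) (simp add: mv_normal_density_nonneg[OF V])
  then have "integrable lborel (\<lambda>u. mv_normal_density V u * sqrt ((2 * pi) ^ CARD('p) * det V))" by simp
  then show ?thesis unfolding dens .
qed

text \<open>Dominated convergence of the densities. If \<open>c\<close> is a coercivity constant of \<open>V\<^sup>-\<^sup>1\<close>, then
the inverses of nearby matrices still satisfy the bound with \<open>c / 2\<close>, and
\<open>exp (- (c / 4) (u \<bullet> u))\<close> dominates up to a constant.\<close>

lemma gauss_mean_tendsto:
  fixes V :: "real^'p^'p"
  assumes [measurable]: "f \<in> borel_measurable borel" and K: "\<And>u. \<bar>f u\<bar> \<le> K"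
    and V: "pos_def V" and lim: "X \<longlonglongrightarrow> V"
  shows "(\<lambda>n. gauss_mean f (X n)) \<longlonglongrightarrow> gauss_mean f V"
proof -
  have det: "det V > 0" by (rule det_pos_if_pos_def[OF V])
  obtain c where c: "c > 0" "\<And>u. u \<bullet> (matrix_inv V *v u) \<ge> c * (u \<bullet> u)"
    using pos_def_coercive[OF pos_def_matrix_inv[OF V]] by blast
  have inv: "(\<lambda>n. matrix_inv (X n)) \<longlonglongrightarrow> matrix_inv V"
    using lim det by (intro tendsto_matrix_inv) auto
  define C where "C = 1 / sqrt ((2 * pi) ^ CARD('p) * det V)"
  have const: "(\<lambda>n. 1 / sqrt ((2 * pi) ^ CARD('p) * det (X n))) \<longlonglongrightarrow> C"
    unfolding C_def using det by (intro tendsto_intros tendsto_det lim) auto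
  have dens: "(\<lambda>n. mv_normal_density (X n) u) \<longlonglongrightarrow> mv_normal_density V u" for u
    unfolding mv_normal_density_def using det
    by (intro tendsto_intros tendsto_det lim tendsto_matrix_vector_mult inv
        tendsto_const) auto
  have "(\<lambda>n. \<Sum>i\<in>UNIV. \<Sum>j\<in>UNIV. \<bar>(matrix_inv (X n) - matrix_inv V) $ i $ j\<bar>)
      \<longlonglongrightarrow> (\<Sum>i\<in>UNIV. \<Sum>j\<in>UNIV. \<bar>(matrix_inv V - matrix_inv V) $ i $ j\<bar>)"
    by (intro tendsto_intros inv)
  then have "\<forall>\<^sub>F n in sequentially. (\<Sum>i\<in>UNIV. \<Sum>j\<in>UNIV. \<bar>(matrix_inv (X n) - matrix_inv V) $ i $ j\<bar>) < c / 2"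
    using c by (intro order_tendstoD(2)) auto
  moreover have "\<forall>\<^sub>F n in sequentially. \<bar>1 / sqrt ((2 * pi) ^ CARD('p) * det (X n))\<bar> < \<bar>C\<bar> + 1"
    by (intro order_tendstoD(2)[OF tendsto_rabs[OF const]]) simp
  ultimately have ev: "\<forall>\<^sub>F n in sequentially. \<forall>u. norm (f u * mv_normal_density (X n) u) \<le> K * (\<bar>C\<bar> + 1) * exp (- (c / 4) * (u \<bullet> u))"
  proof eventually_elim
    case (elim n)
    show ?case
    proof
      fix u
      have "\<bar>u \<bullet> ((matrix_inv (X n) - matrix_inv V) *v u)\<bar> \<le> c / 2 * (u \<bullet> u)"
        using abs_quadratic_form_le[of u "matrix_inv (X n) - matrix_inv V"] elim(1)
          mult_right_mono[of _ "c / 2" "u \<bullet> u"] by (smt (verit) inner_ge_zero)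
      then have "u \<bullet> (matrix_inv (X n) *v u) \<ge> c / 2 * (u \<bullet> u)"
        using c(2)[of u] unfolding matrix_vector_mult_diff_rdistrib inner_diff_right by linarith
      then have e: "exp (- (u \<bullet> (matrix_inv (X n) *v u)) / 2) \<le> exp (- (c / 4) * (u \<bullet> u))" by simp
      have "norm (f u * mv_normal_density (X n) u)
          = \<bar>f u\<bar> * (\<bar>1 / sqrt ((2 * pi) ^ CARD('p) * det (X n))\<bar> * exp (- (u \<bullet> (matrix_inv (X n) *v u)) / 2))"
        by (simp add: mv_normal_density_def abs_mult)
      also have "\<dots> \<le> K * ((\<bar>C\<bar> + 1) * exp (- (c / 4) * (u \<bullet> u)))"
        using K[of u] elim(2) e by (intro mult_mono) auto
      finally show "norm (f u * mv_normal_density (X n) u) \<le> K * (\<bar>C\<bar> + 1) * exp (- (c / 4) * (u \<bullet> u))" by simp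
    qed
  qed
  then obtain N where N: "\<And>n u. n \<ge> N \<Longrightarrow> norm (f u * mv_normal_density (X n) u) \<le> K * (\<bar>C\<bar> + 1) * exp (- (c / 4) * (u \<bullet> u))"
    unfolding eventually_sequentially by blast
  have "(\<lambda>n. gauss_mean f (X (n + N))) \<longlonglongrightarrow> gauss_mean f V"
    unfolding gauss_mean_def
  proof (rule integral_dominated_convergence)
    show "integrable lborel (\<lambda>u::real^'p. K * (\<bar>C\<bar> + 1) * exp (- (c / 4) * (u \<bullet> u)))"
      by (intro integrable_mult_right integrable_exp_neg_quadratic) (use c in simp)
    show "AE u in lborel. (\<lambda>n. f u * mv_normal_density (X (n + N)) u) \<longlonglongrightarrow> f u * mv_normal_density V u"
      by (intro AE_I2 tendsto_intros LIMSEQ_ignore_initial_segment dens)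
  qed (use N in auto)
  then show ?thesis by (rule LIMSEQ_offset)
qed

lemma distr_mv_normal_sum:
  fixes a :: "'i \<Rightarrow> real^'p"
  assumes I: "finite I" and s: "\<And>i. s i > 0" and d: "d > 0"
  defines "N \<equiv> PiM I (\<lambda>i. density lborel (normal_density 0 (s i)))"
  shows "distr (N \<Otimes>\<^sub>M mv_normal 0 (mat 1)) borel (\<lambda>(e, z). d *\<^sub>R z + (\<Sum>i\<in>I. e i *\<^sub>R a i))
    = mv_normal 0 (d\<^sup>2 *\<^sub>R mat 1 + (\<Sum>i\<in>I. (s i)\<^sup>2 *\<^sub>R outer (a i) (a i)))"
proof (rule measure_eqI)
  fix A :: "(real^'p) set"
  assume "A \<in> sets (distr (N \<Otimes>\<^sub>M mv_normal 0 (mat 1)) borel (\<lambda>(e, z). d *\<^sub>R z + (\<Sum>i\<in>I. e i *\<^sub>R a i)))"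
  then have A [measurable]: "A \<in> sets borel" by simp
  have [measurable_cong]: "sets N = sets (PiM I (\<lambda>_. borel))"
    unfolding N_def by (intro sets_PiM_cong) auto
  interpret mv: prob_space "mv_normal 0 (mat 1 :: real^'p^'p)" by (rule prob_space_mv_normal_mat1)
  have "emeasure (distr (N \<Otimes>\<^sub>M mv_normal 0 (mat 1)) borel (\<lambda>(e, z). d *\<^sub>R z + (\<Sum>i\<in>I. e i *\<^sub>R a i))) A
     = (\<integral>\<^sup>+x. indicator A x \<partial>distr (N \<Otimes>\<^sub>M mv_normal 0 (mat 1)) borel (\<lambda>(e, z). d *\<^sub>R z + (\<Sum>i\<in>I. e i *\<^sub>R a i)))"
    by simp
  also have "\<dots> = (\<integral>\<^sup>+x. indicator A (case x of (e, z) \<Rightarrow> d *\<^sub>R z + (\<Sum>i\<in>I. e i *\<^sub>R a i)) \<partial>(N \<Otimes>\<^sub>M mv_normal 0 (mat 1)))"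
    by (subst nn_integral_distr) auto
  also have "\<dots> = (\<integral>\<^sup>+e. \<integral>\<^sup>+z. indicator A (d *\<^sub>R z + (\<Sum>i\<in>I. e i *\<^sub>R a i)) \<partial>mv_normal 0 (mat 1) \<partial>N)"
    by (subst mv.nn_integral_fst[symmetric]) auto
  also have "\<dots> = (\<integral>\<^sup>+e. \<integral>\<^sup>+u. indicator A (u + (\<Sum>i\<in>I. e i *\<^sub>R a i)) \<partial>mv_normal 0 (d\<^sup>2 *\<^sub>R mat 1) \<partial>N)"
    using nn_integral_mv_normal_scaled_mat1[OF d, of "\<lambda>u. indicator A (u + w)" for w] by simp
  also have "\<dots> = (\<integral>\<^sup>+u. indicator A u \<partial>mv_normal 0 (d\<^sup>2 *\<^sub>R mat 1 + (\<Sum>i\<in>I. (s i)\<^sup>2 *\<^sub>R outer (a i) (a i))))"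
    unfolding N_def by (rule nn_integral_mv_normal_add_sum) (use I s d in \<open>auto intro!: pos_def_mat1_scaleR\<close>)
  finally show "emeasure (distr (N \<Otimes>\<^sub>M mv_normal 0 (mat 1)) borel (\<lambda>(e, z). d *\<^sub>R z + (\<Sum>i\<in>I. e i *\<^sub>R a i))) A
     = emeasure (mv_normal 0 (d\<^sup>2 *\<^sub>R mat 1 + (\<Sum>i\<in>I. (s i)\<^sup>2 *\<^sub>R outer (a i) (a i)))) A"
    by simp
qed simp

text \<open>Add \<open>d z\<close> with a standard normal vector \<open>z\<close> and let \<open>d\<close> tend to \<open>0\<close>: the left side
converges because \<open>f\<close> is continuous and bounded, the right side by continuity in the
covariance.\<close>

lemma integral_sum_normals:
  fixes a :: "'i \<Rightarrow> real^'p" and f :: "real^'p \<Rightarrow> real"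
  assumes I: "finite I" and s: "\<And>i. s i > 0"
    and f: "continuous_on UNIV f" and K: "\<And>u. \<bar>f u\<bar> \<le> K"
    and V: "pos_def (\<Sum>i\<in>I. (s i)\<^sup>2 *\<^sub>R outer (a i) (a i))"
  shows "(LINT e|PiM I (\<lambda>i. density lborel (normal_density 0 (s i))). f (\<Sum>i\<in>I. e i *\<^sub>R a i))
    = gauss_mean f (\<Sum>i\<in>I. (s i)\<^sup>2 *\<^sub>R outer (a i) (a i))"
proof -
  define N where "N = PiM I (\<lambda>i. density lborel (\<lambda>t. ennreal (normal_density 0 (s i) t)))"
  define V where "V = (\<Sum>i\<in>I. (s i)\<^sup>2 *\<^sub>R outer (a i) (a i))"
  have [measurable]: "f \<in> borel_measurable borel" using f by (rule borel_measurable_continuous_onI)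
  have [measurable_cong]: "sets N = sets (PiM I (\<lambda>_. borel))"
    unfolding N_def by (intro sets_PiM_cong) auto
  interpret mv: prob_space "mv_normal 0 (mat 1 :: real^'p^'p)" by (rule prob_space_mv_normal_mat1)
  interpret N: prob_space N unfolding N_def
    by (intro prob_space_PiM prob_space_normal_density s)
  interpret P: pair_prob_space N "mv_normal 0 (mat 1 :: real^'p^'p)" ..
  define d where "d n = 1 / real (Suc n)" for n
  have d0: "d n > 0" for n by (simp add: d_def)
  have dlim: "d \<longlonglongrightarrow> 0" unfolding d_def using LIMSEQ_inverse_real_of_nat by (simp add: inverse_eq_divide)
  \<comment> \<open>the regularised sum has the law computed by the rank-one updates\<close>
  have eq: "(LINT (e, z)|(N \<Otimes>\<^sub>M mv_normal 0 (mat 1)). f (d n *\<^sub>R z + (\<Sum>i\<in>I. e i *\<^sub>R a i)))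
      = gauss_mean f ((d n)\<^sup>2 *\<^sub>R mat 1 + V)" for n
  proof -
    have "pos_def ((d n)\<^sup>2 *\<^sub>R mat 1 + V)" unfolding V_def
      by (intro pos_def_add_outer_sum pos_def_mat1_scaleR I) (simp add: d_def)
    then have "gauss_mean f ((d n)\<^sup>2 *\<^sub>R mat 1 + V) = (LINT u|mv_normal 0 ((d n)\<^sup>2 *\<^sub>R mat 1 + V). f u)"
      by (simp add: integral_mv_normal)
    also have "\<dots> = (LINT u|distr (N \<Otimes>\<^sub>M mv_normal 0 (mat 1)) borel (\<lambda>(e, z). d n *\<^sub>R z + (\<Sum>i\<in>I. e i *\<^sub>R a i)). f u)"
      unfolding V_def N_def using distr_mv_normal_sum[where a = a and d = "d n", OF I s d0] by simp
    also have "\<dots> = (LINT (e, z)|(N \<Otimes>\<^sub>M mv_normal 0 (mat 1)). f (d n *\<^sub>R z + (\<Sum>i\<in>I. e i *\<^sub>R a i)))"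
      by (subst integral_distr) (auto simp: case_prod_unfold)
    finally show ?thesis by simp
  qed
  have lim: "(\<lambda>n. LINT (e, z)|(N \<Otimes>\<^sub>M mv_normal 0 (mat 1)). f (d n *\<^sub>R z + (\<Sum>i\<in>I. e i *\<^sub>R a i)))
      \<longlonglongrightarrow> (LINT (e, z :: real^'p)|(N \<Otimes>\<^sub>M mv_normal 0 (mat 1)). f (\<Sum>i\<in>I. e i *\<^sub>R a i))"
  proof (rule integral_dominated_convergence[where w = "\<lambda>_. K"])
    show "AE p in N \<Otimes>\<^sub>M mv_normal 0 (mat 1). (\<lambda>n. case p of (e, z) \<Rightarrow> f (d n *\<^sub>R z + (\<Sum>i\<in>I. e i *\<^sub>R a i)))
        \<longlonglongrightarrow> (case p of (e, z) \<Rightarrow> f (\<Sum>i\<in>I. e i *\<^sub>R a i))"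
    proof (rule AE_I2)
      fix p
      have "(\<lambda>n. f (d n *\<^sub>R snd p + (\<Sum>i\<in>I. fst p i *\<^sub>R a i))) \<longlonglongrightarrow> f (0 *\<^sub>R snd p + (\<Sum>i\<in>I. fst p i *\<^sub>R a i))"
        by (rule continuous_on_tendsto_compose[OF f], intro tendsto_intros dlim) auto
      then show "(\<lambda>n. case p of (e, z) \<Rightarrow> f (d n *\<^sub>R z + (\<Sum>i\<in>I. e i *\<^sub>R a i)))
        \<longlonglongrightarrow> (case p of (e, z) \<Rightarrow> f (\<Sum>i\<in>I. e i *\<^sub>R a i))" by (simp add: case_prod_beta)
    qed
  qed (use K in \<open>auto simp: case_prod_beta\<close>)
  have fst: "(LINT (e, z :: real^'p)|(N \<Otimes>\<^sub>M mv_normal 0 (mat 1)). f (\<Sum>i\<in>I. e i *\<^sub>R a i))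
      = (LINT e|N. f (\<Sum>i\<in>I. e i *\<^sub>R a i))"
  proof -
    have "integrable (N \<Otimes>\<^sub>M mv_normal 0 (mat 1 :: real^'p^'p)) (\<lambda>(e, z). f (\<Sum>i\<in>I. e i *\<^sub>R a i))"
      by (rule P.integrable_const_bound[where B = K]) (use K in \<open>auto simp: case_prod_beta\<close>)
    from P.integral_fst'[OF this] show ?thesis by (simp add: mv.prob_space[simplified])
  qed
  have lim': "(\<lambda>n. gauss_mean f ((d n)\<^sup>2 *\<^sub>R mat 1 + V)) \<longlonglongrightarrow> gauss_mean f V"
  proof (rule gauss_mean_tendsto)
    have "(\<lambda>n. (d n)\<^sup>2 *\<^sub>R mat 1 + V) \<longlonglongrightarrow> 0\<^sup>2 *\<^sub>R mat 1 + V" by (intro tendsto_intros dlim)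
    then show "(\<lambda>n. (d n)\<^sup>2 *\<^sub>R mat 1 + V) \<longlonglongrightarrow> V" by simp
  qed (use K V V_def in auto)
  have "(LINT e|N. f (\<Sum>i\<in>I. e i *\<^sub>R a i)) = gauss_mean f V"
    by (rule LIMSEQ_unique[OF lim[unfolded eq fst] lim'])
  then show ?thesis unfolding N_def V_def .
qed

lemma bounded_gauss_mean_interval:
  fixes V :: "real^'p^'p"
  assumes V: "pos_def V" and lo: "0 < lo" and f: "f \<in> borel_measurable borel" "\<And>u. \<bar>f u\<bar> \<le> K"
  shows "\<exists>K'. \<forall>t\<in>{lo..hi}. \<bar>gauss_mean f (t *\<^sub>R V)\<bar> \<le> K'"
proof -
  have "continuous_on {lo..hi} (\<lambda>t. gauss_mean f (t *\<^sub>R V))"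
    unfolding continuous_on_sequentially comp_def
  proof (intro allI ballI impI, elim conjE)
    fix s :: "nat \<Rightarrow> real" and t assume "t \<in> {lo..hi}" "s \<longlonglongrightarrow> t"
    then show "(\<lambda>n. gauss_mean f (s n *\<^sub>R V)) \<longlonglongrightarrow> gauss_mean f (t *\<^sub>R V)"
      using lo by (intro gauss_mean_tendsto[OF f] pos_def_scaleR V tendsto_intros) auto
  qed
  then have "bounded ((\<lambda>t. gauss_mean f (t *\<^sub>R V)) ` {lo..hi})"
    by (intro compact_imp_bounded compact_continuous_image) auto
  then show ?thesis unfolding bounded_iff by auto
qed

text \<open>At \<open>A = S\<close> and \<open>B = t S\<close> the sandwich \<open>A\<^sup>-\<^sup>1 B A\<^sup>-\<^sup>1\<close> is \<open>t S\<^sup>-\<^sup>1\<close>. A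
radius \<open>\<delta>\<close> valid for all \<open>t\<close> at once exists by compactness: counterexamples
\<open>(A\<^sub>n, B\<^sub>n, t\<^sub>n)\<close> for \<open>\<delta> = 1 / (n + 1)\<close> would have a subsequence with convergent
\<open>t\<^sub>n\<close>, along which both means converge to the same value.\<close>

lemma gauss_mean_uniformly_close:
  fixes S :: "real^'p^'p"
  assumes S: "pos_def S" and r: "r > 0" and lo: "0 < lo"
    and f: "f \<in> borel_measurable borel" "\<And>u. \<bar>f u\<bar> \<le> K" and \<eta>: "\<eta> > 0"
  shows "\<exists>\<delta>>0. \<forall>A B. \<forall>t\<in>{lo..hi}. (\<forall>i j. \<bar>A $ i $ j - S $ i $ j\<bar> < \<delta>) \<longrightarrow> (\<forall>i j. \<bar>B $ i $ j - t * S $ i $ j\<bar> < \<delta>) \<longrightarrow>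
    det A \<noteq> 0 \<and> \<bar>gauss_mean f (r *\<^sub>R (matrix_inv A ** B ** matrix_inv A)) - gauss_mean f ((r * t) *\<^sub>R matrix_inv S)\<bar> < \<eta>"
proof (rule ccontr)
  assume contra: "\<not> ?thesis"
  define good where "good A B t \<longleftrightarrow> det A \<noteq> 0 \<and>
      \<bar>gauss_mean f (r *\<^sub>R (matrix_inv A ** B ** matrix_inv A)) - gauss_mean f ((r * t) *\<^sub>R matrix_inv S)\<bar> < \<eta>"
    for A B t
  define P where "P \<delta> A B t \<longleftrightarrow> t \<in> {lo..hi} \<and> (\<forall>i j. \<bar>A $ i $ j - S $ i $ j\<bar> < \<delta>)
      \<and> (\<forall>i j. \<bar>B $ i $ j - t * S $ i $ j\<bar> < \<delta>) \<and> \<not> good A B t" for \<delta> :: real and A B t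
  have "\<exists>A B t. P \<delta> A B t" if "\<delta> > 0" for \<delta>
    using contra that unfolding P_def good_def[symmetric] by blast
  then have "\<forall>n. \<exists>A B t. P (1 / real (Suc n)) A B t" by simp
  then obtain A B t where q: "\<And>n. P (1 / real (Suc n)) (A n) (B n) (t n)" by metis
  have t: "t n \<in> {lo..hi}" and An: "\<bar>A n $ i $ j - S $ i $ j\<bar> < 1 / real (Suc n)"
    and Bn: "\<bar>B n $ i $ j - t n * S $ i $ j\<bar> < 1 / real (Suc n)"
    and bad: "\<not> (det (A n) \<noteq> 0 \<and> \<bar>gauss_mean f (r *\<^sub>R (matrix_inv (A n) ** B n ** matrix_inv (A n))) - gauss_mean f ((r * t n) *\<^sub>R matrix_inv S)\<bar> < \<eta>)"
    for n i j
    using q[of n] unfolding P_def good_def by blast+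
  obtain t0 \<phi> where t0: "t0 \<in> {lo..hi}" and \<phi>: "strict_mono \<phi>" and tlim: "(t \<circ> \<phi>) \<longlonglongrightarrow> t0"
    using compact_Icc[of lo hi, unfolded compact_def, rule_format, of t] t by blast
  have inv0: "(\<lambda>n. 1 / real (Suc (\<phi> n))) \<longlonglongrightarrow> 0"
    using LIMSEQ_subseq_LIMSEQ[OF LIMSEQ_inverse_real_of_nat \<phi>] by (simp add: o_def inverse_eq_divide)
  have Alim: "(\<lambda>n. A (\<phi> n)) \<longlonglongrightarrow> S"
  proof (intro vec_tendstoI)
    fix i j
    have "(\<lambda>n. A (\<phi> n) $ i $ j - S $ i $ j) \<longlonglongrightarrow> 0"
      by (rule Lim_null_comparison[OF _ inv0]) (use An in \<open>auto intro!: always_eventually less_imp_le\<close>)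
    then show "(\<lambda>n. A (\<phi> n) $ i $ j) \<longlonglongrightarrow> S $ i $ j" by (simp add: LIM_zero_iff)
  qed
  have Blim: "(\<lambda>n. B (\<phi> n)) \<longlonglongrightarrow> t0 *\<^sub>R S"
  proof (intro vec_tendstoI)
    fix i j
    have "(\<lambda>n. B (\<phi> n) $ i $ j - t (\<phi> n) * S $ i $ j) \<longlonglongrightarrow> 0"
      by (rule Lim_null_comparison[OF _ inv0]) (use Bn in \<open>auto intro!: always_eventually less_imp_le\<close>)
    moreover have "(\<lambda>n. t (\<phi> n) * S $ i $ j) \<longlonglongrightarrow> t0 * S $ i $ j"
      using tlim by (intro tendsto_mult tendsto_const) (simp add: o_def)
    ultimately have "(\<lambda>n. (B (\<phi> n) $ i $ j - t (\<phi> n) * S $ i $ j) + t (\<phi> n) * S $ i $ j) \<longlonglongrightarrow> 0 + t0 * S $ i $ j"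
      by (rule tendsto_add)
    then show "(\<lambda>n. B (\<phi> n) $ i $ j) \<longlonglongrightarrow> (t0 *\<^sub>R S) $ i $ j" by simp
  qed
  have detS: "det S \<noteq> 0" using det_pos_if_pos_def[OF S] by simp
  have t0pos: "t0 > 0" using t0 lo by simp
  define V where "V = (r * t0) *\<^sub>R matrix_inv S"
  have V: "pos_def V"
    using pos_def_matrix_inv[OF S] r t0pos unfolding V_def pos_def_def
    by (simp add: transpose_scalar scaleR_matrix_vector_assoc[symmetric])
  have "matrix_inv S ** (t0 *\<^sub>R S) ** matrix_inv S = t0 *\<^sub>R matrix_inv S"
    using matrix_inv_mult[OF detS]
    by (simp add: matrix_eq matrix_vector_mul_assoc[symmetric] matrix_inv_vector_mult[OF detS] scaleR_matrix_vector_assoc[symmetric]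
        matrix_vector_mult_scaleR)
  then have V': "r *\<^sub>R (matrix_inv S ** (t0 *\<^sub>R S) ** matrix_inv S) = V" by (simp add: V_def)
  have "(\<lambda>n. r *\<^sub>R (matrix_inv (A (\<phi> n)) ** B (\<phi> n) ** matrix_inv (A (\<phi> n)))) \<longlonglongrightarrow> V"
    unfolding V'[symmetric] by (intro tendsto_intros tendsto_matrix_mult tendsto_matrix_inv Alim Blim detS)
  then have 1: "(\<lambda>n. gauss_mean f (r *\<^sub>R (matrix_inv (A (\<phi> n)) ** B (\<phi> n) ** matrix_inv (A (\<phi> n))))) \<longlonglongrightarrow> gauss_mean f V"
    by (rule gauss_mean_tendsto[OF f V])
  have "(\<lambda>n. (r * t (\<phi> n)) *\<^sub>R matrix_inv S) \<longlonglongrightarrow> V"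
    unfolding V_def using tlim by (intro tendsto_intros) (simp add: o_def)
  then have 2: "(\<lambda>n. gauss_mean f ((r * t (\<phi> n)) *\<^sub>R matrix_inv S)) \<longlonglongrightarrow> gauss_mean f V"
    by (rule gauss_mean_tendsto[OF f V])
  have "(\<lambda>n. gauss_mean f (r *\<^sub>R (matrix_inv (A (\<phi> n)) ** B (\<phi> n) ** matrix_inv (A (\<phi> n))))
      - gauss_mean f ((r * t (\<phi> n)) *\<^sub>R matrix_inv S)) \<longlonglongrightarrow> 0"
    using tendsto_diff[OF 1 2] by simp
  then have "\<forall>\<^sub>F n in sequentially. \<bar>gauss_mean f (r *\<^sub>R (matrix_inv (A (\<phi> n)) ** B (\<phi> n) ** matrix_inv (A (\<phi> n))))
      - gauss_mean f ((r * t (\<phi> n)) *\<^sub>R matrix_inv S)\<bar> < \<eta>"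
    using \<eta> by (intro order_tendstoD(2)[OF tendsto_rabs_zero]) auto
  moreover have "\<forall>\<^sub>F n in sequentially. det (A (\<phi> n)) \<noteq> 0"
    by (rule tendsto_imp_eventually_ne[OF tendsto_det[OF Alim] detS])
  ultimately have "\<forall>\<^sub>F n in sequentially. False"
    by eventually_elim (use bad in blast)
  then show False by simp
qed

section \<open>A weak law for weighted triangular arrays\<close>

text \<open>The cross terms of the squared sum have mean \<open>0\<close> by independence.\<close>

lemma (in prob_space) second_moment_weighted_indep_sum:
  fixes Z :: "'i \<Rightarrow> 'a \<Rightarrow> real" and B W :: real
  assumes J: "finite J" and ind: "indep_vars (\<lambda>_. borel) Z J"
    and B: "\<And>j \<omega>. j \<in> J \<Longrightarrow> \<bar>Z j \<omega>\<bar> \<le> B" and mean: "\<And>j. j \<in> J \<Longrightarrow> expectation (Z j) = 0"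
    and w: "\<And>j. j \<in> J \<Longrightarrow> \<bar>w j\<bar> \<le> W"
  shows "expectation (\<lambda>\<omega>. (\<Sum>j\<in>J. w j * Z j \<omega>)\<^sup>2) \<le> card J * (W * B)\<^sup>2"
proof -
  have rv [measurable]: "Z j \<in> borel_measurable M" if "j \<in> J" for j
    using ind that unfolding indep_vars_def2 by auto
  have int: "integrable M (Z j)" if "j \<in> J" for j
    by (rule integrable_const_bound[where B = B]) (use that B rv in auto)
  have int2: "integrable M (\<lambda>\<omega>. Z i \<omega> * Z j \<omega>)" if "i \<in> J" "j \<in> J" for i j
  proof (rule integrable_const_bound[where B = "B * B"])
    show "AE \<omega> in M. norm (Z i \<omega> * Z j \<omega>) \<le> B * B"
    proof (rule AE_I2)
      fix \<omega>
      have "\<bar>Z i \<omega>\<bar> * \<bar>Z j \<omega>\<bar> \<le> B * B"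
        using B[OF that(1), of \<omega>] B[OF that(2), of \<omega>] by (intro mult_mono) auto
      then show "norm (Z i \<omega> * Z j \<omega>) \<le> B * B" by (simp add: abs_mult)
    qed
  qed (use rv that in auto)
  have cross: "expectation (\<lambda>\<omega>. Z i \<omega> * Z j \<omega>) = 0" if "i \<in> J" "j \<in> J" "i \<noteq> j" for i j
  proof -
    have "expectation (\<lambda>\<omega>. \<Prod>l\<in>{i, j}. Z l \<omega>) = (\<Prod>l\<in>{i, j}. expectation (Z l))"
      by (rule indep_vars_lebesgue_integral) (use that int indep_vars_subset[OF ind, of "{i, j}"] in auto)
    then show ?thesis using that mean by simp
  qed
  have diag: "expectation (\<lambda>\<omega>. Z j \<omega> * Z j \<omega>) \<le> B\<^sup>2" if "j \<in> J" for j
  proof -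
    have "expectation (\<lambda>\<omega>. Z j \<omega> * Z j \<omega>) \<le> expectation (\<lambda>_. B\<^sup>2)"
    proof (intro integral_mono int2 that)
      fix \<omega> show "Z j \<omega> * Z j \<omega> \<le> B\<^sup>2"
        using power_mono[OF B[OF that, of \<omega>], of 2] by (simp add: power2_eq_square)
    qed simp
    then show ?thesis by (simp add: prob_space)
  qed
  have "expectation (\<lambda>\<omega>. (\<Sum>j\<in>J. w j * Z j \<omega>)\<^sup>2)
      = expectation (\<lambda>\<omega>. \<Sum>i\<in>J. \<Sum>j\<in>J. (w i * w j) * (Z i \<omega> * Z j \<omega>))"
    by (simp add: power2_eq_square sum_product ac_simps)
  also have "\<dots> = (\<Sum>i\<in>J. \<Sum>j\<in>J. (w i * w j) * expectation (\<lambda>\<omega>. Z i \<omega> * Z j \<omega>))"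
    using int2 by (simp add: Bochner_Integration.integral_sum)
  also have "\<dots> = (\<Sum>i\<in>J. (w i)\<^sup>2 * expectation (\<lambda>\<omega>. Z i \<omega> * Z i \<omega>))"
  proof (rule sum.cong[OF refl])
    fix i assume i: "i \<in> J"
    have "(\<Sum>j\<in>J. (w i * w j) * expectation (\<lambda>\<omega>. Z i \<omega> * Z j \<omega>))
        = (\<Sum>j\<in>{i}. (w i * w j) * expectation (\<lambda>\<omega>. Z i \<omega> * Z j \<omega>))"
      by (rule sum.mono_neutral_right) (use i J cross in auto)
    then show "(\<Sum>j\<in>J. (w i * w j) * expectation (\<lambda>\<omega>. Z i \<omega> * Z j \<omega>)) = (w i)\<^sup>2 * expectation (\<lambda>\<omega>. Z i \<omega> * Z i \<omega>)"
      by (simp add: power2_eq_square)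
  qed
  also have "\<dots> \<le> (\<Sum>i\<in>J. W\<^sup>2 * B\<^sup>2)"
  proof (intro sum_mono mult_mono diag)
    fix i assume "i \<in> J"
    then show "(w i)\<^sup>2 \<le> W\<^sup>2" using power_mono[OF w, of i 2] by simp
  qed auto
  finally show ?thesis by (simp add: power_mult_distrib)
qed

text \<open>A substitute for the Cauchy--Schwarz inequality between first and second moments; the parameter
\<open>c\<close> is chosen small first, after which the second moment is made small.\<close>

lemma abs_le_square_plus: "c > 0 \<Longrightarrow> \<bar>v\<bar> \<le> v\<^sup>2 / (2 * c) + c / 2" for v c :: real
proof -
  assume c: "c > 0"
  have "2 * c * \<bar>v\<bar> \<le> v\<^sup>2 + c * c"
    using zero_le_power2[of "\<bar>v\<bar> - c"] by (simp add: power2_diff power2_eq_square algebra_simps)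
  then have "2 * c * \<bar>v\<bar> / (2 * c) \<le> (v\<^sup>2 + c * c) / (2 * c)"
    using c by (intro divide_right_mono) auto
  also have "(v\<^sup>2 + c * c) / (2 * c) = v\<^sup>2 / (2 * c) + c / 2"
    using c by (simp add: add_divide_distrib)
  finally show ?thesis using c by simp
qed

definition truncate_at :: "real \<Rightarrow> real \<Rightarrow> real" where
  "truncate_at K s = (if \<bar>s\<bar> \<le> K then s else 0)"

lemma truncate_at_measurable [measurable]: "truncate_at K \<in> borel_measurable borel"
  unfolding truncate_at_def by measurable

text \<open>The summands have only a first moment, so they are truncated at \<open>K\<close>. The centred truncated parts
\<open>Z\<close> are bounded by \<open>2 K\<close> and controlled by their second moment; each of the remainders
\<open>R\<close> has absolute mean at most twice the truncation error.\<close>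

lemma (in prob_space) weighted_mean_deviation_bound:
  fixes Y :: "nat \<Rightarrow> 'a \<Rightarrow> real"
  assumes T: "T > 0" and ind: "indep_vars (\<lambda>_. borel) Y {..<T}"
    and law: "\<And>j. j < T \<Longrightarrow> distr M borel (Y j) = D" and D: "integrable D (\<lambda>s. s)"
    and w: "\<And>j. j < T \<Longrightarrow> \<bar>w j\<bar> \<le> W" and K: "K \<ge> 0" and c: "c > 0"
  shows "expectation (\<lambda>\<omega>. \<bar>(\<Sum>j<T. w j * (Y j \<omega> - (LINT s|D. s))) / T\<bar>)
    \<le> (2 * W * K)\<^sup>2 / (2 * c) / T + c / 2 + 2 * W * (LINT s|D. \<bar>s - truncate_at K s\<bar>)"
proof -
  have rv [measurable]: "Y j \<in> borel_measurable M" if "j < T" for j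
    using ind that unfolding indep_vars_def2 by auto
  have Dp: "prob_space D" using prob_space_distr[OF rv[OF T]] law[OF T] by simp
  then interpret D: prob_space D .
  have [measurable_cong, simp]: "sets D = sets borel" using law[OF T] by (metis sets_distr)
  have W: "W \<ge> 0" using w[OF T] by linarith
  define \<mu> \<mu>K \<tau> where "\<mu> = (LINT s|D. s)" and "\<mu>K = (LINT s|D. truncate_at K s)"
    and "\<tau> = (LINT s|D. \<bar>s - truncate_at K s\<bar>)"
  have Kb: "\<bar>truncate_at K s\<bar> \<le> K" for s using K by (simp add: truncate_at_def)
  have intK: "integrable D (truncate_at K)"
    by (rule D.integrable_const_bound[where B = K]) (use Kb in auto)
  have \<mu>K: "\<bar>\<mu>K\<bar> \<le> K"
  proof -
    have "\<bar>\<mu>K\<bar> \<le> (LINT s|D. \<bar>truncate_at K s\<bar>)" unfolding \<mu>K_def by (rule integral_abs_bound)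
    also have "\<dots> \<le> (LINT s|D. K)" by (intro integral_mono integrable_abs intK) (use Kb in auto)
    finally show ?thesis by (simp add: D.prob_space)
  qed
  have \<mu>\<mu>K: "\<bar>\<mu> - \<mu>K\<bar> \<le> \<tau>"
    unfolding \<mu>_def \<mu>K_def \<tau>_def using integral_abs_bound[of D "\<lambda>s. s - truncate_at K s"] D intK by simp
  define Z where "Z j \<omega> = truncate_at K (Y j \<omega>) - \<mu>K" for j \<omega>
  have Zind: "indep_vars (\<lambda>_. borel) Z {..<T}"
    unfolding Z_def by (rule indep_vars_compose2[OF ind]) measurable
  have Zrv [measurable]: "Z j \<in> borel_measurable M" if "j < T" for j using that unfolding Z_def by measurable
  have Zb: "\<bar>Z j \<omega>\<bar> \<le> 2 * K" for j \<omega> using Kb[of "Y j \<omega>"] \<mu>K by (simp add: Z_def)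
  have Zint: "integrable M (Z j)" if "j < T" for j
    by (rule integrable_const_bound[where B = "2 * K"]) (use Zb Zrv that in auto)
  have Ymean: "expectation (\<lambda>\<omega>. g (Y j \<omega>)) = (LINT s|D. g s)" if "j < T" "g \<in> borel_measurable borel" for j and g :: "real \<Rightarrow> real"
    using integral_distr[OF rv[OF that(1)] that(2)] law[OF that(1)] by simp
  have Yint: "integrable M (\<lambda>\<omega>. g (Y j \<omega>))" if "j < T" "integrable D g" "g \<in> borel_measurable borel" for j and g :: "real \<Rightarrow> real"
    using integrable_distr_eq[OF rv[OF that(1)] that(3)] law[OF that(1)] that(2) by simp
  have Zmean: "expectation (Z j) = 0" if "j < T" for j
    using Yint[OF that intK] Ymean[OF that, of "truncate_at K"]
    by (simp add: Z_def[abs_def] \<mu>K_def prob_space)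
  define R where "R j \<omega> = (Y j \<omega> - truncate_at K (Y j \<omega>)) - (\<mu> - \<mu>K)" for j \<omega>
  have Rint: "integrable M (R j)" if "j < T" for j
    unfolding R_def using Yint[OF that D] Yint[OF that intK] by simp
  have Rbound: "expectation (\<lambda>\<omega>. \<bar>R j \<omega>\<bar>) \<le> 2 * \<tau>" if "j < T" for j
  proof -
    have i: "integrable M (\<lambda>\<omega>. \<bar>Y j \<omega> - truncate_at K (Y j \<omega>)\<bar>)"
      using Yint[OF that D] Yint[OF that intK] by simp
    have "expectation (\<lambda>\<omega>. \<bar>R j \<omega>\<bar>) \<le> expectation (\<lambda>\<omega>. \<bar>Y j \<omega> - truncate_at K (Y j \<omega>)\<bar> + \<tau>)"
    proof (intro integral_mono integrable_abs Rint that Bochner_Integration.integrable_add i)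
      fix \<omega> show "\<bar>R j \<omega>\<bar> \<le> \<bar>Y j \<omega> - truncate_at K (Y j \<omega>)\<bar> + \<tau>"
        using \<mu>\<mu>K by (simp add: R_def)
    qed (use Yint[OF that D] Yint[OF that intK] in simp_all)
    also have "\<dots> = \<tau> + \<tau>"
      using i Ymean[OF that, of "\<lambda>s. \<bar>s - truncate_at K s\<bar>"] by (simp add: \<tau>_def prob_space)
    finally show ?thesis by simp
  qed
  define S where "S \<omega> = (\<Sum>j<T. w j * Z j \<omega>)" for \<omega>
  have Srv [measurable]: "S \<in> borel_measurable M" unfolding S_def by measurable
  have Sb: "\<bar>S \<omega>\<bar> \<le> T * (W * (2 * K))" for \<omega>
  proof -
    have "\<bar>S \<omega>\<bar> \<le> (\<Sum>j<T. \<bar>w j\<bar> * \<bar>Z j \<omega>\<bar>)" unfolding S_def by (rule order_trans[OF sum_abs]) (simp add: abs_mult)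
    also have "\<dots> \<le> (\<Sum>j<T. W * (2 * K))" using w Zb W by (intro sum_mono mult_mono) auto
    finally show ?thesis by simp
  qed
  have S2int: "integrable M (\<lambda>\<omega>. (S \<omega>)\<^sup>2)"
    by (rule integrable_const_bound[where B = "(T * (W * (2 * K)))\<^sup>2"])
      (use power_mono[OF Sb abs_ge_zero, where n = 2] in auto)
  have S2: "expectation (\<lambda>\<omega>. (S \<omega>)\<^sup>2) \<le> T * (W * (2 * K))\<^sup>2"
    unfolding S_def using second_moment_weighted_indep_sum[OF _ Zind Zb Zmean, of w W] w by simp
  have point: "\<bar>(\<Sum>j<T. w j * (Y j \<omega> - \<mu>)) / T\<bar>
      \<le> ((S \<omega>)\<^sup>2 / T\<^sup>2 / (2 * c) + c / 2) + (\<Sum>j<T. W / T * \<bar>R j \<omega>\<bar>)" for \<omega>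
  proof -
    have "(\<Sum>j<T. w j * (Y j \<omega> - \<mu>)) / T = S \<omega> / T + (\<Sum>j<T. w j / T * R j \<omega>)"
      by (simp add: S_def sum_divide_distrib sum.distrib[symmetric] Z_def R_def)
         (auto intro!: sum.cong simp: field_simps)
    also have "\<bar>\<dots>\<bar> \<le> \<bar>S \<omega> / T\<bar> + (\<Sum>j<T. \<bar>w j / T * R j \<omega>\<bar>)"
      by (intro order_trans[OF abs_triangle_ineq] add_left_mono sum_abs)
    also have "\<bar>S \<omega> / T\<bar> \<le> (S \<omega>)\<^sup>2 / T\<^sup>2 / (2 * c) + c / 2"
      using abs_le_square_plus[OF c, of "S \<omega> / T"] by (simp add: power_divide)
    also have "(\<Sum>j<T. \<bar>w j / T * R j \<omega>\<bar>) \<le> (\<Sum>j<T. W / T * \<bar>R j \<omega>\<bar>)"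
      using w by (intro sum_mono) (auto simp: abs_mult intro!: mult_right_mono divide_right_mono)
    finally show ?thesis by simp
  qed
  have "expectation (\<lambda>\<omega>. \<bar>(\<Sum>j<T. w j * (Y j \<omega> - \<mu>)) / T\<bar>)
      \<le> expectation (\<lambda>\<omega>. ((S \<omega>)\<^sup>2 / T\<^sup>2 / (2 * c) + c / 2) + (\<Sum>j<T. W / T * \<bar>R j \<omega>\<bar>))"
  proof (intro integral_mono point)
    have "integrable M (\<lambda>\<omega>. w j * (Y j \<omega> - \<mu>))" if "j < T" for j
      using Yint[OF that D] by simp
    then show "integrable M (\<lambda>\<omega>. \<bar>(\<Sum>j<T. w j * (Y j \<omega> - \<mu>)) / T\<bar>)"
      by (intro integrable_abs integrable_divide_zero Bochner_Integration.integrable_sum) auto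
    show "integrable M (\<lambda>\<omega>. ((S \<omega>)\<^sup>2 / T\<^sup>2 / (2 * c) + c / 2) + (\<Sum>j<T. W / T * \<bar>R j \<omega>\<bar>))"
      by (intro Bochner_Integration.integrable_add Bochner_Integration.integrable_sum integrable_divide_zero
          integrable_mult_right integrable_abs integrable_const S2int Rint) auto
  qed
  also have "\<dots> = expectation (\<lambda>\<omega>. (S \<omega>)\<^sup>2) / T\<^sup>2 / (2 * c) + c / 2 + (\<Sum>j<T. W / T * expectation (\<lambda>\<omega>. \<bar>R j \<omega>\<bar>))"
  proof -
    have i1: "integrable M (\<lambda>\<omega>. (S \<omega>)\<^sup>2 / T\<^sup>2 / (2 * c))" using S2int by simp
    have i2: "integrable M (\<lambda>\<omega>. W / T * \<bar>R j \<omega>\<bar>)" if "j < T" for j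
      by (intro integrable_mult_right integrable_abs Rint that)
    have "expectation (\<lambda>\<omega>. ((S \<omega>)\<^sup>2 / T\<^sup>2 / (2 * c) + c / 2) + (\<Sum>j<T. W / T * \<bar>R j \<omega>\<bar>))
      = expectation (\<lambda>\<omega>. (S \<omega>)\<^sup>2 / T\<^sup>2 / (2 * c)) + expectation (\<lambda>\<omega>. c / 2)
        + expectation (\<lambda>\<omega>. \<Sum>j<T. W / T * \<bar>R j \<omega>\<bar>)"
      using i1 i2 by (subst Bochner_Integration.integral_add) (auto simp del: times_divide_eq_left)
    also have "expectation (\<lambda>\<omega>. \<Sum>j<T. W / T * \<bar>R j \<omega>\<bar>) = (\<Sum>j<T. expectation (\<lambda>\<omega>. W / T * \<bar>R j \<omega>\<bar>))"
      by (rule Bochner_Integration.integral_sum) (use i2 in auto)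
    finally show ?thesis by (simp add: prob_space)
  qed
  also have "\<dots> \<le> T * (W * (2 * K))\<^sup>2 / T\<^sup>2 / (2 * c) + c / 2 + (\<Sum>j<T. W / T * (2 * \<tau>))"
    using S2 Rbound W c by (intro add_mono sum_mono mult_left_mono divide_right_mono) auto
  also have "\<dots> = (2 * W * K)\<^sup>2 / (2 * c) / T + c / 2 + 2 * W * \<tau>"
    using T by (simp add: power2_eq_square field_simps)
  finally show ?thesis unfolding \<mu>_def \<tau>_def .
qed

lemma truncation_error_tendsto_0:
  fixes D :: "real measure"
  assumes [measurable_cong]: "sets D = sets borel" and D: "integrable D (\<lambda>s. s)"
  shows "(\<lambda>K. LINT s|D. \<bar>s - truncate_at (real K) s\<bar>) \<longlonglongrightarrow> 0"
proof -
  have "(\<lambda>K. LINT s|D. \<bar>s - truncate_at (real K) s\<bar>) \<longlonglongrightarrow> (LINT s|D. 0)"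
  proof (rule integral_dominated_convergence[where w = "\<lambda>s. \<bar>s\<bar>"])
    show "AE s in D. (\<lambda>K. \<bar>s - truncate_at (real K) s\<bar>) \<longlonglongrightarrow> 0"
    proof (rule AE_I2, rule tendsto_eventually)
      fix s :: real
      obtain N :: nat where "\<bar>s\<bar> \<le> real N" using real_arch_simple[of "\<bar>s\<bar>"] by blast
      then show "\<forall>\<^sub>F K in sequentially. \<bar>s - truncate_at (real K) s\<bar> = 0"
        unfolding eventually_sequentially truncate_at_def by (intro exI[of _ N]) auto
    qed
    show "integrable D (\<lambda>s. \<bar>s\<bar>)" using D by (rule integrable_abs)
    show "AE s in D. norm \<bar>s - truncate_at (real K) s\<bar> \<le> \<bar>s\<bar>" for K
      by (simp add: truncate_at_def)
  qed measurable
  then show ?thesis by simp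
qed

text \<open>In the bound of \<open>weighted_mean_deviation_bound\<close> fix a small \<open>c\<close>, then a large \<open>K\<close>, and
finally let \<open>T\<close> grow. That bound depends on the row only through \<open>T\<close>, so each row may
live on its own probability space.\<close>

lemma weak_law_triangular_array:
  fixes M :: "nat \<Rightarrow> 'a measure" and Y :: "nat \<Rightarrow> nat \<Rightarrow> 'a \<Rightarrow> real"
  assumes P: "\<And>m. prob_space (M m)"
    and ind: "\<And>m. prob_space.indep_vars (M m) (\<lambda>_. borel) (Y m) {..<T m}"
    and law: "\<And>m j. j < T m \<Longrightarrow> distr (M m) borel (Y m j) = D"
    and D: "integrable D (\<lambda>s. s)"
    and w: "\<And>m j. j < T m \<Longrightarrow> \<bar>w m j\<bar> \<le> W"
    and T: "filterlim T at_top sequentially"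
  shows "(\<lambda>m. LINT \<omega>|M m. \<bar>(\<Sum>j<T m. w m j * (Y m j \<omega> - (LINT s|D. s))) / T m\<bar>) \<longlonglongrightarrow> 0"
proof (rule LIMSEQ_I)
  fix r :: real assume r: "r > 0"
  have T1: "\<forall>\<^sub>F m in sequentially. T m \<ge> 1" using T by (simp add: filterlim_at_top)
  then obtain m0 where m0: "T m0 \<ge> 1" using eventually_happens by force
  then have D0: "distr (M m0) borel (Y m0 0) = D" and "\<bar>w m0 0\<bar> \<le> W" using law w by auto
  then have W: "W \<ge> 0" by linarith
  have sD: "sets D = sets borel" using D0 by (metis sets_distr)
  define c where "c = r / 2"
  have c: "c > 0" using r by (simp add: c_def)
  have "\<forall>\<^sub>F K in sequentially. (LINT s|D. \<bar>s - truncate_at (real K) s\<bar>) < r / (8 * (W + 1))"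
    using r W by (intro order_tendstoD(2)[OF truncation_error_tendsto_0[OF sD D]]) auto
  then obtain K :: nat where K: "(LINT s|D. \<bar>s - truncate_at (real K) s\<bar>) < r / (8 * (W + 1))"
    using eventually_happens by force
  have "2 * W * (LINT s|D. \<bar>s - truncate_at (real K) s\<bar>) \<le> 2 * W * (r / (8 * (W + 1)))"
    using K W by (intro mult_left_mono) auto
  also have "\<dots> \<le> r / 4" using W r by (simp add: field_simps)
  finally have tail: "2 * W * (LINT s|D. \<bar>s - truncate_at (real K) s\<bar>) \<le> r / 4" .
  have "(\<lambda>m. (2 * W * real K)\<^sup>2 / (2 * c) / real (T m)) \<longlonglongrightarrow> 0"
    by (intro tendsto_divide_0[OF tendsto_const] filterlim_at_top_imp_at_infinity
        filterlim_compose[OF filterlim_real_sequentially T])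
  then have "\<forall>\<^sub>F m in sequentially. (2 * W * real K)\<^sup>2 / (2 * c) / real (T m) < r / 4"
    by (rule order_tendstoD(2)) (use r in simp)
  with T1 have "\<forall>\<^sub>F m in sequentially.
      norm ((LINT \<omega>|M m. \<bar>(\<Sum>j<T m. w m j * (Y m j \<omega> - (LINT s|D. s))) / T m\<bar>) - 0) < r"
  proof eventually_elim
    case (elim m)
    then have "T m > 0" by simp
    note bound = prob_space.weighted_mean_deviation_bound[OF P this ind law D, of "w m" W "real K" c]
    have "(LINT \<omega>|M m. \<bar>(\<Sum>j<T m. w m j * (Y m j \<omega> - (LINT s|D. s))) / T m\<bar>)
      \<le> (2 * W * real K)\<^sup>2 / (2 * c) / T m + c / 2 + 2 * W * (LINT s|D. \<bar>s - truncate_at (real K) s\<bar>)"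
      by (rule bound) (use w c in auto)
    also have "\<dots> < r" using elim(2) tail r c_def by linarith
    finally show ?case by (simp add: integral_nonneg)
  qed
  then show "\<exists>no. \<forall>m\<ge>no. norm ((LINT \<omega>|M m. \<bar>(\<Sum>j<T m. w m j * (Y m j \<omega> - (LINT s|D. s))) / T m\<bar>) - 0) < r"
    unfolding eventually_sequentially .
qed

section \<open>Normal equations of the EM estimate\<close>

definition within_dev :: "nat \<Rightarrow> (nat \<Rightarrow> real^'p) \<Rightarrow> nat \<Rightarrow> real^'p" where
  "within_dev n0 x i = x i - (\<Sum>l\<in>window n0 (i div n0). x l) /\<^sub>R real n0"

definition window_scatter :: "nat \<Rightarrow> (nat \<Rightarrow> real^'p) \<Rightarrow> nat \<Rightarrow> real^'p^'p" where
  "window_scatter n0 x j = (\<Sum>i\<in>window n0 j. outer (within_dev n0 x i) (within_dev n0 x i))"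

lemma window_div: "i \<in> window n0 j \<Longrightarrow> i div n0 = j"
proof -
  assume "i \<in> window n0 j"
  then show ?thesis by (intro div_nat_eqI) (auto simp: window_def algebra_simps)
qed

lemma sum_windows:
  fixes h :: "nat \<Rightarrow> 'b::comm_monoid_add"
  shows "(\<Sum>i<T * n0. h i) = (\<Sum>j<T. \<Sum>i\<in>window n0 j. h i)"
proof (induction T)
  case (Suc T)
  have "{..<Suc T * n0} = {..<T * n0} \<union> window n0 T"
    by (auto simp: window_def)
  moreover have "(\<Sum>i\<in>{..<T * n0} \<union> window n0 T. h i) = (\<Sum>i<T * n0. h i) + (\<Sum>i\<in>window n0 T. h i)"
    by (intro sum.union_disjoint) (auto simp: window_def)
  ultimately show ?case using Suc by simp
qed simp

lemma sum_within_dev_window: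
  assumes n0: "n0 > 0"
  shows "(\<Sum>i\<in>window n0 j. within_dev n0 x i) = 0"
proof -
  have "(\<Sum>i\<in>window n0 j. within_dev n0 x i) = (\<Sum>i\<in>window n0 j. x i - (\<Sum>l\<in>window n0 j. x l) /\<^sub>R real n0)"
    by (intro sum.cong) (auto simp: within_dev_def window_div)
  also have "\<dots> = 0" using n0 by (simp add: sum_subtractf sum_constant_scaleR window_def del: sum_constant)
  finally show ?thesis .
qed

text \<open>In each window the residuals sum to zero, so the predictors in the second estimating equation may be
replaced by their deviations from the window mean. These deviations also sum to zero in each window,
and everything constant on the window drops out: the intercept \<open>d j\<close>, the estimate \<open>a j\<close> and
the window mean of the predictors.\<close>

lemma EM_estimate_normal_equations:
  fixes x :: "nat \<Rightarrow> real^'p"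
  assumes n0: "n0 > 0"
    and y: "\<And>i. i < T * n0 \<Longrightarrow> y i = x i \<bullet> \<beta> + d (i div n0) + e i"
    and EM: "EM_estimate n0 (T * n0) x y b"
  shows "(\<Sum>j<T. window_scatter n0 x j) *v (b - \<beta>) = (\<Sum>i<T * n0. e i *\<^sub>R within_dev n0 x i)"
proof -
  obtain a where a: "\<And>j. j < T \<Longrightarrow> (\<Sum>i\<in>window n0 j. y i - a j - x i \<bullet> b) = 0"
    and eq: "(\<Sum>j<T. \<Sum>i\<in>window n0 j. (y i - a j - x i \<bullet> b) *\<^sub>R x i) = 0"
    using EM unfolding EM_estimate_iff_estimating_equations[OF n0] by blast
  have window_eq: "(\<Sum>i\<in>window n0 j. (y i - a j - x i \<bullet> b) *\<^sub>R x i)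
      = (\<Sum>i\<in>window n0 j. e i *\<^sub>R within_dev n0 x i) - window_scatter n0 x j *v (b - \<beta>)" if j: "j < T" for j
  proof -
    let ?w = "window n0 j" and ?D = "within_dev n0 x"
    define mean where "mean = (\<Sum>l\<in>?w. x l) /\<^sub>R real n0"
    have x: "x i = ?D i + mean" if "i \<in> ?w" for i
      using window_div[OF that] by (simp add: within_dev_def mean_def)
    have lt: "i < T * n0" if "i \<in> ?w" for i
    proof -
      have "i < Suc j * n0" using that by (simp add: window_def)
      also have "\<dots> \<le> T * n0" using j by (intro mult_right_mono) auto
      finally show ?thesis .
    qed
    have "(\<Sum>i\<in>?w. (y i - a j - x i \<bullet> b) *\<^sub>R x i)
        = (\<Sum>i\<in>?w. (y i - a j - x i \<bullet> b) *\<^sub>R ?D i) + (\<Sum>i\<in>?w. y i - a j - x i \<bullet> b) *\<^sub>R mean"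
      using x by (simp add: scaleR_sum_left sum.distrib[symmetric] scaleR_add_right[symmetric] cong: sum.cong)
    also have "\<dots> = (\<Sum>i\<in>?w. (y i - a j - x i \<bullet> b) *\<^sub>R ?D i)"
      using a[OF j] by simp
    also have "\<dots> = (\<Sum>i\<in>?w. e i *\<^sub>R ?D i + (d j - a j - mean \<bullet> (b - \<beta>)) *\<^sub>R ?D i - outer (?D i) (?D i) *v (b - \<beta>))"
    proof (rule sum.cong[OF refl])
      fix i assume i: "i \<in> ?w"
      have r: "y i - a j - x i \<bullet> b = e i + (d j - a j - mean \<bullet> (b - \<beta>)) - ?D i \<bullet> (b - \<beta>)"
        using y[OF lt[OF i]] window_div[OF i] x[OF i] by (simp add: inner_diff_right inner_add_left)
      show "(y i - a j - x i \<bullet> b) *\<^sub>R ?D i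
          = e i *\<^sub>R ?D i + (d j - a j - mean \<bullet> (b - \<beta>)) *\<^sub>R ?D i - outer (?D i) (?D i) *v (b - \<beta>)"
        unfolding r outer_mult_vector by (simp only: scaleR_add_left scaleR_diff_left)
    qed
    also have "\<dots> = (\<Sum>i\<in>?w. e i *\<^sub>R ?D i) - window_scatter n0 x j *v (b - \<beta>)"
      using sum_within_dev_window[OF n0, of x j]
      by (simp add: sum.distrib sum_subtractf scaleR_sum_right[symmetric] window_scatter_def sum_matrix_vector_mult)
    finally show ?thesis .
  qed
  have "(\<Sum>j<T. (\<Sum>i\<in>window n0 j. e i *\<^sub>R within_dev n0 x i) - window_scatter n0 x j *v (b - \<beta>)) = 0"
    using eq window_eq by simp
  then show ?thesis by (simp add: sum_subtractf sum_windows sum_matrix_vector_mult)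
qed

section \<open>Windows inside samples\<close>

text \<open>The sample boundaries are multiples of \<open>n0\<close>, so no window crosses one. The sample is found from
the first boundary \<open>S G\<close> to the right of the first index of the window.\<close>

lemma ex1_window_sample:
  assumes n0: "n0 > 0" and dvd: "\<And>g. g < k \<Longrightarrow> n0 dvd ns g" and j: "j < total_size k ns div n0"
  shows "\<exists>!g. g < k \<and> window n0 j \<subseteq> sample_block ns g"
proof -
  define S where "S g = (\<Sum>l<g. ns l)" for g
  have dvdS: "n0 dvd S g" if "g \<le> k" for g
    unfolding S_def using that by (intro dvd_sum dvd) auto
  have "Suc j * n0 \<le> S k"
    using j n0 by (metis S_def Suc_leI less_eq_div_iff_mult_less_eq total_size_def)
  then have jk: "j * n0 < S k" using n0 by simp
  define G where "G = (LEAST g. j * n0 < S g)"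
  have G: "j * n0 < S G" unfolding G_def using jk by (rule LeastI)
  have Gk: "G \<le> k" unfolding G_def using jk by (rule Least_le)
  have "S 0 = 0" by (simp add: S_def)
  then obtain g where g: "G = Suc g" using G by (cases G) auto
  have "\<not> j * n0 < S g" using not_less_Least[of g "\<lambda>g. j * n0 < S g"] g by (simp add: G_def)
  then have lo: "S g \<le> j * n0" by simp
  obtain q where q: "S (Suc g) = n0 * q" using dvdS[of "Suc g"] Gk g by (auto elim: dvdE)
  have "j < q" using G g q by (simp add: mult.commute)
  then have "Suc j * n0 \<le> q * n0" by (intro mult_right_mono) auto
  then have hi: "Suc j * n0 \<le> S (Suc g)" using q by (simp add: mult.commute)
  show ?thesis
  proof (rule ex1I[of _ g])
    show "g < k \<and> window n0 j \<subseteq> sample_block ns g"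
      using lo hi Gk g by (auto simp: window_def sample_block_def S_def)
    fix h assume h: "h < k \<and> window n0 j \<subseteq> sample_block ns h"
    have "j * n0 \<in> window n0 j" using n0 by (simp add: window_def)
    then have *: "S h \<le> j * n0" "j * n0 < S (Suc h)" using h by (auto simp: sample_block_def S_def)
    have mono: "S a \<le> S b" if "a \<le> b" for a b
      unfolding S_def using that by (intro sum_mono2) auto
    have "\<not> h < g" using mono[of "Suc h" g] lo * by auto
    moreover have "\<not> g < h" using mono[of "Suc g" h] * G g by auto
    ultimately show "h = g" by simp
  qed
qed

lemma window_sample:
  assumes "n0 > 0" "\<And>g. g < k \<Longrightarrow> n0 dvd ns g" "j < total_size k ns div n0"
  shows "window_sample k ns n0 j < k" "window n0 j \<subseteq> sample_block ns (window_sample k ns n0 j)"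
  using theI'[OF ex1_window_sample[OF assms, simplified]] by (auto simp: window_sample_def)

lemma avg_window_var_bounds:
  assumes n0: "n0 > 0" and dvd: "\<And>g. g < k \<Longrightarrow> n0 dvd ns g" and T: "total_size k ns div n0 > 0"
    and lo: "0 < lo" and \<sigma>: "\<And>g. g < k \<Longrightarrow> \<sigma> g \<in> {lo..hi}"
  shows "avg_window_var k ns \<sigma> n0 \<in> {lo\<^sup>2..hi\<^sup>2}"
proof -
  define T s where "T = total_size k ns div n0" and "s j = \<sigma> (window_sample k ns n0 j)" for j
  have s: "s j \<in> {lo..hi}" if "j < T" for j
    using window_sample(1)[OF n0 dvd] \<sigma> that by (simp add: s_def T_def)
  have "real T * lo\<^sup>2 \<le> (\<Sum>j<T. (s j)\<^sup>2)"
  proof -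
    have "(\<Sum>j<T. lo\<^sup>2) \<le> (\<Sum>j<T. (s j)\<^sup>2)"
      using s lo by (intro sum_mono power_mono) auto
    then show ?thesis by simp
  qed
  moreover have "(\<Sum>j<T. (s j)\<^sup>2) \<le> real T * hi\<^sup>2"
  proof -
    have "(\<Sum>j<T. (s j)\<^sup>2) \<le> (\<Sum>j<T. hi\<^sup>2)"
    proof (rule sum_mono)
      fix j assume "j \<in> {..<T}"
      then have "lo \<le> s j" "s j \<le> hi" using s by auto
      then show "(s j)\<^sup>2 \<le> hi\<^sup>2" using lo by (intro power_mono) auto
    qed
    then show ?thesis by simp
  qed
  ultimately show ?thesis using T unfolding avg_window_var_def Let_def s_def[symmetric] T_def[symmetric]
    by (simp add: field_simps)
qed

section \<open>Moments of the scatter matrix of a window\<close>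

text \<open>The scatter matrix of a block about its mean in expanded form, a polynomial in the coordinates,
from which measurability and moments can be read off.\<close>

definition block_scatter :: "nat \<Rightarrow> (nat \<Rightarrow> real^'p) \<Rightarrow> real^'p^'p" where
  "block_scatter n0 u = (\<chi> a b. (\<Sum>r<n0. u r $ a * u r $ b) - (\<Sum>r<n0. \<Sum>s<n0. u r $ a * u s $ b) / real n0)"

lemma sum_window: "(\<Sum>i\<in>window n0 j. h i) = (\<Sum>r<n0. h (j * n0 + r))"
proof -
  have "window n0 j = (\<lambda>r. j * n0 + r) ` {..<n0}"
  proof (intro equalityI subsetI)
    fix i assume "i \<in> window n0 j"
    then show "i \<in> (\<lambda>r. j * n0 + r) ` {..<n0}"
      by (intro image_eqI[of _ _ "i - j * n0"]) (auto simp: window_def)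
  qed (auto simp: window_def)
  then show ?thesis by (simp add: sum.reindex)
qed

lemma window_scatter_eq_block_scatter:
  assumes n0: "n0 > 0"
  shows "window_scatter n0 x j = block_scatter n0 (\<lambda>r\<in>{..<n0}. x (j * n0 + r))"
proof -
  define u where "u r = x (j * n0 + r)" for r
  have "window_scatter n0 x j $ a $ b = block_scatter n0 (\<lambda>r\<in>{..<n0}. u r) $ a $ b" for a b
  proof -
    define A B where "A = (\<Sum>r<n0. u r $ a)" and "B = (\<Sum>r<n0. u r $ b)"
    have div: "(j * n0 + r) div n0 = j" if "r < n0" for r using that by simp
    have "window_scatter n0 x j $ a $ b = (\<Sum>r<n0. (u r $ a - A / real n0) * (u r $ b - B / real n0))"
      by (simp add: window_scatter_def sum_window within_dev_def outer_def div u_def A_def B_def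
          divide_inverse_commute)
    also have "\<dots> = (\<Sum>r<n0. u r $ a * u r $ b) - (\<Sum>r<n0. u r $ a) * B / real n0
        - A * (\<Sum>r<n0. u r $ b) / real n0 + real n0 * (A / real n0 * (B / real n0))"
      by (simp add: algebra_simps sum.distrib sum_subtractf sum_distrib_left sum_distrib_right sum_divide_distrib)
    also have "\<dots> = (\<Sum>r<n0. u r $ a * u r $ b) - A * B / real n0"
      using n0 by (simp add: A_def[symmetric] B_def[symmetric] field_simps)
    finally show ?thesis by (simp add: block_scatter_def A_def B_def sum_product)
  qed
  then show ?thesis by (simp add: vec_eq_iff u_def)
qed

lemma borel_measurable_vec_component [measurable (raw)]:
  fixes f :: "'a \<Rightarrow> real^'p"
  assumes "f \<in> borel_measurable M" shows "(\<lambda>x. f x $ i) \<in> borel_measurable M"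
  by (rule measurable_compose[OF assms borel_measurable_continuous_onI]) (intro continuous_intros)

lemma block_scatter_measurable [measurable]:
  "(\<lambda>u. block_scatter n0 u $ a $ b) \<in> borel_measurable (PiM {..<n0} (\<lambda>_. borel))"
  unfolding block_scatter_def vec_lambda_beta by measurable

context
  fixes F :: "(real^'p) measure"
  assumes F: "prob_space F" and sF: "sets F = sets borel" and third: "integrable F (\<lambda>u. norm u ^ 3)"
begin

interpretation F: prob_space F by (rule F)

lemma sets_F [measurable_cong]: "sets F = sets borel" by (rule sF)

text \<open>Powers up to \<open>3\<close> of the norm are bounded by \<open>1 + norm u ^ 3\<close>.\<close>

lemma integrable_of_power_bound:
  fixes g :: "real^'p \<Rightarrow> 'b::{banach, second_countable_topology}"
  assumes [measurable]: "g \<in> borel_measurable borel" and g: "\<And>u. norm (g u) \<le> norm u ^ q" and q: "q \<le> 3"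
  shows "integrable F g"
proof (rule Bochner_Integration.integrable_bound)
  show "integrable F (\<lambda>u. 1 + norm u ^ 3)" using third by simp
  show "AE u in F. norm (g u) \<le> norm (1 + norm u ^ 3)"
  proof (rule AE_I2)
    fix u :: "real^'p"
    have "norm u ^ q \<le> 1 + norm u ^ 3"
    proof (cases "norm u \<le> 1")
      case True
      then have "norm u ^ q \<le> 1" by (intro power_le_one) auto
      then show ?thesis by (simp add: add_increasing2)
    next
      case False
      then have "norm u ^ q \<le> norm u ^ 3" using q by (intro power_increasing) auto
      then show ?thesis by simp
    qed
    then show "norm (g u) \<le> norm (1 + norm u ^ 3)" using g[of u] by simp
  qed
qed simp

lemma integrable_component: "integrable F (\<lambda>u. u $ a)"
  by (rule integrable_of_power_bound[where q = 1]) (auto intro: component_le_norm_cart)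

lemma integrable_component_product: "integrable F (\<lambda>u. u $ a * u $ b)"
  by (rule integrable_of_power_bound[where q = 2])
    (auto simp: abs_mult power2_eq_square intro!: mult_mono component_le_norm_cart)

lemma integral_vector_component: "(LINT u|F. u) $ a = (LINT u|F. u $ a)"
proof -
  have "integrable F (\<lambda>u. u)" by (rule integrable_of_power_bound[where q = 1]) auto
  from integral_bounded_linear[OF bounded_linear_vec_nth[of a] this] show ?thesis by simp
qed

lemma cov_mat_eq: "cov_mat F $ a $ b = (LINT u|F. u $ a * u $ b) - (LINT u|F. u $ a) * (LINT u|F. u $ b)"
proof -
  define ma mb where "ma = (LINT u|F. u $ a)" and "mb = (LINT u|F. u $ b)"
  have "cov_mat F $ a $ b = (LINT u|F. (u $ a - ma) * (u $ b - mb))"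
    by (simp add: cov_mat_def mean_vec_def integral_vector_component ma_def mb_def)
  also have "\<dots> = (LINT u|F. u $ a * u $ b - mb * u $ a - ma * u $ b + ma * mb)"
    by (simp add: algebra_simps)
  also have "\<dots> = (LINT u|F. u $ a * u $ b) - mb * ma - ma * mb + ma * mb"
    using integrable_component integrable_component_product
    by (simp add: F.prob_space ma_def[symmetric] mb_def[symmetric])
  finally show ?thesis by (simp add: ma_def mb_def)
qed

text \<open>The integrand is written as a product over all coordinates, with factors \<open>1\<close> except at
\<open>r\<close> and \<open>s\<close>; this treats \<open>r = s\<close> and \<open>r \<noteq> s\<close> alike.\<close>

lemma product_moment:
  fixes n0 :: nat
  assumes rs: "r < n0" "s < n0"
  shows "integrable (PiM {..<n0} (\<lambda>_. F)) (\<lambda>u. u r $ a * u s $ b)"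
    and "(LINT u|PiM {..<n0} (\<lambda>_. F). u r $ a * u s $ b)
      = (if r = s then LINT u|F. u $ a * u $ b else (LINT u|F. u $ a) * (LINT u|F. u $ b))"
proof -
  interpret product_sigma_finite "\<lambda>_. F"
    by (intro product_sigma_finite.intro prob_space_imp_sigma_finite F)
  define h where "h i u = (if i = r then u $ a else 1) * (if i = s then u $ b else 1)" for i and u :: "real^'p"
  have int: "integrable F (h i)" for i
    unfolding h_def using integrable_component integrable_component_product by (cases "i = r"; cases "i = s") auto
  have prod: "(\<Prod>i<n0. h i (u i)) = u r $ a * u s $ b" for u
    using rs by (simp add: h_def prod.distrib prod.delta')
  show "integrable (PiM {..<n0} (\<lambda>_. F)) (\<lambda>u. u r $ a * u s $ b)"
    using product_integrable_prod[of "{..<n0}" h] int by (simp add: prod)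
  have "(LINT u|PiM {..<n0} (\<lambda>_. F). u r $ a * u s $ b) = (\<Prod>i<n0. LINT u|F. h i u)"
    using product_integral_prod[of "{..<n0}" h] int by (simp add: prod)
  also have "\<dots> = (if r = s then LINT u|F. u $ a * u $ b else (LINT u|F. u $ a) * (LINT u|F. u $ b))"
  proof (cases "r = s")
    case True
    have "(\<Prod>i<n0. LINT u|F. h i u) = (\<Prod>i<n0. if i = r then LINT u|F. u $ a * u $ b else 1)"
      by (intro prod.cong) (auto simp: h_def True F.prob_space)
    then show ?thesis using True rs by simp
  next
    case False
    have "(\<Prod>i<n0. LINT u|F. h i u) = (\<Prod>i<n0. (if i = r then LINT u|F. u $ a else 1) * (if i = s then LINT u|F. u $ b else 1))"
      by (intro prod.cong) (auto simp: h_def False F.prob_space)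
    then show ?thesis using False rs by (simp add: prod.distrib)
  qed
  finally show "(LINT u|PiM {..<n0} (\<lambda>_. F). u r $ a * u s $ b)
      = (if r = s then LINT u|F. u $ a * u $ b else (LINT u|F. u $ a) * (LINT u|F. u $ b))" .
qed

text \<open>With \<open>p = E[u\<^sub>a u\<^sub>b]\<close> and \<open>q = E[u\<^sub>a] E[u\<^sub>b]\<close>, the double sum over the block has
\<open>n0\<close> diagonal terms of mean \<open>p\<close> and \<open>n0 (n0 - 1)\<close> further ones of mean \<open>q\<close>. This is
the loss of one degree of freedom per window.\<close>

lemma
  fixes n0 :: nat
  assumes n0: "n0 > 0"
  shows integrable_block_scatter: "integrable (PiM {..<n0} (\<lambda>_. F)) (\<lambda>u. block_scatter n0 u $ a $ b)"
    and integral_block_scatter: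
      "(LINT u|PiM {..<n0} (\<lambda>_. F). block_scatter n0 u $ a $ b) = (real n0 - 1) * cov_mat F $ a $ b"
proof -
  note int = product_moment(1) and val = product_moment(2)
  show "integrable (PiM {..<n0} (\<lambda>_. F)) (\<lambda>u. block_scatter n0 u $ a $ b)"
    unfolding block_scatter_def vec_lambda_beta
    by (intro Bochner_Integration.integrable_diff integrable_divide_zero Bochner_Integration.integrable_sum int) auto
  define p q where "p = (LINT u|F. u $ a * u $ b)" and "q = (LINT u|F. u $ a) * (LINT u|F. u $ b)"
  have "(LINT u|PiM {..<n0} (\<lambda>_. F). block_scatter n0 u $ a $ b)
      = (\<Sum>r<n0. LINT u|PiM {..<n0} (\<lambda>_. F). u r $ a * u r $ b)
        - (\<Sum>r<n0. \<Sum>s<n0. LINT u|PiM {..<n0} (\<lambda>_. F). u r $ a * u s $ b) / real n0"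
  proof -
    let ?P = "PiM {..<n0} (\<lambda>_. F)"
    have 1: "integrable ?P (\<lambda>u. \<Sum>r<n0. u r $ a * u r $ b)"
      by (intro Bochner_Integration.integrable_sum int) auto
    have 2: "integrable ?P (\<lambda>u. (\<Sum>r<n0. \<Sum>s<n0. u r $ a * u s $ b) / real n0)"
      by (intro integrable_divide_zero Bochner_Integration.integrable_sum int) auto
    have 3: "(LINT u|?P. (\<Sum>r<n0. u r $ a * u r $ b)) = (\<Sum>r<n0. LINT u|?P. u r $ a * u r $ b)"
      by (intro Bochner_Integration.integral_sum int) auto
    have "(LINT u|?P. (\<Sum>r<n0. \<Sum>s<n0. u r $ a * u s $ b)) = (\<Sum>r<n0. LINT u|?P. (\<Sum>s<n0. u r $ a * u s $ b))"
      by (intro Bochner_Integration.integral_sum Bochner_Integration.integrable_sum int) auto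
    also have "\<dots> = (\<Sum>r<n0. \<Sum>s<n0. LINT u|?P. u r $ a * u s $ b)"
      by (intro sum.cong refl Bochner_Integration.integral_sum int) auto
    finally show ?thesis
      unfolding block_scatter_def vec_lambda_beta Bochner_Integration.integral_diff[OF 1 2] 3 by simp
  qed
  also have "(\<Sum>r<n0. LINT u|PiM {..<n0} (\<lambda>_. F). u r $ a * u r $ b) = real n0 * p"
    by (simp add: val p_def)
  also have "(\<Sum>r<n0. \<Sum>s<n0. LINT u|PiM {..<n0} (\<lambda>_. F). u r $ a * u s $ b) = (\<Sum>r<n0. p + (real n0 - 1) * q)"
  proof (rule sum.cong[OF refl])
    fix r assume r: "r \<in> {..<n0}"
    have "(\<Sum>s<n0. LINT u|PiM {..<n0} (\<lambda>_. F). u r $ a * u s $ b) = (\<Sum>s<n0. q + (if r = s then p - q else 0))"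
      using r by (intro sum.cong) (auto simp: val p_def q_def)
    also have "\<dots> = real n0 * q + (p - q)" using r by (simp add: sum.distrib)
    finally show "(\<Sum>s<n0. LINT u|PiM {..<n0} (\<lambda>_. F). u r $ a * u s $ b) = p + (real n0 - 1) * q"
      by (simp add: algebra_simps)
  qed
  also have "real n0 * p - (\<Sum>r<n0. p + (real n0 - 1) * q) / real n0 = (real n0 - 1) * (p - q)"
    using n0 by (simp add: field_simps)
  finally show "(LINT u|PiM {..<n0} (\<lambda>_. F). block_scatter n0 u $ a $ b) = (real n0 - 1) * cov_mat F $ a $ b"
    by (simp add: cov_mat_eq p_def q_def)
qed

end

section \<open>The joint law of predictors and errors\<close>

lemma Int_stable_vimage:
  assumes "Int_stable G"
  shows "Int_stable {f -` A \<inter> \<Omega> |A. A \<in> G}"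
proof (safe intro!: Int_stableI)
  fix A B assume "A \<in> G" "B \<in> G"
  then have "A \<inter> B \<in> G" using assms by (auto simp: Int_stable_def)
  then show "\<exists>C. f -` A \<inter> \<Omega> \<inter> (f -` B \<inter> \<Omega>) = f -` C \<inter> \<Omega> \<and> C \<in> G"
    by (intro exI[of _ "A \<inter> B"]) auto
qed

text \<open>If the pairs \<open>(X\<^sub>i, Y\<^sub>i)\<close> are independent across \<open>i\<close> and each pair has independent
components, then the family \<open>X\<close> is independent of the family \<open>Y\<close>. For rectangles with sides
\<open>A\<^sub>i\<close> and \<open>B\<^sub>i\<close> the probabilities factor over \<open>i\<close> and within each \<open>i\<close>, and
rectangles form a generator stable under intersections.\<close>

lemma (in prob_space) distr_pair_of_families:
  assumes I: "finite I" "I \<noteq> {}"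
    and pairs: "indep_vars (\<lambda>i. S \<Otimes>\<^sub>M R) (\<lambda>i \<omega>. (X i \<omega>, Y i \<omega>)) I"
    and rvX [measurable]: "\<And>i. i \<in> I \<Longrightarrow> X i \<in> measurable M S"
    and rvY [measurable]: "\<And>i. i \<in> I \<Longrightarrow> Y i \<in> measurable M R"
    and each: "\<And>i A B. i \<in> I \<Longrightarrow> A \<in> sets S \<Longrightarrow> B \<in> sets R \<Longrightarrow>
      prob (X i -` A \<inter> space M \<inter> (Y i -` B \<inter> space M)) = prob (X i -` A \<inter> space M) * prob (Y i -` B \<inter> space M)"
  shows "distr M (PiM I (\<lambda>_. S) \<Otimes>\<^sub>M PiM I (\<lambda>_. R)) (\<lambda>\<omega>. (\<lambda>i\<in>I. X i \<omega>, \<lambda>i\<in>I. Y i \<omega>))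
    = PiM I (\<lambda>i. distr M S (X i)) \<Otimes>\<^sub>M PiM I (\<lambda>i. distr M R (Y i))"
proof -
  have indX: "indep_vars (\<lambda>_. S) X I" using indep_vars_compose2[OF pairs, of "\<lambda>_. fst" "\<lambda>_. S"] by simp
  have indY: "indep_vars (\<lambda>_. R) Y I" using indep_vars_compose2[OF pairs, of "\<lambda>_. snd" "\<lambda>_. R"] by simp
  define fX fY where "fX \<omega> = (\<lambda>i\<in>I. X i \<omega>)" and "fY \<omega> = (\<lambda>i\<in>I. Y i \<omega>)" for \<omega>
  have mX: "fX \<in> measurable M (PiM I (\<lambda>_. S))" unfolding fX_def by (rule measurable_restrict) simp
  have mY: "fY \<in> measurable M (PiM I (\<lambda>_. R))" unfolding fY_def by (rule measurable_restrict) simp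
  have maps: "fX \<in> space M \<rightarrow> (\<Pi>\<^sub>E i\<in>I. space S)" "fY \<in> space M \<rightarrow> (\<Pi>\<^sub>E i\<in>I. space R)"
    using measurable_space[OF mX] measurable_space[OF mY] by (auto simp: space_PiM)
  define GX where "GX = {fX -` A \<inter> space M |A. A \<in> prod_algebra I (\<lambda>_. S)}"
  define GY where "GY = {fY -` A \<inter> space M |A. A \<in> prod_algebra I (\<lambda>_. R)}"
  have stable: "Int_stable GX" "Int_stable GY"
    unfolding GX_def GY_def by (intro Int_stable_vimage Int_stable_prod_algebra)+
  have cylX: "fX -` PiE I A \<inter> space M = (\<Inter>i\<in>I. X i -` A i \<inter> space M)" for A
    using I by (auto simp: fX_def PiE_iff)
  have cylY: "fY -` PiE I A \<inter> space M = (\<Inter>i\<in>I. Y i -` A i \<inter> space M)" for A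
    using I by (auto simp: fY_def PiE_iff)
  have "indep_set GX GY"
    unfolding indep_sets2_eq
  proof (intro conjI ballI)
    have "prod_algebra I (\<lambda>_. S) \<subseteq> sets (PiM I (\<lambda>_. S))" "prod_algebra I (\<lambda>_. R) \<subseteq> sets (PiM I (\<lambda>_. R))"
      unfolding sets_PiM by auto
    then show "GX \<subseteq> events" "GY \<subseteq> events"
      using measurable_sets[OF mX] measurable_sets[OF mY] by (auto simp: GX_def GY_def)
    fix a b assume "a \<in> GX" "b \<in> GY"
    then obtain A B where A: "A \<in> (\<Pi> i\<in>I. sets S)" "a = fX -` PiE I A \<inter> space M"
      and B: "B \<in> (\<Pi> i\<in>I. sets R)" "b = fY -` PiE I B \<inter> space M"
      unfolding GX_def GY_def prod_algebra_eq_finite[OF I(1)] by blast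
    have "a \<inter> b = (\<Inter>i\<in>I. (\<lambda>\<omega>. (X i \<omega>, Y i \<omega>)) -` (A i \<times> B i) \<inter> space M)"
      unfolding A(2) B(2) cylX cylY using I by auto
    also have "prob \<dots> = (\<Prod>i\<in>I. prob ((\<lambda>\<omega>. (X i \<omega>, Y i \<omega>)) -` (A i \<times> B i) \<inter> space M))"
      by (rule indep_varsD_finite[OF pairs I(2,1)]) (use A(1) B(1) in auto)
    also have "\<dots> = (\<Prod>i\<in>I. prob (X i -` A i \<inter> space M) * prob (Y i -` B i \<inter> space M))"
    proof (rule prod.cong[OF refl])
      fix i assume i: "i \<in> I"
      have "(\<lambda>\<omega>. (X i \<omega>, Y i \<omega>)) -` (A i \<times> B i) \<inter> space M = X i -` A i \<inter> space M \<inter> (Y i -` B i \<inter> space M)"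
        by auto
      then show "prob ((\<lambda>\<omega>. (X i \<omega>, Y i \<omega>)) -` (A i \<times> B i) \<inter> space M) = prob (X i -` A i \<inter> space M) * prob (Y i -` B i \<inter> space M)"
        using each[OF i, of "A i" "B i"] A(1) B(1) i by (auto simp: Pi_iff)
    qed
    also have "\<dots> = prob a * prob b"
      unfolding A(2) B(2) cylX cylY prod.distrib
      using indep_varsD_finite[OF indX I(2,1), of A] indep_varsD_finite[OF indY I(2,1), of B] A(1) B(1)
      by (auto simp: Pi_iff)
    finally show "prob (a \<inter> b) = prob a * prob b" .
  qed
  then have indep: "indep_set (sigma_sets (space M) GX) (sigma_sets (space M) GY)"
    by (rule indep_set_sigma_sets[OF _ stable])
  have genX: "sigma_sets (space M) {fX -` A \<inter> space M |A. A \<in> sets (PiM I (\<lambda>_. S))} = sigma_sets (space M) GX"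
    unfolding sets_PiM GX_def by (subst sigma_sets_vimage_commute[OF maps(1)]) (rule sigma_sets_sigma_sets_eq, auto)
  have genY: "sigma_sets (space M) {fY -` A \<inter> space M |A. A \<in> sets (PiM I (\<lambda>_. R))} = sigma_sets (space M) GY"
    unfolding sets_PiM GY_def by (subst sigma_sets_vimage_commute[OF maps(2)]) (rule sigma_sets_sigma_sets_eq, auto)
  have "distr M (PiM I (\<lambda>_. S)) fX = PiM I (\<lambda>i. distr M S (X i))"
    using indep_vars_iff_distr_eq_PiM'[OF I(2), where M' = "\<lambda>_. S" and X = X] indX rvX by (simp add: fX_def[abs_def])
  moreover have "distr M (PiM I (\<lambda>_. R)) fY = PiM I (\<lambda>i. distr M R (Y i))"
    using indep_vars_iff_distr_eq_PiM'[OF I(2), where M' = "\<lambda>_. R" and X = Y] indY rvY by (simp add: fY_def[abs_def])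
  moreover have "distr M (PiM I (\<lambda>_. S)) fX \<Otimes>\<^sub>M distr M (PiM I (\<lambda>_. R)) fY
      = distr M (PiM I (\<lambda>_. S) \<Otimes>\<^sub>M PiM I (\<lambda>_. R)) (\<lambda>\<omega>. (fX \<omega>, fY \<omega>))" (is "?DX \<Otimes>\<^sub>M ?DY = ?J")
  proof (rule pair_measure_eqI)
    show "sigma_finite_measure ?DX" "sigma_finite_measure ?DY"
      by (intro prob_space_imp_sigma_finite prob_space_distr mX mY)+
    fix A B assume "A \<in> sets ?DX" "B \<in> sets ?DY"
    then have A: "A \<in> sets (PiM I (\<lambda>_. S))" and B: "B \<in> sets (PiM I (\<lambda>_. R))" by simp_all
    have "prob (fX -` A \<inter> space M \<inter> (fY -` B \<inter> space M)) = prob (fX -` A \<inter> space M) * prob (fY -` B \<inter> space M)"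
    proof (rule indep_setD[OF indep])
      show "fX -` A \<inter> space M \<in> sigma_sets (space M) GX" unfolding genX[symmetric] using A by blast
      show "fY -` B \<inter> space M \<in> sigma_sets (space M) GY" unfolding genY[symmetric] using B by blast
    qed
    moreover have "(\<lambda>\<omega>. (fX \<omega>, fY \<omega>)) -` (A \<times> B) \<inter> space M = fX -` A \<inter> space M \<inter> (fY -` B \<inter> space M)"
      by auto
    moreover have "(\<lambda>\<omega>. (fX \<omega>, fY \<omega>)) \<in> measurable M (PiM I (\<lambda>_. S) \<Otimes>\<^sub>M PiM I (\<lambda>_. R))"
      by (rule measurable_Pair[OF mX mY])
    ultimately show "emeasure ?DX A * emeasure ?DY B = emeasure ?J (A \<times> B)"
      using A B mX mY by (simp add: emeasure_distr emeasure_eq_measure ennreal_mult)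
  qed simp
  ultimately show ?thesis by (simp add: fX_def fY_def)
qed

text \<open>The independence across observations is about the pairs \<open>(x\<^sub>i, y\<^sub>i)\<close>. It carries over to
\<open>e\<^sub>i = y\<^sub>i - x\<^sub>i \<bullet> \<beta> - d\<^sub>i\<close>, which is a function of the pair because the intercept is
the constant \<open>d\<^sub>i\<close> up to a null set. Outside this null set \<open>e\<^sub>i\<close> is the error
\<open>\<epsilon>\<^sub>i\<close>, from which it inherits the normal law and the independence of \<open>x\<^sub>i\<close>.\<close>

lemma (in k_sample_model) joint_law_predictors_errors:
  fixes n0 :: nat
  defines "n \<equiv> total_size k ns"
  defines "d \<equiv> \<lambda>i. c (window_sample k ns n0 (i div n0))"
  defines "s \<equiv> \<lambda>i. \<sigma> (window_sample k ns n0 (i div n0))"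
  defines "e \<equiv> \<lambda>i \<omega>. y i \<omega> - x i \<omega> \<bullet> \<beta> - d i"
  assumes n: "n > 0"
    and sample: "\<And>i. i < n \<Longrightarrow> window_sample k ns n0 (i div n0) < k"
      "\<And>i. i < n \<Longrightarrow> i \<in> sample_block ns (window_sample k ns n0 (i div n0))"
  shows "(\<lambda>\<omega>. (\<lambda>i\<in>{..<n}. x i \<omega>, \<lambda>i\<in>{..<n}. e i \<omega>))
      \<in> measurable M (PiM {..<n} (\<lambda>_. borel) \<Otimes>\<^sub>M PiM {..<n} (\<lambda>_. borel))"
    and "distr M (PiM {..<n} (\<lambda>_. borel) \<Otimes>\<^sub>M PiM {..<n} (\<lambda>_. borel)) (\<lambda>\<omega>. (\<lambda>i\<in>{..<n}. x i \<omega>, \<lambda>i\<in>{..<n}. e i \<omega>))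
      = PiM {..<n} (\<lambda>_. F) \<Otimes>\<^sub>M PiM {..<n} (\<lambda>i. density lborel (normal_density 0 (s i)))"
proof -
  have ne: "{..<n} \<noteq> {}" using n by auto
  have x [measurable]: "x i \<in> borel_measurable M" if "i < n" for i
    using measurable_components that by (auto simp: n_def)
  have \<epsilon> [measurable]: "\<epsilon> i \<in> borel_measurable M" if "i < n" for i
    using measurable_components that by (auto simp: n_def)
  have \<nu> [measurable]: "\<nu> i \<in> borel_measurable M" if "i < n" for i
    using measurable_components that by (auto simp: n_def)
  have y [measurable]: "y i \<in> borel_measurable M" if "i < n" for i
  proof -
    have "(\<lambda>\<omega>. (x i \<omega>, y i \<omega>)) \<in> measurable M (borel \<Otimes>\<^sub>M borel)"
      using indep_observations that unfolding indep_vars_def2 n_def by auto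
    from measurable_compose[OF this measurable_snd] show ?thesis by simp
  qed
  have e [measurable]: "e i \<in> borel_measurable M" if "i < n" for i
    using that unfolding e_def by measurable
  have AE_e: "AE \<omega> in M. e i \<omega> = \<epsilon> i \<omega>" if i: "i < n" for i
  proof -
    have "distr M borel (\<nu> i) = return borel (d i)"
      unfolding d_def by (rule intercept_law) (use sample i in auto)
    then have "AE t in distr M borel (\<nu> i). t = d i"
      by (rule ssubst) (subst AE_return, auto)
    then have "AE \<omega> in M. \<nu> i \<omega> = d i"
      by (subst (asm) AE_distr_iff) (use i in auto)
    then show ?thesis
      by (rule AE_mp, intro AE_I2 impI) (use response[of i] i in \<open>auto simp: e_def n_def\<close>)
  qed
  have law_e: "distr M borel (e i) = density lborel (normal_density 0 (s i))" if i: "i < n" for i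
  proof -
    have "distributed M lborel (\<epsilon> i) (normal_density 0 (s i))"
      unfolding s_def by (rule error_law) (use sample i in auto)
    then have "distr M lborel (\<epsilon> i) = density lborel (normal_density 0 (s i))"
      by (rule distributed_distr_eq_density)
    moreover have "distr M borel (e i) = distr M lborel (\<epsilon> i)"
      using AE_e[OF i] i by (intro distr_cong_AE) auto
    ultimately show ?thesis by simp
  qed
  have each: "prob (x i -` A \<inter> space M \<inter> (e i -` B \<inter> space M)) = prob (x i -` A \<inter> space M) * prob (e i -` B \<inter> space M)"
    if i: "i < n" and A [measurable]: "A \<in> sets borel" "B \<in> sets borel" for i A B
  proof -
    have "prob (x i -` A \<inter> space M \<inter> (e i -` B \<inter> space M)) = prob {\<omega> \<in> space M. x i \<omega> \<in> A \<and> \<nu> i \<omega> \<in> UNIV \<and> \<epsilon> i \<omega> \<in> B}"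
      using AE_e[OF i] i by (intro finite_measure_eq_AE) auto
    also have "\<dots> = prob {\<omega> \<in> space M. x i \<omega> \<in> A} * prob {\<omega> \<in> space M. \<nu> i \<omega> \<in> UNIV} * prob {\<omega> \<in> space M. \<epsilon> i \<omega> \<in> B}"
      by (rule mutually_indep) (use i A in \<open>auto simp: n_def\<close>)
    also have "prob {\<omega> \<in> space M. \<epsilon> i \<omega> \<in> B} = prob (e i -` B \<inter> space M)"
      using AE_e[OF i] i by (intro finite_measure_eq_AE) auto
    also have "prob {\<omega> \<in> space M. x i \<omega> \<in> A} = prob (x i -` A \<inter> space M)"
      by (intro arg_cong[where f = prob]) auto
    finally show "prob (x i -` A \<inter> space M \<inter> (e i -` B \<inter> space M)) = prob (x i -` A \<inter> space M) * prob (e i -` B \<inter> space M)"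
      by (simp add: prob_space)
  qed
  have "indep_vars (\<lambda>_. borel \<Otimes>\<^sub>M borel) (\<lambda>i \<omega>. (\<lambda>(u, t). (u, t - u \<bullet> \<beta> - d i)) (x i \<omega>, y i \<omega>)) {..<n}"
    by (rule indep_vars_compose2[OF indep_observations[folded n_def]]) measurable
  then have pairs: "indep_vars (\<lambda>_. borel \<Otimes>\<^sub>M borel) (\<lambda>i \<omega>. (x i \<omega>, e i \<omega>)) {..<n}"
    by (simp add: e_def)
  show "(\<lambda>\<omega>. (\<lambda>i\<in>{..<n}. x i \<omega>, \<lambda>i\<in>{..<n}. e i \<omega>))
      \<in> measurable M (PiM {..<n} (\<lambda>_. borel) \<Otimes>\<^sub>M PiM {..<n} (\<lambda>_. borel))"
    by (intro measurable_Pair measurable_restrict x e) auto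
  have "distr M (PiM {..<n} (\<lambda>_. borel) \<Otimes>\<^sub>M PiM {..<n} (\<lambda>_. borel)) (\<lambda>\<omega>. (\<lambda>i\<in>{..<n}. x i \<omega>, \<lambda>i\<in>{..<n}. e i \<omega>))
      = PiM {..<n} (\<lambda>i. distr M borel (x i)) \<Otimes>\<^sub>M PiM {..<n} (\<lambda>i. distr M borel (e i))"
    by (rule distr_pair_of_families[OF finite_lessThan ne pairs]) (use each x e in auto)
  also have "PiM {..<n} (\<lambda>i. distr M borel (x i)) = PiM {..<n} (\<lambda>_. F)"
    using predictor_law by (intro PiM_cong) (auto simp: n_def)
  also have "PiM {..<n} (\<lambda>i. distr M borel (e i)) = PiM {..<n} (\<lambda>i. density lborel (normal_density 0 (s i)))"
    using law_e by (intro PiM_cong) auto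
  finally show "distr M (PiM {..<n} (\<lambda>_. borel) \<Otimes>\<^sub>M PiM {..<n} (\<lambda>_. borel)) (\<lambda>\<omega>. (\<lambda>i\<in>{..<n}. x i \<omega>, \<lambda>i\<in>{..<n}. e i \<omega>))
      = PiM {..<n} (\<lambda>_. F) \<Otimes>\<^sub>M PiM {..<n} (\<lambda>i. density lborel (normal_density 0 (s i)))" .
qed

lemma (in k_sample_model) predictor_law_prob_space:
  assumes "total_size k ns > 0"
  shows "prob_space F" "sets F = sets borel"
  using predictor_law[OF assms] measurable_components[OF assms] prob_space_distr[of "x 0" borel] by auto

section \<open>The covariance of the estimator given the predictors\<close>

text \<open>The factor is chosen so that the expectation is the average weight times the covariance of the
predictors.\<close>

definition scaled_scatter :: "nat \<Rightarrow> nat \<Rightarrow> (nat \<Rightarrow> real) \<Rightarrow> (nat \<Rightarrow> real^'p) \<Rightarrow> real^'p^'p" where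
  "scaled_scatter n0 T w x = (1 / (real T * (real n0 - 1))) *\<^sub>R (\<Sum>j<T. w j *\<^sub>R window_scatter n0 x j)"

lemma scaled_scatter_eq_sum:
  "scaled_scatter n0 T w x = (\<Sum>i<T * n0. (w (i div n0) / (real T * (real n0 - 1))) *\<^sub>R outer (within_dev n0 x i) (within_dev n0 x i))"
  by (simp add: scaled_scatter_def window_scatter_def sum_windows scaleR_sum_right window_div cong: sum.cong)

text \<open>The vectors \<open>a i\<close> are the coefficients of the errors in the scaled estimation error. Their
weighted outer products add up to the sandwich form because \<open>A\<^sup>-\<^sup>1\<close> is symmetric. If the
quadratic form vanished at \<open>v\<close>, all deviations would be orthogonal to \<open>A\<^sup>-\<^sup>1 v\<close>, so that
\<open>v = A (A\<^sup>-\<^sup>1 v) = 0\<close>.\<close>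

lemma conditional_covariance:
  fixes x :: "nat \<Rightarrow> real^'p"
  assumes n0: "n0 \<ge> 2" and T: "T > 0" and w: "\<And>j. j < T \<Longrightarrow> w j > 0"
  defines "A \<equiv> scaled_scatter n0 T (\<lambda>_. 1) x"
  defines "a \<equiv> \<lambda>i. (sqrt (real (T * n0)) / (real T * (real n0 - 1))) *\<^sub>R (matrix_inv A *v within_dev n0 x i)"
  assumes det: "det A \<noteq> 0"
  shows "(\<Sum>i<T * n0. (w (i div n0))\<^sup>2 *\<^sub>R outer (a i) (a i))
      = (real n0 / (real n0 - 1)) *\<^sub>R (matrix_inv A ** scaled_scatter n0 T (\<lambda>j. (w j)\<^sup>2) x ** matrix_inv A)"
    and "pos_def (\<Sum>i<T * n0. (w (i div n0))\<^sup>2 *\<^sub>R outer (a i) (a i))"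
proof -
  let ?D = "within_dev n0 x"
  define N where "N = real T * (real n0 - 1)"
  have N: "N > 0" using n0 T by (simp add: N_def)
  have symA: "transpose A = A" unfolding A_def scaled_scatter_eq_sum by (rule transpose_outer_sum)
  have symI: "transpose (matrix_inv A) = matrix_inv A" by (rule transpose_matrix_inv[OF symA det])
  have scaled: "outer (c *\<^sub>R u) (c *\<^sub>R u) = c\<^sup>2 *\<^sub>R outer u u" for c and u :: "real^'p"
    by (simp add: vec_eq_iff outer_def power2_eq_square)
  have mat_scale: "M ** (c *\<^sub>R Q) = c *\<^sub>R (M ** Q)" "(c *\<^sub>R Q) ** M = c *\<^sub>R (Q ** M)" for c and M Q :: "real^'p^'p"
    by (simp_all add: matrix_eq matrix_vector_mul_assoc[symmetric] scaleR_matrix_vector_assoc[symmetric] matrix_vector_mult_scaleR)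
  \<comment> \<open>one factor \<open>1 / N\<close> is absorbed by the scaling of the weighted scatter matrix\<close>
  have c: "(sqrt (real (T * n0)) / N)\<^sup>2 = (real n0 / (real n0 - 1)) / N"
    using n0 T by (simp add: power_divide N_def power2_eq_square)
  have "(\<Sum>i<T * n0. (w (i div n0))\<^sup>2 *\<^sub>R outer (a i) (a i))
      = (\<Sum>i<T * n0. (real n0 / (real n0 - 1)) *\<^sub>R (matrix_inv A ** (((w (i div n0))\<^sup>2 / N) *\<^sub>R outer (?D i) (?D i)) ** matrix_inv A))"
    unfolding a_def scaled N_def[symmetric] c outer_matrix_vector_mult symI mat_scale by (simp add: ac_simps)
  also have "\<dots> = (real n0 / (real n0 - 1)) *\<^sub>R (matrix_inv A ** scaled_scatter n0 T (\<lambda>j. (w j)\<^sup>2) x ** matrix_inv A)"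
    unfolding scaled_scatter_eq_sum N_def[symmetric] matrix_mult_sum_left matrix_mult_sum_right scaleR_sum_right ..
  finally show "(\<Sum>i<T * n0. (w (i div n0))\<^sup>2 *\<^sub>R outer (a i) (a i))
      = (real n0 / (real n0 - 1)) *\<^sub>R (matrix_inv A ** scaled_scatter n0 T (\<lambda>j. (w j)\<^sup>2) x ** matrix_inv A)" .
  show "pos_def (\<Sum>i<T * n0. (w (i div n0))\<^sup>2 *\<^sub>R outer (a i) (a i))"
    unfolding pos_def_def
  proof (intro conjI allI impI transpose_outer_sum)
    fix v :: "real^'p" assume v: "v \<noteq> 0"
    have quad: "v \<bullet> ((\<Sum>i<T * n0. (w (i div n0))\<^sup>2 *\<^sub>R outer (a i) (a i)) *v v) = (\<Sum>i<T * n0. (w (i div n0))\<^sup>2 * (a i \<bullet> v)\<^sup>2)"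
      by (simp add: sum_matrix_vector_mult scaleR_matrix_vector_assoc[symmetric] outer_mult_vector inner_sum_right
          power2_eq_square inner_commute mult.assoc)
    have nonneg: "(\<Sum>i<T * n0. (w (i div n0))\<^sup>2 * (a i \<bullet> v)\<^sup>2) \<ge> 0" by (intro sum_nonneg) auto
    moreover have "(\<Sum>i<T * n0. (w (i div n0))\<^sup>2 * (a i \<bullet> v)\<^sup>2) \<noteq> 0"
    proof
      assume "(\<Sum>i<T * n0. (w (i div n0))\<^sup>2 * (a i \<bullet> v)\<^sup>2) = 0"
      then have zero: "a i \<bullet> v = 0" if "i < T * n0" for i
        using that w[OF less_mult_imp_div_less[OF that]]
        by (subst (asm) sum_nonneg_eq_0_iff) (auto dest!: bspec[where x = i])
      have "sqrt (real (T * n0)) / N \<noteq> 0" using N n0 T by simp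
      then have "(matrix_inv A *v ?D i) \<bullet> v = 0" if "i < T * n0" for i
        using zero[OF that] by (simp add: a_def N_def)
      define z where "z = matrix_inv A *v v"
      have D: "?D i \<bullet> z = 0" if "i < T * n0" for i
        unfolding z_def using \<open>\<And>i. i < T * n0 \<Longrightarrow> (matrix_inv A *v ?D i) \<bullet> v = 0\<close>[OF that] symmetric_inner_matrix_vector[OF symI, of "?D i" v] by (simp add: inner_commute)
      have "A *v z = 0"
        unfolding A_def scaled_scatter_eq_sum sum_matrix_vector_mult
        by (intro sum.neutral) (use D in \<open>auto simp: scaleR_matrix_vector_assoc[symmetric] outer_mult_vector\<close>)
      then show False using v matrix_inv_vector_mult(1)[OF det] by (simp add: z_def)
    qed
    ultimately show "v \<bullet> ((\<Sum>i<T * n0. (w (i div n0))\<^sup>2 *\<^sub>R outer (a i) (a i)) *v v) > 0"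
      unfolding quad by simp
  qed
qed

section \<open>Concentration of the scatter matrices\<close>

lemma borel_measurable_vecI:
  fixes f :: "'a \<Rightarrow> ('b::euclidean_space)^'n"
  assumes [measurable]: "\<And>i. (\<lambda>x. f x $ i) \<in> borel_measurable M"
  shows "f \<in> borel_measurable M"
proof -
  have "(\<lambda>x. f x \<bullet> b) \<in> borel_measurable M" if b: "b \<in> Basis" for b
  proof -
    obtain i u where "b = axis i u" using b by (auto simp: Basis_vec_def)
    then show ?thesis by (simp add: inner_axis)
  qed
  then show ?thesis by (rule borel_measurable_euclidean_space[THEN iffD2, rule_format])
qed

lemma window_subset: "j < T \<Longrightarrow> window n0 j \<subseteq> {..<T * n0}"
proof -
  assume "j < T"
  then have "Suc j * n0 \<le> T * n0" by (intro mult_right_mono) auto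
  then show ?thesis by (auto simp: window_def)
qed

lemma measurable_within_dev:
  assumes "i < T * n0"
  shows "(\<lambda>u. within_dev n0 u i) \<in> borel_measurable (PiM {..<T * n0} (\<lambda>_. borel))"
proof -
  have "(\<lambda>u. u l) \<in> borel_measurable (PiM {..<T * n0} (\<lambda>_. borel))" if "l < T * n0" for l
    using that by (intro measurable_component_singleton) auto
  then show ?thesis
    unfolding within_dev_def using assms window_subset[OF less_mult_imp_div_less[OF assms], of n0]
    by (intro borel_measurable_diff borel_measurable_scaleR borel_measurable_sum borel_measurable_const) auto
qed

lemma measurable_scaled_scatter:
  "(\<lambda>u. scaled_scatter n0 T w u $ k $ l) \<in> borel_measurable (PiM {..<T * n0} (\<lambda>_. borel))"
proof -
  have "(\<lambda>u. \<Sum>i<T * n0. (w (i div n0) / (real T * (real n0 - 1))) * (within_dev n0 u i $ k * within_dev n0 u i $ l))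
      \<in> borel_measurable (PiM {..<T * n0} (\<lambda>_. borel))"
    by (intro borel_measurable_sum borel_measurable_times borel_measurable_const borel_measurable_vec_component
        measurable_within_dev) auto
  then show ?thesis by (simp add: scaled_scatter_eq_sum outer_def)
qed

text \<open>The law of the predictors lives on functions restricted to the index set \<open>{..<T * n0}\<close>; the
statistics are the same for a sequence and its restriction.\<close>

lemma within_dev_restrict:
  assumes "i < T * n0"
  shows "within_dev n0 (restrict x {..<T * n0}) i = within_dev n0 x i"
  using assms window_subset[OF less_mult_imp_div_less[OF assms], of n0] unfolding within_dev_def
  by (auto intro!: arg_cong2[where f = "(-)"] arg_cong[where f = "\<lambda>v. v /\<^sub>R real n0"] sum.cong)

lemma window_scatter_restrict:
  assumes j: "j < T"
  shows "window_scatter n0 (restrict x {..<T * n0}) j = window_scatter n0 x j"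
  unfolding window_scatter_def using window_subset[OF j, of n0]
  by (intro sum.cong refl) (auto simp: within_dev_restrict)

lemma borel_measurable_det:
  fixes f :: "'a \<Rightarrow> real^'p^'p"
  assumes "\<And>k l. (\<lambda>x. f x $ k $ l) \<in> borel_measurable M"
  shows "(\<lambda>x. det (f x)) \<in> borel_measurable M"
  unfolding det_def using assms
  by (intro borel_measurable_sum borel_measurable_times borel_measurable_prod borel_measurable_const)

lemma borel_measurable_cramer_inv_mult:
  fixes f :: "'a \<Rightarrow> real^'p^'p"
  assumes f: "\<And>k l. (\<lambda>x. f x $ k $ l) \<in> borel_measurable M" and g: "g \<in> borel_measurable M"
  shows "(\<lambda>x. cramer_inv (f x) *v g x) \<in> borel_measurable M"
proof (rule borel_measurable_vecI)
  fix i
  have "(\<lambda>x. if l = i then axis j 1 $ k else f x $ k $ l) \<in> borel_measurable M" for i j k l :: 'p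
    using f by (cases "l = i") auto
  then have minor: "(\<lambda>x. det (\<chi> k l. if l = i then axis j 1 $ k else f x $ k $ l)) \<in> borel_measurable M" for i j :: 'p
    by (intro borel_measurable_det) simp
  show "(\<lambda>x. (cramer_inv (f x) *v g x) $ i) \<in> borel_measurable M"
    unfolding cramer_inv_def matrix_vector_mult_def vec_lambda_beta
    by (intro borel_measurable_sum borel_measurable_times borel_measurable_divide minor borel_measurable_det f
        borel_measurable_vec_component[OF g])
qed

lemma indep_vars_PiM_coordinates:
  assumes F: "prob_space F"
  shows "prob_space.indep_vars (PiM I (\<lambda>_. F)) (\<lambda>_. F) (\<lambda>i u. u i) I"
proof -
  interpret P: prob_space "PiM I (\<lambda>_. F)" by (intro prob_space_PiM F)
  show ?thesis
  proof (cases "I = {}")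
    case True
    then show ?thesis unfolding P.indep_vars_def P.indep_sets_def by simp
  next
    case False
    have "distr (PiM I (\<lambda>_. F)) (PiM I (\<lambda>_. F)) (\<lambda>u. \<lambda>i\<in>I. u i) = distr (PiM I (\<lambda>_. F)) (PiM I (\<lambda>_. F)) (\<lambda>u. u)"
      by (intro distr_cong refl) (auto simp: space_PiM)
    also have "\<dots> = PiM I (\<lambda>_. F)" by (rule distr_id)
    also have "\<dots> = PiM I (\<lambda>i. distr (PiM I (\<lambda>_. F)) F (\<lambda>u. u i))"
      by (intro PiM_cong refl distr_PiM_component[symmetric] F)
    finally show ?thesis
      by (subst P.indep_vars_iff_distr_eq_PiM'[OF False]) auto
  qed
qed

lemma
  fixes F :: "'b measure" and j T n0 :: nat
  assumes F: "prob_space F" and j: "j < T"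
  shows measurable_window_coordinates: "(\<lambda>u. \<lambda>r\<in>{..<n0}. u (j * n0 + r))
      \<in> measurable (PiM {..<T * n0} (\<lambda>_. F)) (PiM {..<n0} (\<lambda>_. F))"
    and distr_window_coordinates: "distr (PiM {..<T * n0} (\<lambda>_. F)) (PiM {..<n0} (\<lambda>_. F))
      (\<lambda>u. \<lambda>r\<in>{..<n0}. u (j * n0 + r)) = PiM {..<n0} (\<lambda>_. F)"
proof -
  have idx: "j * n0 + r < T * n0" if "r < n0" for r
    by (rule subsetD[OF window_subset[OF j, of n0], simplified]) (use that in \<open>simp add: window_def\<close>)
  show "(\<lambda>u. \<lambda>r\<in>{..<n0}. u (j * n0 + r)) \<in> measurable (PiM {..<T * n0} (\<lambda>_. F)) (PiM {..<n0} (\<lambda>_. F))"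
    by (intro measurable_restrict measurable_component_singleton) (use idx in auto)
  show "distr (PiM {..<T * n0} (\<lambda>_. F)) (PiM {..<n0} (\<lambda>_. F)) (\<lambda>u. \<lambda>r\<in>{..<n0}. u (j * n0 + r)) = PiM {..<n0} (\<lambda>_. F)"
    by (rule distr_PiM_reindex) (use F idx in \<open>auto simp: inj_on_def\<close>)
qed

text \<open>Scatter matrices of different windows are functions of disjoint blocks of independent predictors, and
they have the same law because each block has the law of the first \<open>n0\<close> coordinates. The weak law
applies to each entry.\<close>

lemma expected_scatter_deviation_tendsto_0:
  fixes F :: "(real^'p) measure" and T :: "nat \<Rightarrow> nat"
  assumes F: "prob_space F" and sF: "sets F = sets borel" and third: "integrable F (\<lambda>u. norm u ^ 3)"
    and n0: "n0 \<ge> 2" and T: "filterlim T at_top sequentially"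
    and w: "\<And>m j. j < T m \<Longrightarrow> \<bar>w m j\<bar> \<le> W"
  shows "(\<lambda>m. LINT u|PiM {..<T m * n0} (\<lambda>_. F).
      \<bar>scaled_scatter n0 (T m) (w m) u $ k $ l - (\<Sum>j<T m. w m j) / T m * cov_mat F $ k $ l\<bar>) \<longlonglongrightarrow> 0"
proof -
  define Y where "Y j u = window_scatter n0 u j $ k $ l / (real n0 - 1)" for j and u :: "nat \<Rightarrow> real^'p"
  define b where "b u = block_scatter n0 u $ k $ l / (real n0 - 1)" for u :: "nat \<Rightarrow> real^'p"
  define D where "D = distr (PiM {..<n0} (\<lambda>_. F)) borel b"
  have pos: "real n0 - 1 > 0" "n0 > 0" using n0 by auto
  have sPi: "sets (PiM I (\<lambda>_. F)) = sets (PiM I (\<lambda>_. borel))" for I :: "nat set"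
    by (intro sets_PiM_cong) (auto simp: sF)
  have b [measurable]: "b \<in> borel_measurable (PiM {..<n0} (\<lambda>_. F))"
    unfolding b_def measurable_cong_sets[OF sPi refl] by measurable
  have Yb: "Y j u = b (\<lambda>r\<in>{..<n0}. u (j * n0 + r))" for j u
    by (simp add: Y_def b_def window_scatter_eq_block_scatter[OF pos(2)])
  have bint: "integrable (PiM {..<n0} (\<lambda>_. F)) b"
    unfolding b_def using integrable_block_scatter[OF F sF third pos(2)] by simp
  have bval: "(LINT u|PiM {..<n0} (\<lambda>_. F). b u) = cov_mat F $ k $ l"
    unfolding b_def using integral_block_scatter[OF F sF third pos(2)] pos by simp
  have Pm: "prob_space (PiM {..<T m * n0} (\<lambda>_. F))" for m by (intro prob_space_PiM F)
  have ind: "prob_space.indep_vars (PiM {..<T m * n0} (\<lambda>_. F)) (\<lambda>_. borel) Y {..<T m}" for m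
  proof -
    interpret P: prob_space "PiM {..<T m * n0} (\<lambda>_. F)" by (rule Pm)
    have "P.indep_vars (\<lambda>j. PiM (window n0 j) (\<lambda>_. F)) (\<lambda>j u. restrict (\<lambda>i. u i) (window n0 j)) {..<T m}"
    proof (rule P.indep_vars_restrict[OF indep_vars_PiM_coordinates[OF F]])
      show "disjoint_family_on (window n0) {..<T m}"
        unfolding disjoint_family_on_def using window_div by blast
    qed (use window_subset in auto)
    then have "P.indep_vars (\<lambda>_. borel) (\<lambda>j u. b (\<lambda>r\<in>{..<n0}. (restrict (\<lambda>i. u i) (window n0 j)) (j * n0 + r))) {..<T m}"
    proof (rule P.indep_vars_compose2)
      fix j assume "j \<in> {..<T m}"
      have "(\<lambda>v. \<lambda>r\<in>{..<n0}. v (j * n0 + r)) \<in> measurable (PiM (window n0 j) (\<lambda>_. F)) (PiM {..<n0} (\<lambda>_. F))"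
        by (intro measurable_restrict measurable_component_singleton) (auto simp: window_def)
      then show "(\<lambda>v. b (\<lambda>r\<in>{..<n0}. v (j * n0 + r))) \<in> borel_measurable (PiM (window n0 j) (\<lambda>_. F))"
        using b by (rule measurable_compose)
    qed
    moreover have "b (\<lambda>r\<in>{..<n0}. (restrict (\<lambda>i. u i) (window n0 j)) (j * n0 + r)) = Y j u" for j u
      unfolding Yb by (intro arg_cong[where f = b]) (auto simp: restrict_def window_def)
    ultimately show ?thesis by simp
  qed
  have law: "distr (PiM {..<T m * n0} (\<lambda>_. F)) borel (Y j) = D" if "j < T m" for m j
  proof -
    have "D = distr (distr (PiM {..<T m * n0} (\<lambda>_. F)) (PiM {..<n0} (\<lambda>_. F)) (\<lambda>u. \<lambda>r\<in>{..<n0}. u (j * n0 + r))) borel b"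
      by (simp add: D_def distr_window_coordinates[OF F that])
    also have "\<dots> = distr (PiM {..<T m * n0} (\<lambda>_. F)) borel (b \<circ> (\<lambda>u. \<lambda>r\<in>{..<n0}. u (j * n0 + r)))"
      by (rule distr_distr[OF b measurable_window_coordinates[OF F that]])
    also have "b \<circ> (\<lambda>u. \<lambda>r\<in>{..<n0}. u (j * n0 + r)) = Y j" by (rule ext) (simp add: Yb)
    finally show ?thesis by simp
  qed
  have Dint: "integrable D (\<lambda>s. s)" unfolding D_def using bint by (subst integrable_distr_eq) auto
  have Dval: "(LINT s|D. s) = cov_mat F $ k $ l" unfolding D_def using bval by (subst integral_distr) auto
  have eq: "(\<Sum>j<T m. w m j * (Y j u - cov_mat F $ k $ l)) / T m
      = scaled_scatter n0 (T m) (w m) u $ k $ l - (\<Sum>j<T m. w m j) / T m * cov_mat F $ k $ l" for m u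
    by (simp add: scaled_scatter_def Y_def algebra_simps sum_subtractf sum_distrib_left sum_distrib_right
        sum_divide_distrib diff_divide_distrib)
  have "(\<lambda>m. LINT u|PiM {..<T m * n0} (\<lambda>_. F). \<bar>(\<Sum>j<T m. w m j * (Y j u - (LINT s|D. s))) / T m\<bar>) \<longlonglongrightarrow> 0"
    by (rule weak_law_triangular_array[OF Pm ind _ Dint w T]) (simp_all add: law)
  then show ?thesis unfolding Dval eq .
qed

lemma integrable_scaled_scatter:
  fixes F :: "(real^'p) measure"
  assumes F: "prob_space F" and sF: "sets F = sets borel" and third: "integrable F (\<lambda>u. norm u ^ 3)"
    and n0: "n0 > 0"
  shows "integrable (PiM {..<T * n0} (\<lambda>_. F)) (\<lambda>u. scaled_scatter n0 T w u $ k $ l)"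
proof -
  have "integrable (PiM {..<T * n0} (\<lambda>_. F)) (\<lambda>u. window_scatter n0 u j $ k $ l)" if j: "j < T" for j
  proof -
    note int = integrable_block_scatter[OF F sF third n0, of k l]
    have "integrable (PiM {..<T * n0} (\<lambda>_. F)) (\<lambda>u. block_scatter n0 (\<lambda>r\<in>{..<n0}. u (j * n0 + r)) $ k $ l)"
      by (rule integrable_distr[OF measurable_window_coordinates[OF F j]])
        (unfold distr_window_coordinates[OF F j], rule int)
    then show ?thesis by (simp add: window_scatter_eq_block_scatter[OF n0])
  qed
  then have "integrable (PiM {..<T * n0} (\<lambda>_. F))
      (\<lambda>u. (1 / (real T * (real n0 - 1))) * (\<Sum>j<T. w j * window_scatter n0 u j $ k $ l))"
    by (intro integrable_mult_right Bochner_Integration.integrable_sum) auto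
  then show ?thesis by (simp add: scaled_scatter_def)
qed

section \<open>Asymptotic normality\<close>

text \<open>The normal equations solved for the estimation error.\<close>

lemma EM_error_eq:
  fixes x :: "nat \<Rightarrow> real^'p"
  assumes n0: "n0 \<ge> 2" and T: "T > 0"
    and y: "\<And>i. i < T * n0 \<Longrightarrow> y i = x i \<bullet> \<beta> + d (i div n0) + e i"
    and EM: "EM_estimate n0 (T * n0) x y b"
  defines "A \<equiv> scaled_scatter n0 T (\<lambda>_. 1) x"
  assumes det: "det A \<noteq> 0"
  shows "b - \<beta> = (\<Sum>i<T * n0. e i *\<^sub>R ((1 / (real T * (real n0 - 1))) *\<^sub>R (matrix_inv A *v within_dev n0 x i)))"
proof -
  let ?N = "real T * (real n0 - 1)"
  have "(\<Sum>j<T. window_scatter n0 x j) *v (b - \<beta>) = (\<Sum>i<T * n0. e i *\<^sub>R within_dev n0 x i)"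
    by (rule EM_estimate_normal_equations[OF _ y EM]) (use n0 in auto)
  then have "A *v (b - \<beta>) = (1 / ?N) *\<^sub>R (\<Sum>i<T * n0. e i *\<^sub>R within_dev n0 x i)"
    by (simp add: A_def scaled_scatter_def scaleR_matrix_vector_assoc[symmetric])
  then have "b - \<beta> = matrix_inv A *v ((1 / ?N) *\<^sub>R (\<Sum>i<T * n0. e i *\<^sub>R within_dev n0 x i))"
    using matrix_inv_vector_mult(2)[OF det, of "b - \<beta>"] by simp
  also have "\<dots> = (\<Sum>i<T * n0. matrix_inv A *v ((1 / ?N) *\<^sub>R (e i *\<^sub>R within_dev n0 x i)))"
    unfolding scaleR_sum_right by (rule linear_sum[OF matrix_vector_mul_linear])
  finally show ?thesis by (simp add: matrix_vector_mult_scaleR mult.commute)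
qed

text \<open>The number \<open>dev u\<close> measures how far the two scatter matrices of the predictors \<open>u\<close> are from
their targets. On the event \<open>dev < \<delta>\<close> the estimate is an explicit function of predictors and
errors, whose mean given the predictors is a \<open>gauss_mean\<close> within \<open>\<eta>\<close> of \<open>g0\<close>. On the
complement, where the estimate need not even be unique, the integrand is at most \<open>K + K'\<close>, and
the probability is at most the mean of \<open>dev\<close> divided by \<open>\<delta>\<close>.\<close>

lemma (in k_sample_model) EM_error_bound:
  fixes n0 :: nat and bhat :: "'a \<Rightarrow> real^'p" and f :: "real^'p \<Rightarrow> real"
  defines "n \<equiv> total_size k ns"
  defines "T \<equiv> n div n0"
  defines "A \<equiv> scaled_scatter n0 T (\<lambda>_. 1)"
  defines "B \<equiv> scaled_scatter n0 T (\<lambda>j. (\<sigma> (window_sample k ns n0 j))\<^sup>2)"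
  assumes n0: "n0 \<ge> 2" and dvd: "\<And>g. g < k \<Longrightarrow> n0 dvd ns g" and T: "T > 0"
    and \<sigma>: "\<And>g. g < k \<Longrightarrow> \<sigma> g > 0"
    and bhat [measurable]: "bhat \<in> borel_measurable M"
    and EM: "AE \<omega> in M. EM_estimate n0 n (\<lambda>i. x i \<omega>) (\<lambda>i. y i \<omega>) (bhat \<omega>)"
    and f: "continuous_on UNIV f" and K: "\<And>u. \<bar>f u\<bar> \<le> K" and g0: "\<bar>g0\<bar> \<le> K'"
    and dev: "integrable (PiM {..<n} (\<lambda>_. F)) dev" "\<And>u. dev u \<ge> 0" and \<delta>: "\<delta> > 0" and \<eta>: "\<eta> \<ge> 0"
    and close: "\<And>u. dev u < \<delta> \<Longrightarrow> det (A u) \<noteq> 0 \<and>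
      \<bar>gauss_mean f ((real n0 / (real n0 - 1)) *\<^sub>R (matrix_inv (A u) ** B u ** matrix_inv (A u))) - g0\<bar> \<le> \<eta>"
  shows "\<bar>(LINT \<omega>|M. f (sqrt (real n) *\<^sub>R (bhat \<omega> - \<beta>))) - g0\<bar>
    \<le> \<eta> + (K + K') * (LINT u|PiM {..<n} (\<lambda>_. F). dev u) / \<delta>"
proof -
  \<comment> \<open>the value \<open>1\<close> only serves to make \<open>w\<close> positive everywhere\<close>
  define w where "w j = (if j < T then \<sigma> (window_sample k ns n0 j) else 1)" for j
  have n0': "n0 > 0" using n0 by simp
  have "n0 dvd n" unfolding n_def total_size_def by (intro dvd_sum dvd) auto
  then have nT: "n = T * n0" by (simp add: T_def)
  then have n: "n > 0" using T n0' by simp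
  have idx: "i div n0 < T" if "i < n" for i using that nT by (simp add: less_mult_imp_div_less)
  have sample: "window_sample k ns n0 j < k" "window n0 j \<subseteq> sample_block ns (window_sample k ns n0 j)" if "j < T" for j
    using window_sample[OF n0' dvd] that by (auto simp: T_def n_def)
  have w: "w j > 0" for j using \<sigma> sample by (simp add: w_def)
  have in_block: "i \<in> sample_block ns (window_sample k ns n0 (i div n0))" if "i < n" for i
  proof -
    have "i \<in> window n0 (i div n0)" using n0' by (simp add: window_def dividend_less_div_times)
    then show ?thesis using sample(2)[OF idx[OF that]] by blast
  qed
  define d where "d i = c (window_sample k ns n0 i)" for i
  define e where "e i \<omega> = y i \<omega> - x i \<omega> \<bullet> \<beta> - d (i div n0)" for i \<omega>
  define X where "X \<omega> = (\<lambda>i\<in>{..<n}. x i \<omega>)" for \<omega>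
  define E where "E \<omega> = (\<lambda>i\<in>{..<n}. e i \<omega>)" for \<omega>
  define PX where "PX = PiM {..<n} (\<lambda>_. F)"
  define PE where "PE = PiM {..<n} (\<lambda>i. density lborel (\<lambda>t. ennreal (normal_density 0 (w (i div n0)) t)))"
  let ?S = "PiM {..<n} (\<lambda>_. borel :: (real^'p) measure)" and ?R = "PiM {..<n} (\<lambda>_. borel :: real measure)"
  note joint = joint_law_predictors_errors[of n0, folded n_def, OF n sample(1)[OF idx] in_block]
  have XE [measurable]: "(\<lambda>\<omega>. (X \<omega>, E \<omega>)) \<in> measurable M (?S \<Otimes>\<^sub>M ?R)"
    using joint(1) unfolding X_def E_def e_def d_def by simp
  have law: "distr M (?S \<Otimes>\<^sub>M ?R) (\<lambda>\<omega>. (X \<omega>, E \<omega>)) = PX \<Otimes>\<^sub>M PE"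
  proof -
    have "PE = PiM {..<n} (\<lambda>i. density lborel (\<lambda>t. ennreal (normal_density 0 (\<sigma> (window_sample k ns n0 (i div n0))) t)))"
      unfolding PE_def by (intro PiM_cong refl) (simp add: w_def idx)
    then show ?thesis using joint(2) unfolding X_def E_def e_def d_def PX_def by simp
  qed
  note F = predictor_law_prob_space[OF n[unfolded n_def]]
  interpret PX: prob_space PX unfolding PX_def by (intro prob_space_PiM F)
  interpret PE: prob_space PE unfolding PE_def by (intro prob_space_PiM prob_space_normal_density w)
  interpret P: pair_prob_space PX PE ..
  have sPX [measurable_cong]: "sets PX = sets ?S" unfolding PX_def by (intro sets_PiM_cong) (auto simp: F)
  have sPE [measurable_cong]: "sets PE = sets ?R" unfolding PE_def by (intro sets_PiM_cong) auto
  \<comment> \<open>\<open>cramer_inv\<close> makes the coefficients measurable in \<open>u\<close>, also where \<open>A u\<close> is singular\<close>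
  define a where "a u i = (sqrt (real (T * n0)) / (real T * (real n0 - 1))) *\<^sub>R (cramer_inv (A u) *v within_dev n0 u i)"
    for u :: "nat \<Rightarrow> real^'p" and i
  define H where "H u t = f (\<Sum>i<n. t i *\<^sub>R a u i)" for u and t :: "nat \<Rightarrow> real"
  define good where "good u = (if dev u < \<delta> then 1 else 0 :: real)" for u
  have fm [measurable]: "f \<in> borel_measurable borel" using f by (rule borel_measurable_continuous_onI)
  have am [measurable]: "(\<lambda>u. a u i) \<in> borel_measurable ?S" if "i < n" for i
    unfolding a_def A_def nT using that nT
    by (intro borel_measurable_scaleR borel_measurable_const borel_measurable_cramer_inv_mult measurable_scaled_scatter
        measurable_within_dev) auto
  have devm [measurable]: "dev \<in> borel_measurable ?S"
    using borel_measurable_integrable[OF dev(1)] unfolding PX_def[symmetric] measurable_cong_sets[OF sPX refl] .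
  have goodm [measurable]: "good \<in> borel_measurable ?S" unfolding good_def by measurable
  have Hm [measurable]: "(\<lambda>p. H (fst p) (snd p)) \<in> borel_measurable (?S \<Otimes>\<^sub>M ?R)"
    unfolding H_def by measurable
  have K0: "K \<ge> 0" "K' \<ge> 0" using K[of 0] g0 by linarith+
  have Hb: "\<bar>H u t - g0\<bar> \<le> K + K'" for u t
    using K[of "\<Sum>i<n. t i *\<^sub>R a u i"] g0 unfolding H_def by linarith
  have gb: "\<bar>good u\<bar> \<le> 1" for u by (simp add: good_def)
  define Z where "Z \<omega> = f (sqrt (real n) *\<^sub>R (bhat \<omega> - \<beta>))" for \<omega>
  have Zm [measurable]: "Z \<in> borel_measurable M" unfolding Z_def by measurable
  have Zb: "\<bar>Z \<omega> - g0\<bar> \<le> K + K'" for \<omega>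
    using K[of "sqrt (real n) *\<^sub>R (bhat \<omega> - \<beta>)"] g0 unfolding Z_def by linarith
  have Xm [measurable]: "X \<in> measurable M ?S"
    using measurable_compose[OF XE measurable_fst] by simp
  have AE: "AE \<omega> in M. good (X \<omega>) * (Z \<omega> - g0) = good (X \<omega>) * (H (X \<omega>) (E \<omega>) - g0)"
    using EM
  proof eventually_elim
    case (elim \<omega>)
    show ?case
    proof (cases "dev (X \<omega>) < \<delta>")
      case True
      have AX: "A (X \<omega>) = scaled_scatter n0 T (\<lambda>_. 1) (\<lambda>i. x i \<omega>)"
        unfolding A_def scaled_scatter_def X_def nT by (simp add: window_scatter_restrict)
      have det: "det (A (X \<omega>)) \<noteq> 0" using close[OF True] by simp
      have "bhat \<omega> - \<beta> = (\<Sum>i<T * n0. e i \<omega> *\<^sub>R ((1 / (real T * (real n0 - 1))) *\<^sub>R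
          (matrix_inv (A (X \<omega>)) *v within_dev n0 (\<lambda>i. x i \<omega>) i)))"
        unfolding AX
        by (rule EM_error_eq[OF n0 T _ elim[unfolded nT]]) (use det in \<open>auto simp: e_def AX\<close>)
      also have "\<dots> = (\<Sum>i<n. E \<omega> i *\<^sub>R ((1 / (real T * (real n0 - 1))) *\<^sub>R
          (cramer_inv (A (X \<omega>)) *v within_dev n0 (X \<omega>) i)))"
        unfolding nT matrix_inv_eq_cramer_inv[OF det, symmetric]
        by (intro sum.cong refl) (simp add: E_def X_def nT within_dev_restrict)
      finally have "sqrt (real n) *\<^sub>R (bhat \<omega> - \<beta>) = (\<Sum>i<n. E \<omega> i *\<^sub>R a (X \<omega>) i)"
        by (simp add: a_def scaleR_sum_right nT mult.commute)
      then show ?thesis by (simp add: Z_def H_def)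
    qed (simp add: good_def)
  qed
  have int_good: "integrable M (\<lambda>\<omega>. good (X \<omega>) * (Z \<omega> - g0))"
  proof (rule integrable_const_bound[where B = "1 * (K + K')"])
    show "AE \<omega> in M. norm (good (X \<omega>) * (Z \<omega> - g0)) \<le> 1 * (K + K')"
      unfolding real_norm_def abs_mult by (intro AE_I2 mult_mono gb Zb) auto
  qed measurable
  have int_bad: "integrable M (\<lambda>\<omega>. (1 - good (X \<omega>)) * (Z \<omega> - g0))"
  proof (rule integrable_const_bound[where B = "1 * (K + K')"])
    show "AE \<omega> in M. norm ((1 - good (X \<omega>)) * (Z \<omega> - g0)) \<le> 1 * (K + K')"
      unfolding real_norm_def abs_mult by (intro AE_I2 mult_mono Zb) (auto simp: good_def)
  qed measurable
  have lawX: "distr M ?S X = PX"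
  proof -
    have "distr M ?S X = distr (distr M (?S \<Otimes>\<^sub>M ?R) (\<lambda>\<omega>. (X \<omega>, E \<omega>))) ?S fst"
      by (subst distr_distr) (auto simp: comp_def)
    also have "\<dots> = distr (PX \<Otimes>\<^sub>M PE) PX fst" unfolding law by (intro distr_cong) (auto simp: sPX)
    also have "\<dots> = PX" by (rule PE.distr_pair_fst)
    finally show ?thesis .
  qed
  have split: "(LINT \<omega>|M. Z \<omega>) - g0 = (LINT \<omega>|M. good (X \<omega>) * (Z \<omega> - g0)) + (LINT \<omega>|M. (1 - good (X \<omega>)) * (Z \<omega> - g0))"
  proof -
    have "(LINT \<omega>|M. good (X \<omega>) * (Z \<omega> - g0)) + (LINT \<omega>|M. (1 - good (X \<omega>)) * (Z \<omega> - g0))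
        = (LINT \<omega>|M. good (X \<omega>) * (Z \<omega> - g0) + (1 - good (X \<omega>)) * (Z \<omega> - g0))"
      by (rule Bochner_Integration.integral_add[OF int_good int_bad, symmetric])
    also have "\<dots> = (LINT \<omega>|M. Z \<omega> - g0)" by (simp add: algebra_simps)
    also have "\<dots> = (LINT \<omega>|M. Z \<omega>) - g0"
    proof -
      have "integrable M Z" by (rule integrable_const_bound[where B = K]) (auto simp: Z_def K)
      then show ?thesis by (simp add: prob_space)
    qed
    finally show ?thesis by simp
  qed
  \<comment> \<open>Markov's inequality for \<open>dev\<close>, multiplied by the bound of the integrand\<close>
  have bad: "\<bar>LINT \<omega>|M. (1 - good (X \<omega>)) * (Z \<omega> - g0)\<bar> \<le> (K + K') * (LINT u|PX. dev u) / \<delta>"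
  proof -
    have intd: "integrable M (\<lambda>\<omega>. dev (X \<omega>))"
      using dev(1) unfolding PX_def[symmetric] lawX[symmetric] by (subst (asm) integrable_distr_eq) auto
    have "\<bar>LINT \<omega>|M. (1 - good (X \<omega>)) * (Z \<omega> - g0)\<bar> \<le> (LINT \<omega>|M. \<bar>(1 - good (X \<omega>)) * (Z \<omega> - g0)\<bar>)"
      by (rule integral_abs_bound)
    also have "\<dots> \<le> (LINT \<omega>|M. (K + K') / \<delta> * dev (X \<omega>))"
    proof (rule integral_mono[OF integrable_abs[OF int_bad]])
      show "integrable M (\<lambda>\<omega>. (K + K') / \<delta> * dev (X \<omega>))" using intd by simp
      fix \<omega>
      show "\<bar>(1 - good (X \<omega>)) * (Z \<omega> - g0)\<bar> \<le> (K + K') / \<delta> * dev (X \<omega>)"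
      proof (cases "dev (X \<omega>) < \<delta>")
        case True
        then show ?thesis using K0 \<delta> dev(2)[of "X \<omega>"] by (simp add: good_def)
      next
        case False
        have "\<bar>Z \<omega> - g0\<bar> \<le> (K + K') * 1" using Zb by simp
        also have "\<dots> \<le> (K + K') * (dev (X \<omega>) / \<delta>)"
          using False \<delta> K0 by (intro mult_left_mono) auto
        finally show ?thesis using False by (simp add: good_def)
      qed
    qed
    also have "\<dots> = (K + K') / \<delta> * (LINT \<omega>|M. dev (X \<omega>))" by simp
    also have "(LINT \<omega>|M. dev (X \<omega>)) = (LINT u|PX. dev u)"
      unfolding lawX[symmetric] by (rule integral_distr[symmetric]) auto
    finally show ?thesis by simp
  qed
  \<comment> \<open>given predictors in the good event, the scaled estimation error is exactly normal\<close>
  have conditional: "\<bar>good u * ((LINT t|PE. H u t) - g0)\<bar> \<le> \<eta>" for u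
  proof (cases "dev u < \<delta>")
    case True
    note c = close[OF True]
    then have det: "det (A u) \<noteq> 0" by simp
    have a: "a u i = (sqrt (real (T * n0)) / (real T * (real n0 - 1))) *\<^sub>R (matrix_inv (A u) *v within_dev n0 u i)" for i
      by (simp add: a_def matrix_inv_eq_cramer_inv[OF det])
    note cov = conditional_covariance[OF n0 T w det[unfolded A_def], folded A_def, folded a, folded nT]
    have "(LINT t|PE. H u t) = gauss_mean f (\<Sum>i<n. (w (i div n0))\<^sup>2 *\<^sub>R outer (a u i) (a u i))"
      unfolding PE_def H_def by (rule integral_sum_normals[OF _ w f K cov(2)]) simp
    also have "\<dots> = gauss_mean f ((real n0 / (real n0 - 1)) *\<^sub>R (matrix_inv (A u) ** scaled_scatter n0 T (\<lambda>j. (w j)\<^sup>2) u ** matrix_inv (A u)))"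
      by (rule arg_cong[OF cov(1)])
    also have "scaled_scatter n0 T (\<lambda>j. (w j)\<^sup>2) u = B u"
      unfolding scaled_scatter_def B_def w_def by (intro arg_cong[where f = "\<lambda>v. _ *\<^sub>R v"] sum.cong) auto
    finally show ?thesis using c True by (simp add: good_def)
  qed (simp add: good_def \<eta>)
  have main: "\<bar>LINT \<omega>|M. good (X \<omega>) * (Z \<omega> - g0)\<bar> \<le> \<eta>"
  proof -
    have Gm: "(\<lambda>p. good (fst p) * (H (fst p) (snd p) - g0)) \<in> borel_measurable (?S \<Otimes>\<^sub>M ?R)" by measurable
    have "(LINT \<omega>|M. good (X \<omega>) * (Z \<omega> - g0)) = (LINT \<omega>|M. good (X \<omega>) * (H (X \<omega>) (E \<omega>) - g0))"
      by (rule integral_cong_AE[OF _ _ AE]) (use measurable_compose[OF XE Gm] in auto)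
    also have "\<dots> = (LINT p|distr M (?S \<Otimes>\<^sub>M ?R) (\<lambda>\<omega>. (X \<omega>, E \<omega>)). good (fst p) * (H (fst p) (snd p) - g0))"
      by (subst integral_distr[OF XE Gm]) simp
    also have "\<dots> = (LINT p|(PX \<Otimes>\<^sub>M PE). good (fst p) * (H (fst p) (snd p) - g0))" unfolding law ..
    also have "\<dots> = (LINT u|PX. LINT t|PE. good u * (H u t - g0))"
    proof -
      have "integrable (PX \<Otimes>\<^sub>M PE) (\<lambda>p. good (fst p) * (H (fst p) (snd p) - g0))"
      proof (rule P.integrable_const_bound[where B = "1 * (K + K')"])
        show "AE p in PX \<Otimes>\<^sub>M PE. norm (good (fst p) * (H (fst p) (snd p) - g0)) \<le> 1 * (K + K')"
          unfolding real_norm_def abs_mult by (intro AE_I2 mult_mono gb Hb) auto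
        show "(\<lambda>p. good (fst p) * (H (fst p) (snd p) - g0)) \<in> borel_measurable (PX \<Otimes>\<^sub>M PE)"
          unfolding measurable_cong_sets[OF sets_pair_measure_cong[OF sPX sPE] refl] by (rule Gm)
      qed
      from P.integral_fst'[OF this] show ?thesis by simp
    qed
    also have "\<dots> = (LINT u|PX. good u * ((LINT t|PE. H u t) - g0))"
    proof (rule Bochner_Integration.integral_cong[OF refl])
      fix u assume u: "u \<in> space PX"
      have "integrable PE (H u)"
      proof (rule PE.integrable_const_bound[where B = K])
        have "(\<lambda>t. H u t) \<in> borel_measurable ?R"
          unfolding H_def by measurable
        then show "H u \<in> borel_measurable PE" by simp
      qed (simp add: H_def K)
      then show "(LINT t|PE. good u * (H u t - g0)) = good u * ((LINT t|PE. H u t) - g0)"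
        by (simp add: PE.prob_space)
    qed
    finally have eq: "(LINT \<omega>|M. good (X \<omega>) * (Z \<omega> - g0)) = (LINT u|PX. good u * ((LINT t|PE. H u t) - g0))" .
    have Lm [measurable]: "(\<lambda>u. good u * ((LINT t|PE. H u t) - g0)) \<in> borel_measurable PX"
    proof -
      have "(\<lambda>(u, t). H u t) \<in> borel_measurable (PX \<Otimes>\<^sub>M PE)"
        unfolding measurable_cong_sets[OF sets_pair_measure_cong[OF sPX sPE] refl] using Hm by (simp add: case_prod_beta')
      from PE.borel_measurable_lebesgue_integral[OF this] show ?thesis
        using goodm unfolding measurable_cong_sets[OF sPX refl, symmetric]
        by (intro borel_measurable_times borel_measurable_diff borel_measurable_const)
    qed
    have "integrable PX (\<lambda>u. good u * ((LINT t|PE. H u t) - g0))"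
      by (rule PX.integrable_const_bound[where B = \<eta>]) (use conditional Lm in auto)
    then have "(LINT u|PX. \<bar>good u * ((LINT t|PE. H u t) - g0)\<bar>) \<le> (LINT u|PX. \<eta>)"
      by (intro integral_mono integrable_abs conditional) auto
    then have "(LINT u|PX. \<bar>good u * ((LINT t|PE. H u t) - g0)\<bar>) \<le> \<eta>"
      by (simp add: PX.prob_space)
    then show ?thesis unfolding eq by (rule order_trans[OF integral_abs_bound])
  qed
  show ?thesis using split main bad unfolding Z_def PX_def by linarith
qed

theorem theorem3:
  fixes M :: "nat \<Rightarrow> 'a measure"
    and k :: "nat \<Rightarrow> nat" and ns :: "nat \<Rightarrow> nat \<Rightarrow> nat"
    and c \<sigma> :: "nat \<Rightarrow> nat \<Rightarrow> real"
    and \<beta> :: "real^'p" and F :: "(real^'p) measure"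
    and x :: "nat \<Rightarrow> nat \<Rightarrow> 'a \<Rightarrow> real^'p" and \<nu> \<epsilon> y :: "nat \<Rightarrow> nat \<Rightarrow> 'a \<Rightarrow> real"
    and bhat :: "nat \<Rightarrow> 'a \<Rightarrow> real^'p"
    and n0 :: nat and \<sigma>_lo \<sigma>_hi :: real
  defines "n \<equiv> \<lambda>m. total_size (k m) (ns m)"
  assumes model: "\<And>m. k_sample_model (M m) (k m) (ns m) (c m) (\<sigma> m) \<beta> F (x m) (\<nu> m) (\<epsilon> m) (y m)"
    and sd_bounds: "0 < \<sigma>_lo" "\<sigma>_lo \<le> \<sigma>_hi" "\<And>m g. g < k m \<Longrightarrow> \<sigma> m g \<in> {\<sigma>_lo..\<sigma>_hi}"
    and window_size: "n0 \<ge> 2" "\<And>m g. g < k m \<Longrightarrow> n0 < ns m g"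
    and divisible: "\<And>m g. g < k m \<Longrightarrow> n0 dvd ns m g"
    and third_moment: "integrable F (\<lambda>u. norm u ^ 3)"
    and cov_pos_def: "pos_def (cov_mat F)"
    and T_to_infinity: "filterlim (\<lambda>m. n m div n0) at_top sequentially"
    and estimator_measurable: "\<And>m. bhat m \<in> borel_measurable (M m)"
    and estimator: "\<And>m. AE \<omega> in M m. EM_estimate n0 (n m) (\<lambda>i. x m i \<omega>) (\<lambda>i. y m i \<omega>) (bhat m \<omega>)"
  shows "(\<forall>m. avg_window_var (k m) (ns m) (\<sigma> m) n0 \<in> {\<sigma>_lo\<^sup>2..\<sigma>_hi\<^sup>2}) \<and>
    conv_in_distr
      (\<lambda>m. distr (M m) borel (\<lambda>\<omega>. sqrt (real (n m)) *\<^sub>R (bhat m \<omega> - \<beta>)))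
      (\<lambda>m. mv_normal 0
        ((real n0 / (real n0 - 1) * avg_window_var (k m) (ns m) (\<sigma> m) n0) *\<^sub>R matrix_inv (cov_mat F)))"
proof -
  have n0: "n0 > 0" using window_size(1) by simp
  define T where "T m = n m div n0" for m
  define s where "s m j = \<sigma> m (window_sample (k m) (ns m) n0 j)" for m j
  define t where "t m = avg_window_var (k m) (ns m) (\<sigma> m) n0" for m
  define r where "r = real n0 / (real n0 - 1)"
  define \<Sigma> where "\<Sigma> = cov_mat F"
  have r: "r > 0" using window_size(1) by (simp add: r_def)
  have nT: "n m = T m * n0" for m
  proof -
    have "n0 dvd n m" unfolding n_def total_size_def by (intro dvd_sum divisible) auto
    then show ?thesis by (simp add: T_def)
  qed
  have npos: "n m > 0" for m
  proof -
    have "0 < k m" using k_sample_model.k_pos[OF model, of m] by simp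
    then have "ns m 0 \<le> n m" unfolding n_def total_size_def by (intro member_le_sum) auto
    then show ?thesis using window_size(2)[OF \<open>0 < k m\<close>] by simp
  qed
  have Tpos: "T m > 0" for m using npos[of m] nT[of m] by (cases "T m") auto
  have t: "t m \<in> {\<sigma>_lo\<^sup>2..\<sigma>_hi\<^sup>2}" for m
    unfolding t_def using Tpos[of m]
    by (intro avg_window_var_bounds n0 divisible sd_bounds) (auto simp: T_def n_def)
  have s: "s m j \<in> {\<sigma>_lo..\<sigma>_hi}" if "j < T m" for m j
    unfolding s_def by (intro sd_bounds(3) window_sample(1)[OF n0 divisible]) (use that in \<open>auto simp: T_def n_def\<close>)
  note F = k_sample_model.predictor_law_prob_space[OF model npos[unfolded n_def]]
  have lo: "0 < \<sigma>_lo\<^sup>2" using sd_bounds(1) by simp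
  have conv: "(\<lambda>m. (LINT u|distr (M m) borel (\<lambda>\<omega>. sqrt (real (n m)) *\<^sub>R (bhat m \<omega> - \<beta>)). f u)
      - (LINT u|mv_normal 0 ((r * t m) *\<^sub>R matrix_inv \<Sigma>). f u)) \<longlonglongrightarrow> 0"
    if f: "continuous_on UNIV f" "bounded (range f)" for f :: "real^'p \<Rightarrow> real"
  proof (rule LIMSEQ_I)
    fix \<eta> :: real assume \<eta>: "\<eta> > 0"
    have fm [measurable]: "f \<in> borel_measurable borel" using f(1) by (rule borel_measurable_continuous_onI)
    obtain K where K: "\<And>u. \<bar>f u\<bar> \<le> K" using f(2) unfolding bounded_iff by auto
    have inv: "pos_def (matrix_inv \<Sigma>)" unfolding \<Sigma>_def by (rule pos_def_matrix_inv[OF cov_pos_def])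
    define g where "g m = gauss_mean f ((r * t m) *\<^sub>R matrix_inv \<Sigma>)" for m
    \<comment> \<open>a bound of the target means that is valid for all sample sizes\<close>
    obtain K' where K': "\<And>v. v \<in> {\<sigma>_lo\<^sup>2..\<sigma>_hi\<^sup>2} \<Longrightarrow> \<bar>gauss_mean f (v *\<^sub>R r *\<^sub>R matrix_inv \<Sigma>)\<bar> \<le> K'"
      using bounded_gauss_mean_interval[OF pos_def_scaleR[OF inv r] lo fm K] by blast
    have gK': "\<bar>g m\<bar> \<le> K'" for m using K'[OF t[of m]] by (simp add: g_def mult.commute)
    have K0: "K + K' \<ge> 0" using K[of 0] gK'[of 0] by linarith
    obtain \<delta> where \<delta>: "\<delta> > 0" and close: "\<And>A B v. v \<in> {\<sigma>_lo\<^sup>2..\<sigma>_hi\<^sup>2} \<Longrightarrow>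
        (\<And>i j. \<bar>A $ i $ j - \<Sigma> $ i $ j\<bar> < \<delta>) \<Longrightarrow> (\<And>i j. \<bar>B $ i $ j - v * \<Sigma> $ i $ j\<bar> < \<delta>) \<Longrightarrow>
        det A \<noteq> 0 \<and> \<bar>gauss_mean f (r *\<^sub>R (matrix_inv A ** B ** matrix_inv A)) - gauss_mean f ((r * v) *\<^sub>R matrix_inv \<Sigma>)\<bar> < \<eta> / 2"
      using gauss_mean_uniformly_close[OF cov_pos_def r lo fm K, of "\<eta> / 2" "\<sigma>_hi\<^sup>2"] \<eta>
      unfolding \<Sigma>_def by (metis half_gt_zero)
    define A where "A m = (scaled_scatter n0 (T m) (\<lambda>_. 1) :: (nat \<Rightarrow> real^'p) \<Rightarrow> _)" for m
    define B where "B m = (scaled_scatter n0 (T m) (\<lambda>j. (s m j)\<^sup>2) :: (nat \<Rightarrow> real^'p) \<Rightarrow> _)" for m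
    \<comment> \<open>a sum over all entries, so that \<open>dev m u < \<delta>\<close> bounds each of them\<close>
    define dev where "dev m u = (\<Sum>a\<in>UNIV. \<Sum>b\<in>UNIV. \<bar>A m u $ a $ b - \<Sigma> $ a $ b\<bar> + \<bar>B m u $ a $ b - t m * \<Sigma> $ a $ b\<bar>)"
      for m u
    define P where "P m = PiM {..<n m} (\<lambda>_. F)" for m
    have P: "prob_space (P m)" for m unfolding P_def by (intro prob_space_PiM F)
    have intA: "integrable (P m) (\<lambda>u. \<bar>A m u $ a $ b - \<Sigma> $ a $ b\<bar>)" for m a b
    proof -
      interpret prob_space "P m" by (rule P)
      have "integrable (P m) (\<lambda>u. A m u $ a $ b)"
        unfolding A_def P_def nT by (rule integrable_scaled_scatter[OF F third_moment n0])
      then show ?thesis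
        by (intro integrable_abs Bochner_Integration.integrable_diff integrable_const)
    qed
    have intB: "integrable (P m) (\<lambda>u. \<bar>B m u $ a $ b - t m * \<Sigma> $ a $ b\<bar>)" for m a b
    proof -
      interpret prob_space "P m" by (rule P)
      have "integrable (P m) (\<lambda>u. B m u $ a $ b)"
        unfolding B_def P_def nT by (rule integrable_scaled_scatter[OF F third_moment n0])
      then show ?thesis
        by (intro integrable_abs Bochner_Integration.integrable_diff integrable_const)
    qed
    have intdev: "integrable (P m) (dev m)" for m
      unfolding dev_def by (intro Bochner_Integration.integrable_sum Bochner_Integration.integrable_add intA intB)
    have Tlim: "filterlim T at_top sequentially" using T_to_infinity by (simp add: T_def[abs_def])
    have limA: "(\<lambda>m. LINT u|P m. \<bar>A m u $ a $ b - \<Sigma> $ a $ b\<bar>) \<longlonglongrightarrow> 0" for a b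
      using expected_scatter_deviation_tendsto_0[OF F third_moment window_size(1) Tlim, of "\<lambda>_ _. 1" 1 a b] Tpos
      by (simp add: A_def P_def nT \<Sigma>_def less_imp_neq[symmetric])
    have limB: "(\<lambda>m. LINT u|P m. \<bar>B m u $ a $ b - t m * \<Sigma> $ a $ b\<bar>) \<longlonglongrightarrow> 0" for a b
    proof -
      have "\<bar>(s m j)\<^sup>2\<bar> \<le> \<sigma>_hi\<^sup>2" if "j < T m" for m j
        using s[OF that] sd_bounds(1) by (auto intro!: power_mono)
      moreover have "(\<Sum>j<T m. (s m j)\<^sup>2) / T m = t m" for m
        unfolding t_def avg_window_var_def Let_def s_def T_def n_def ..
      ultimately show ?thesis
        using expected_scatter_deviation_tendsto_0[OF F third_moment window_size(1) Tlim, of "\<lambda>m j. (s m j)\<^sup>2" "\<sigma>_hi\<^sup>2" a b]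
        by (simp add: B_def P_def nT \<Sigma>_def)
    qed
    have "(\<lambda>m. LINT u|P m. dev m u) \<longlonglongrightarrow> 0"
    proof -
      have "(LINT u|P m. dev m u) = (\<Sum>a\<in>UNIV. \<Sum>b\<in>UNIV.
          (LINT u|P m. \<bar>A m u $ a $ b - \<Sigma> $ a $ b\<bar>) + (LINT u|P m. \<bar>B m u $ a $ b - t m * \<Sigma> $ a $ b\<bar>))" for m
        unfolding dev_def by (simp add: Bochner_Integration.integral_sum intA intB)
      moreover have "(\<lambda>m. \<Sum>a\<in>UNIV. \<Sum>b\<in>UNIV.
          (LINT u|P m. \<bar>A m u $ a $ b - \<Sigma> $ a $ b\<bar>) + (LINT u|P m. \<bar>B m u $ a $ b - t m * \<Sigma> $ a $ b\<bar>))
          \<longlonglongrightarrow> (\<Sum>a\<in>(UNIV :: 'p set). \<Sum>b\<in>(UNIV :: 'p set). 0 + 0)"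
        by (intro tendsto_sum tendsto_add limA limB)
      ultimately show ?thesis by simp
    qed
    then have "(\<lambda>m. (K + K') * (LINT u|P m. dev m u) / \<delta>) \<longlonglongrightarrow> (K + K') * 0 / \<delta>"
      using \<delta> by (intro tendsto_intros) auto
    then have "\<forall>\<^sub>F m in sequentially. (K + K') * (LINT u|P m. dev m u) / \<delta> < \<eta> / 2"
      using \<eta> by (intro order_tendstoD(2)[where y = "(K + K') * 0 / \<delta>"]) auto
    then obtain no where no: "\<And>m. m \<ge> no \<Longrightarrow> (K + K') * (LINT u|P m. dev m u) / \<delta> < \<eta> / 2"
      unfolding eventually_sequentially by blast
    have dev_ge: "\<bar>A m u $ a $ b - \<Sigma> $ a $ b\<bar> \<le> dev m u" "\<bar>B m u $ a $ b - t m * \<Sigma> $ a $ b\<bar> \<le> dev m u" for m u a b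
    proof -
      let ?h = "\<lambda>a b. \<bar>A m u $ a $ b - \<Sigma> $ a $ b\<bar> + \<bar>B m u $ a $ b - t m * \<Sigma> $ a $ b\<bar>"
      have "?h a b \<le> (\<Sum>b\<in>UNIV. ?h a b)" by (rule member_le_sum) auto
      also have "\<dots> \<le> dev m u" unfolding dev_def
        by (rule member_le_sum[where f = "\<lambda>a. \<Sum>b\<in>UNIV. ?h a b"]) (auto intro!: sum_nonneg)
      finally show "\<bar>A m u $ a $ b - \<Sigma> $ a $ b\<bar> \<le> dev m u" "\<bar>B m u $ a $ b - t m * \<Sigma> $ a $ b\<bar> \<le> dev m u" by linarith+
    qed
    have bound: "\<bar>(LINT \<omega>|M m. f (sqrt (real (n m)) *\<^sub>R (bhat m \<omega> - \<beta>))) - g m\<bar> \<le> \<eta> / 2 + (K + K') * (LINT u|P m. dev m u) / \<delta>" for m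
      unfolding n_def P_def
    proof (rule k_sample_model.EM_error_bound[OF model window_size(1) divisible _ _ estimator_measurable
          estimator[unfolded n_def] f(1) K gK'])
      show "0 < total_size (k m) (ns m) div n0" using Tpos[of m] by (simp add: T_def n_def)
      show "0 < \<sigma> m g" if "g < k m" for g using sd_bounds(1) sd_bounds(3)[OF that] by auto
      show "integrable (PiM {..<total_size (k m) (ns m)} (\<lambda>_. F)) (dev m)"
        using intdev[of m] by (simp add: P_def n_def)
      show "dev m u \<ge> 0" for u unfolding dev_def by (intro sum_nonneg) auto
      show "0 < \<delta>" "0 \<le> \<eta> / 2" using \<delta> \<eta> by auto
      fix u assume "dev m u < \<delta>"
      then have "\<bar>A m u $ a $ b - \<Sigma> $ a $ b\<bar> < \<delta>" "\<bar>B m u $ a $ b - t m * \<Sigma> $ a $ b\<bar> < \<delta>" for a b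
        using dev_ge[of m u a b] by linarith+
      from close[OF t[of m] this]
      show "det (scaled_scatter n0 (total_size (k m) (ns m) div n0) (\<lambda>_. 1) u) \<noteq> 0 \<and>
        \<bar>gauss_mean f ((real n0 / (real n0 - 1)) *\<^sub>R (matrix_inv (scaled_scatter n0 (total_size (k m) (ns m) div n0) (\<lambda>_. 1) u) **
          scaled_scatter n0 (total_size (k m) (ns m) div n0) (\<lambda>j. (\<sigma> m (window_sample (k m) (ns m) n0 j))\<^sup>2) u **
          matrix_inv (scaled_scatter n0 (total_size (k m) (ns m) div n0) (\<lambda>_. 1) u))) - g m\<bar> \<le> \<eta> / 2"
        by (simp add: A_def B_def T_def n_def s_def r_def g_def)
    qed
    have target: "(LINT u|mv_normal 0 ((r * t m) *\<^sub>R matrix_inv \<Sigma>). f u) = g m" for m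
    proof -
      have "t m > 0" using t[of m] less_le_trans[OF lo] by simp
      then have "r * t m > 0" using r by simp
      then show ?thesis unfolding g_def by (intro integral_mv_normal pos_def_scaleR inv fm)
    qed
    have source: "(LINT u|distr (M m) borel (\<lambda>\<omega>. sqrt (real (n m)) *\<^sub>R (bhat m \<omega> - \<beta>)). f u)
        = (LINT \<omega>|M m. f (sqrt (real (n m)) *\<^sub>R (bhat m \<omega> - \<beta>)))" for m
      by (rule integral_distr) (use estimator_measurable[of m] in measurable)
    show "\<exists>no. \<forall>m\<ge>no. norm ((LINT u|distr (M m) borel (\<lambda>\<omega>. sqrt (real (n m)) *\<^sub>R (bhat m \<omega> - \<beta>)). f u)
      - (LINT u|mv_normal 0 ((r * t m) *\<^sub>R matrix_inv \<Sigma>). f u) - 0) < \<eta>"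
    proof (intro exI allI impI)
      fix m assume "no \<le> m"
      from no[OF this] bound[of m]
      show "norm ((LINT u|distr (M m) borel (\<lambda>\<omega>. sqrt (real (n m)) *\<^sub>R (bhat m \<omega> - \<beta>)). f u)
        - (LINT u|mv_normal 0 ((r * t m) *\<^sub>R matrix_inv \<Sigma>). f u) - 0) < \<eta>"
        unfolding source target real_norm_def by linarith
    qed
  qed
  show ?thesis
    using t conv unfolding conv_in_distr_def t_def r_def \<Sigma>_def by blast
qed

end
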